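(* Let $\mathbf f\in \mathbf L^2(\Omega)$ be such that $$\frac{4}{\gamma^2}\,C_S^2\Big(\frac{1}{\sqrt\nu}+\mathsf F\Big)\|\mathbf f\|_{0,\Omega}<1 .$$ Then the map $\mathscr F:\mathbf K\to\mathbf K$ (defined in the context) has a unique fixed point $\mathbf u\in\mathbf K$. Equivalently, the problem: find $((\mathbf u,\boldsymbol\omega),p)$ such that $$a(\mathbf u,\boldsymbol\omega;\mathbf v,\boldsymbol\theta)+b(\mathbf v,\boldsymbol\theta;p)+c^{\mathbf u}(\mathbf u,\boldsymbol\omega;\mathbf v,\boldsymbol\theta)=\int_\Omega\mathbf f\cdot\mathbf v,\qquad b(\mathbf u,\boldsymbol\omega;q)=0$$ for all $((\mathbf v,\boldsymbol\theta),q)\in[\mathbf V\times\mathbf L^2(\Omega)]\times L^2_0(\Omega)$, has a unique solution $((\mathbf u,\boldsymbol\omega),p)\in[\mathbf K\times\mathbf L^2(\Omega)]\times L^2_0(\Omega)$. Moreover $$\|((\mathbf u,\boldsymbol\omega),p)\|\le\frac{2}{\gamma}\|\mathbf f\|_{0,\Omega}.$$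
   Context: Setting. $\Omega\subset\mathbb R^3$ is a connected bounded polyhedral Lipschitz domain; $\nu>0$ and $\mathsf F>0$ are constants; $\kappa\in L^\infty(\Omega)$ satisfies $0<\kappa_{\min}\le\kappa(x)\le\kappa_{\max}$ a.e. in $\Omega$ for constants $\kappa_{\min},\kappa_{\max}$. $\|\cdot\|_{0,\Omega}$ is the $L^2(\Omega)$ norm, $\|\cdot\|_{1,\Omega}$ the $H^1(\Omega)$ norm, $\mathbf L^2(\Omega)=L^2(\Omega)^3$, and $L^2_0(\Omega)$ is the space of $L^2(\Omega)$ functions with zero mean. Space. $\mathbf V:=\mathbf H_0(\mathrm{div};\Omega)\cap\mathbf H_0(\mathbf{curl};\Omega)$ (vanishing normal, resp. tangential, trace on $\partial\Omega$), with $\|\mathbf v\|_{\mathbf V}^2:=\|\mathbf v\|_{0,\Omega}^2+\|\mathrm{div}\,\mathbf v\|_{0,\Omega}^2+\|\mathbf{curl}\,\mathbf v\|_{0,\Omega}^2$. The product norm is $\|((\mathbf v,\boldsymbol\theta),q)\|:=\|\mathbf v\|_{\mathbf V}+\|\boldsymbol\theta\|_{0,\Omega}+\|q\|_{0,\Omega}$. Forms. $$a(\mathbf u,\boldsymbol\omega;\mathbf v,\boldsymbol\theta):=\int_\Omega\kappa^{-1}\mathbf u\cdot\mathbf v+\sqrt\nu\int_\Omega\boldsymbol\omega\cdot\mathbf{curl}\,\mathbf v+\sqrt\nu\int_\Omega\boldsymbol\theta\cdot\mathbf{curl}\,\mathbf u-\int_\Omega\boldsymbol\omega\cdot\boldsymbol\theta,$$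 $$b(\mathbf v,\boldsymbol\theta;q):=-\int_\Omega q\,\mathrm{div}\,\mathbf v,\qquad c^{\widehat{\mathbf u}}(\mathbf u,\boldsymbol\omega;\mathbf v,\boldsymbol\theta):=-\frac1{\sqrt\nu}\int_\Omega(\widehat{\mathbf u}\times\boldsymbol\omega)\cdot\mathbf v+\mathsf F\int_\Omega|\widehat{\mathbf u}|\,\mathbf u\cdot\mathbf v .$$ Constants. $C_S>0$ is the constant of the Sobolev embedding $\|w\|_{L^{p}(\Omega)}\le C_S\|w\|_{1,\Omega}$ for $w\in H^1(\Omega)$ (used with $p=4$). $\beta>0$ is a constant with $$\sup_{\mathbf 0\ne(\mathbf v,\boldsymbol\theta)\in\mathbf V\times\mathbf L^2(\Omega)}\frac{b(\mathbf v,\boldsymbol\theta;q)}{\|\mathbf v\|_{\mathbf V}+\|\boldsymbol\theta\|_{0,\Omega}}\ge\beta\|q\|_{0,\Omega}\quad\forall q\in L^2_0(\Omega),$$ and $$\gamma:=\frac{\min\{2\kappa_{\max}^{-1},\nu,1\}\,\beta^2}{(\beta+\kappa_{\min}^{-1}+\sqrt\nu+2)^2}.$$ Fixed-point map. $\mathbf K:=\{\widehat{\mathbf u}\in\mathbf V:\ \|\widehat{\mathbf u}\|_{\mathbf V}\le\frac2\gamma\|\mathbf f\|_{0,\Omega}\}$, and for $\widehat{\mathbf u}\in\mathbf K$, $\mathscr F(\widehat{\mathbf u}):=\mathbf u$ is the velocity component of the solution $((\mathbf u,\boldsymbol\omega),p)\in[\mathbf V\times\mathbf L^2(\Omega)]\times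 L_0^2(\Omega)$ of the linearised problem $a(\mathbf u,\boldsymbol\omega;\mathbf v,\boldsymbol\theta)+b(\mathbf v,\boldsymbol\theta;p)+c^{\widehat{\mathbf u}}(\mathbf u,\boldsymbol\omega;\mathbf v,\boldsymbol\theta)=\int_\Omega\mathbf f\cdot\mathbf v$, $b(\mathbf u,\boldsymbol\omega;q)=0$ for all $((\mathbf v,\boldsymbol\theta),q)$. *)

theory Defs
  imports "HOL-Analysis.Analysis"
begin

text \<open>
  Elements of Lebesgue and Sobolev spaces are represented by functions on \<open>real^3\<close> of which only
  the values on \<open>\<Omega>\<close> matter; equality in these spaces is equality almost everywhere on \<open>\<Omega>\<close>.
\<close>

section \<open>Polyhedral Lipschitz domains\<close>

text \<open>Near each boundary point, \<open>\<Omega>\<close> is the strict epigraph, in some direction \<open>e\<close>, of a Lipschitz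
  function on the plane orthogonal to \<open>e\<close>.\<close>

definition lipschitz_boundary :: "(real^3) set \<Rightarrow> bool" where
  "lipschitz_boundary \<Omega> \<longleftrightarrow>
     (\<forall>x\<in>frontier \<Omega>. \<exists>r>0. \<exists>e L g. norm e = 1 \<and> L-lipschitz_on {z. z \<bullet> e = 0} (g :: real^3 \<Rightarrow> real) \<and>
        \<Omega> \<inter> ball x r = {y \<in> ball x r. g (y - (y \<bullet> e) *\<^sub>R e) < y \<bullet> e})"

text \<open>The polytopes below are convex, but their union need not be.\<close>

definition polyhedral_lipschitz_domain :: "(real^3) set \<Rightarrow> bool" where
  "polyhedral_lipschitz_domain \<Omega> \<longleftrightarrow>
     open \<Omega> \<and> connected \<Omega> \<and> \<Omega> \<noteq> {} \<and> bounded \<Omega> \<and> lipschitz_boundary \<Omega> \<and>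
     (\<exists>P. finite P \<and> (\<forall>S\<in>P. polytope S) \<and> closure \<Omega> = \<Union>P)"

section \<open>Lebesgue spaces\<close>

definition eq_ae :: "(real^3) set \<Rightarrow> (real^3 \<Rightarrow> 'b) \<Rightarrow> (real^3 \<Rightarrow> 'b) \<Rightarrow> bool" where
  "eq_ae \<Omega> u v \<longleftrightarrow> (AE x in lebesgue_on \<Omega>. u x = v x)"

definition Lp :: "nat \<Rightarrow> (real^3) set \<Rightarrow> (real^3 \<Rightarrow> 'b::real_normed_vector) set" where
  "Lp p \<Omega> = {u. u \<in> borel_measurable (lebesgue_on \<Omega>) \<and> integrable (lebesgue_on \<Omega>) (\<lambda>x. norm (u x) ^ p)}"

definition Lp_norm :: "nat \<Rightarrow> (real^3) set \<Rightarrow> (real^3 \<Rightarrow> 'b::real_normed_vector) \<Rightarrow> real" where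
  "Lp_norm p \<Omega> u = root p (\<integral>x. norm (u x) ^ p \<partial>lebesgue_on \<Omega>)"

definition L20 :: "(real^3) set \<Rightarrow> (real^3 \<Rightarrow> real) set" where
  "L20 \<Omega> = {q \<in> Lp 2 \<Omega>. (\<integral>x. q x \<partial>lebesgue_on \<Omega>) = 0}"

section \<open>Test functions\<close>

definition partial_deriv :: "3 \<Rightarrow> (real^3 \<Rightarrow> real) \<Rightarrow> real^3 \<Rightarrow> real" where
  "partial_deriv i \<phi> x = frechet_derivative \<phi> (at x) (axis i 1)"

primrec C_k :: "nat \<Rightarrow> (real^3 \<Rightarrow> real) \<Rightarrow> bool" where
  "C_k 0 \<phi> \<longleftrightarrow> continuous_on UNIV \<phi>"
| "C_k (Suc k) \<phi> \<longleftrightarrow> (\<forall>x. \<phi> differentiable (at x)) \<and> (\<forall>i. C_k k (partial_deriv i \<phi>))"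

definition test_functions :: "(real^3) set \<Rightarrow> (real^3 \<Rightarrow> real) set" where
  "test_functions \<Omega> =
     {\<phi>. (\<forall>k. C_k k \<phi>) \<and> compact (closure {x. \<phi> x \<noteq> 0}) \<and> closure {x. \<phi> x \<noteq> 0} \<subseteq> \<Omega>}"

definition grad :: "(real^3 \<Rightarrow> real) \<Rightarrow> real^3 \<Rightarrow> real^3" where
  "grad \<phi> x = (\<chi> i. partial_deriv i \<phi> x)"

definition curl :: "(real^3 \<Rightarrow> real^3) \<Rightarrow> real^3 \<Rightarrow> real^3" where
  "curl \<phi> x =
     vector [partial_deriv 2 (\<lambda>y. \<phi> y $ 3) x - partial_deriv 3 (\<lambda>y. \<phi> y $ 2) x,
             partial_deriv 3 (\<lambda>y. \<phi> y $ 1) x - partial_deriv 1 (\<lambda>y. \<phi> y $ 3) x,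
             partial_deriv 1 (\<lambda>y. \<phi> y $ 2) x - partial_deriv 2 (\<lambda>y. \<phi> y $ 1) x]"

section \<open>Weak derivatives\<close>

text \<open>A square-integrable weak derivative is determined up to a null set, so the choice made by
  \<open>SOME\<close> below does not affect any integral.\<close>

definition is_weak_grad :: "(real^3) set \<Rightarrow> (real^3 \<Rightarrow> real) \<Rightarrow> (real^3 \<Rightarrow> real^3) \<Rightarrow> bool" where
  "is_weak_grad \<Omega> w g \<longleftrightarrow> g \<in> Lp 2 \<Omega> \<and>
     (\<forall>\<phi>\<in>test_functions \<Omega>. \<forall>i.
        (\<integral>x. w x * partial_deriv i \<phi> x \<partial>lebesgue_on \<Omega>) = - (\<integral>x. g x $ i * \<phi> x \<partial>lebesgue_on \<Omega>))"

definition is_weak_div :: "(real^3) set \<Rightarrow> (real^3 \<Rightarrow> real^3) \<Rightarrow> (real^3 \<Rightarrow> real) \<Rightarrow> bool" where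
  "is_weak_div \<Omega> v d \<longleftrightarrow> d \<in> Lp 2 \<Omega> \<and>
     (\<forall>\<phi>\<in>test_functions \<Omega>.
        (\<integral>x. v x \<bullet> grad \<phi> x \<partial>lebesgue_on \<Omega>) = - (\<integral>x. d x * \<phi> x \<partial>lebesgue_on \<Omega>))"

definition is_weak_curl :: "(real^3) set \<Rightarrow> (real^3 \<Rightarrow> real^3) \<Rightarrow> (real^3 \<Rightarrow> real^3) \<Rightarrow> bool" where
  "is_weak_curl \<Omega> v c \<longleftrightarrow> c \<in> Lp 2 \<Omega> \<and>
     (\<forall>\<phi>. (\<forall>i. (\<lambda>x. \<phi> x $ i) \<in> test_functions \<Omega>) \<longrightarrow>
        (\<integral>x. v x \<bullet> curl \<phi> x \<partial>lebesgue_on \<Omega>) = (\<integral>x. c x \<bullet> \<phi> x \<partial>lebesgue_on \<Omega>))"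

definition weak_grad :: "(real^3) set \<Rightarrow> (real^3 \<Rightarrow> real) \<Rightarrow> real^3 \<Rightarrow> real^3" where
  "weak_grad \<Omega> w = (SOME g. is_weak_grad \<Omega> w g)"

definition weak_div :: "(real^3) set \<Rightarrow> (real^3 \<Rightarrow> real^3) \<Rightarrow> real^3 \<Rightarrow> real" where
  "weak_div \<Omega> v = (SOME d. is_weak_div \<Omega> v d)"

definition weak_curl :: "(real^3) set \<Rightarrow> (real^3 \<Rightarrow> real^3) \<Rightarrow> real^3 \<Rightarrow> real^3" where
  "weak_curl \<Omega> v = (SOME c. is_weak_curl \<Omega> v c)"

section \<open>Sobolev spaces\<close>

definition H1 :: "(real^3) set \<Rightarrow> (real^3 \<Rightarrow> real) set" where
  "H1 \<Omega> = {w \<in> Lp 2 \<Omega>. \<exists>g. is_weak_grad \<Omega> w g}"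

definition H1_norm :: "(real^3) set \<Rightarrow> (real^3 \<Rightarrow> real) \<Rightarrow> real" where
  "H1_norm \<Omega> w = sqrt ((Lp_norm 2 \<Omega> w)\<^sup>2 + (Lp_norm 2 \<Omega> (weak_grad \<Omega> w))\<^sup>2)"

definition H1_vec :: "(real^3) set \<Rightarrow> (real^3 \<Rightarrow> real^3) set" where
  "H1_vec \<Omega> = {\<phi>. \<forall>i. (\<lambda>x. \<phi> x $ i) \<in> H1 \<Omega>}"

definition H_div :: "(real^3) set \<Rightarrow> (real^3 \<Rightarrow> real^3) set" where
  "H_div \<Omega> = {v \<in> Lp 2 \<Omega>. \<exists>d. is_weak_div \<Omega> v d}"

definition H_curl :: "(real^3) set \<Rightarrow> (real^3 \<Rightarrow> real^3) set" where
  "H_curl \<Omega> = {v \<in> Lp 2 \<Omega>. \<exists>c. is_weak_curl \<Omega> v c}"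

text \<open>The normal trace of \<open>v\<close> in \<open>H(div)\<close> and the tangential trace of \<open>v\<close> in \<open>H(curl)\<close> are the
  functionals on (traces of) \<open>H\<^sup>1\<close> functions given by Green's formulas; for smooth data they are
  the surface integrals over \<open>frontier \<Omega>\<close> of \<open>(v \<bullet> n) \<phi>\<close> and of \<open>(n \<times> v) \<bullet> \<phi>\<close>.\<close>

definition normal_trace :: "(real^3) set \<Rightarrow> (real^3 \<Rightarrow> real^3) \<Rightarrow> (real^3 \<Rightarrow> real) \<Rightarrow> real" where
  "normal_trace \<Omega> v \<phi> =
     (\<integral>x. v x \<bullet> weak_grad \<Omega> \<phi> x \<partial>lebesgue_on \<Omega>) + (\<integral>x. weak_div \<Omega> v x * \<phi> x \<partial>lebesgue_on \<Omega>)"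

definition tangential_trace :: "(real^3) set \<Rightarrow> (real^3 \<Rightarrow> real^3) \<Rightarrow> (real^3 \<Rightarrow> real^3) \<Rightarrow> real" where
  "tangential_trace \<Omega> v \<phi> =
     (\<integral>x. weak_curl \<Omega> v x \<bullet> \<phi> x \<partial>lebesgue_on \<Omega>) - (\<integral>x. v x \<bullet> weak_curl \<Omega> \<phi> x \<partial>lebesgue_on \<Omega>)"

definition H0_div :: "(real^3) set \<Rightarrow> (real^3 \<Rightarrow> real^3) set" where
  "H0_div \<Omega> = {v \<in> H_div \<Omega>. \<forall>\<phi>\<in>H1 \<Omega>. normal_trace \<Omega> v \<phi> = 0}"

definition H0_curl :: "(real^3) set \<Rightarrow> (real^3 \<Rightarrow> real^3) set" where
  "H0_curl \<Omega> = {v \<in> H_curl \<Omega>. \<forall>\<phi>\<in>H1_vec \<Omega>. tangential_trace \<Omega> v \<phi> = 0}"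

definition V_space :: "(real^3) set \<Rightarrow> (real^3 \<Rightarrow> real^3) set" where
  "V_space \<Omega> = H0_div \<Omega> \<inter> H0_curl \<Omega>"

definition V_norm :: "(real^3) set \<Rightarrow> (real^3 \<Rightarrow> real^3) \<Rightarrow> real" where
  "V_norm \<Omega> v = sqrt ((Lp_norm 2 \<Omega> v)\<^sup>2 + (Lp_norm 2 \<Omega> (weak_div \<Omega> v))\<^sup>2
                        + (Lp_norm 2 \<Omega> (weak_curl \<Omega> v))\<^sup>2)"

definition prod_norm ::
    "(real^3) set \<Rightarrow> (real^3 \<Rightarrow> real^3) \<Rightarrow> (real^3 \<Rightarrow> real^3) \<Rightarrow> (real^3 \<Rightarrow> real) \<Rightarrow> real" where
  "prod_norm \<Omega> v \<theta> q = V_norm \<Omega> v + Lp_norm 2 \<Omega> \<theta> + Lp_norm 2 \<Omega> q"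

section \<open>Forms, weak problem and fixed-point map\<close>

definition form_a ::
    "(real^3) set \<Rightarrow> (real^3 \<Rightarrow> real) \<Rightarrow> real \<Rightarrow> (real^3 \<Rightarrow> real^3) \<Rightarrow> (real^3 \<Rightarrow> real^3) \<Rightarrow>
     (real^3 \<Rightarrow> real^3) \<Rightarrow> (real^3 \<Rightarrow> real^3) \<Rightarrow> real" where
  "form_a \<Omega> \<kappa> \<nu> u \<omega> v \<theta> =
     (\<integral>x. inverse (\<kappa> x) * (u x \<bullet> v x) \<partial>lebesgue_on \<Omega>)
     + sqrt \<nu> * (\<integral>x. \<omega> x \<bullet> weak_curl \<Omega> v x \<partial>lebesgue_on \<Omega>)
     + sqrt \<nu> * (\<integral>x. \<theta> x \<bullet> weak_curl \<Omega> u x \<partial>lebesgue_on \<Omega>)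
     - (\<integral>x. \<omega> x \<bullet> \<theta> x \<partial>lebesgue_on \<Omega>)"

definition form_b ::
    "(real^3) set \<Rightarrow> (real^3 \<Rightarrow> real^3) \<Rightarrow> (real^3 \<Rightarrow> real^3) \<Rightarrow> (real^3 \<Rightarrow> real) \<Rightarrow> real" where
  "form_b \<Omega> v \<theta> q = - (\<integral>x. q x * weak_div \<Omega> v x \<partial>lebesgue_on \<Omega>)"

definition form_c ::
    "(real^3) set \<Rightarrow> real \<Rightarrow> real \<Rightarrow> (real^3 \<Rightarrow> real^3) \<Rightarrow> (real^3 \<Rightarrow> real^3) \<Rightarrow> (real^3 \<Rightarrow> real^3) \<Rightarrow>
     (real^3 \<Rightarrow> real^3) \<Rightarrow> (real^3 \<Rightarrow> real^3) \<Rightarrow> real" where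
  "form_c \<Omega> \<nu> F u' u \<omega> v \<theta> =
     - (1 / sqrt \<nu>) * (\<integral>x. cross3 (u' x) (\<omega> x) \<bullet> v x \<partial>lebesgue_on \<Omega>)
     + F * (\<integral>x. norm (u' x) * (u x \<bullet> v x) \<partial>lebesgue_on \<Omega>)"

text \<open>\<open>u'\<close> is the frozen velocity; the nonlinear problem is the case \<open>u' = u\<close>.\<close>

definition is_solution ::
    "(real^3) set \<Rightarrow> real \<Rightarrow> real \<Rightarrow> (real^3 \<Rightarrow> real) \<Rightarrow> (real^3 \<Rightarrow> real^3) \<Rightarrow> (real^3 \<Rightarrow> real^3) \<Rightarrow>
     (real^3 \<Rightarrow> real^3) \<Rightarrow> (real^3 \<Rightarrow> real^3) \<Rightarrow> (real^3 \<Rightarrow> real) \<Rightarrow> bool" where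
  "is_solution \<Omega> \<nu> F \<kappa> f u' u \<omega> p \<longleftrightarrow>
     u \<in> V_space \<Omega> \<and> \<omega> \<in> Lp 2 \<Omega> \<and> p \<in> L20 \<Omega> \<and>
     (\<forall>v\<in>V_space \<Omega>. \<forall>\<theta>\<in>Lp 2 \<Omega>.
        form_a \<Omega> \<kappa> \<nu> u \<omega> v \<theta> + form_b \<Omega> v \<theta> p + form_c \<Omega> \<nu> F u' u \<omega> v \<theta>
          = (\<integral>x. f x \<bullet> v x \<partial>lebesgue_on \<Omega>)) \<and>
     (\<forall>q\<in>L20 \<Omega>. form_b \<Omega> u \<omega> q = 0)"

definition K_set :: "(real^3) set \<Rightarrow> real \<Rightarrow> (real^3 \<Rightarrow> real^3) \<Rightarrow> (real^3 \<Rightarrow> real^3) set" where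
  "K_set \<Omega> \<gamma> f = {u \<in> V_space \<Omega>. V_norm \<Omega> u \<le> 2 / \<gamma> * Lp_norm 2 \<Omega> f}"

definition fixpoint_map ::
    "(real^3) set \<Rightarrow> real \<Rightarrow> real \<Rightarrow> (real^3 \<Rightarrow> real) \<Rightarrow> (real^3 \<Rightarrow> real^3) \<Rightarrow> (real^3 \<Rightarrow> real^3) \<Rightarrow>
     real^3 \<Rightarrow> real^3" where
  "fixpoint_map \<Omega> \<nu> F \<kappa> f u' = (SOME u. \<exists>\<omega> p. is_solution \<Omega> \<nu> F \<kappa> f u' u \<omega> p)"

end

theory Submission
  imports Defs
begin

text \<open>
  A field in \<open>V\<close>, extended by zero, has divergence and curl in \<open>L\<^sup>2(\<real>\<^sup>3)\<close>, because both traces vanish.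
  Mollifying it and using \<open>\<integral>\<bar>\<nabla>v\<bar>\<^sup>2 = \<integral>\<bar>div v\<bar>\<^sup>2 + \<integral>\<bar>curl v\<bar>\<^sup>2\<close> on the whole space, the scalar Sobolev inequality
  yields \<open>\<parallel>v\<parallel>\<close> in \<open>L\<^sup>4\<close> at most \<open>C\<^sub>S\<close> times \<open>\<parallel>v\<parallel>\<close> in \<open>V\<close>, which controls the two trilinear terms.

  Elimination of \<open>\<omega> = \<surd>\<nu> curl u\<close> turns the linearised problem into a saddle point problem for \<open>(u, p)\<close>.
  For \<open>u'\<close> in \<open>K\<close> the smallness condition makes the convective term a small perturbation of a form that is
  coercive on divergence free fields, so Brezzi's theory applies. Necessarily \<open>\<beta> \<le> 1\<close>, and then \<open>\<gamma>\<close>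
  is so small compared with the coercivity constant that solutions stay in \<open>K\<close> and the solution map
  contracts \<open>K\<close> with factor \<open>4/27\<close>.
\<close>

section \<open>Hilbert spaces up to null vectors\<close>

text \<open>Functions that agree almost everywhere are not identified, and \<open>weak_div\<close>,
  \<open>weak_curl\<close> and \<open>fixpoint_map\<close> are mere choices. Distance zero therefore
  replaces equality throughout, and fixed points are unique only up to null sets. The embedding must
  cost exactly C_S, since the smallness condition offers C_S^2 and no further factor. This is
  possible because the gradient identity on the whole space is exact, and because it is the squares
  of the components that are added, in L2, rather than the components in L4. The convective term
  does not vanish when a solution is tested with itself, so it has to be absorbed. With
  \<open>\<alpha> = min (inverse \<kappa>max) \<nu>\<close> and r the radius of K, the smallness
  condition gives C_S^2 (1 / sqrt \<nu> + F) r \<le> \<gamma> / 2. Two properties of \<gamma> do the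
  rest. Hence 4/27 = (4/3) (1/9). The bound \<beta> \<le> 1 behind both holds because the norm of V
  dominates the norm of the divergence.\<close>

text \<open>The single operation \<open>axpy a x y\<close> stands for \<open>a x + y\<close>. No vector space axiom is imposed on
  the elements themselves: only inner products are ever compared, so elements at distance \<open>0\<close>
  need not be equal.\<close>

locale semi_hilbert =
  fixes S :: "'a set" and axpy :: "real \<Rightarrow> 'a \<Rightarrow> 'a \<Rightarrow> 'a" and ip :: "'a \<Rightarrow> 'a \<Rightarrow> real"
  assumes nonempty: "S \<noteq> {}"
    and axpy_in: "x \<in> S \<Longrightarrow> y \<in> S \<Longrightarrow> axpy a x y \<in> S"
    and ip_axpy: "x \<in> S \<Longrightarrow> y \<in> S \<Longrightarrow> z \<in> S \<Longrightarrow> ip (axpy a x y) z = a * ip x z + ip y z"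
    and ip_commute: "x \<in> S \<Longrightarrow> y \<in> S \<Longrightarrow> ip x y = ip y x"
    and ip_nonneg: "x \<in> S \<Longrightarrow> 0 \<le> ip x x"
    and complete: "(\<And>n::nat. X n \<in> S) \<Longrightarrow>
      (\<And>e. 0 < e \<Longrightarrow> \<exists>N. \<forall>m\<ge>N. \<forall>n\<ge>N. sqrt (ip (axpy (-1) (X n) (X m)) (axpy (-1) (X n) (X m))) < e) \<Longrightarrow>
      \<exists>x\<in>S. (\<lambda>n. sqrt (ip (axpy (-1) x (X n)) (axpy (-1) x (X n)))) \<longlonglongrightarrow> 0"
begin

section \<open>Geometry of a semi-inner product: Cauchy-Schwarz, distance, limits\<close>

definition nrm :: "'a \<Rightarrow> real" where "nrm x = sqrt (ip x x)"

definition dst :: "'a \<Rightarrow> 'a \<Rightarrow> real" where "dst x y = nrm (axpy (-1) y x)"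

lemma ip_axpy_right:
  "x \<in> S \<Longrightarrow> y \<in> S \<Longrightarrow> z \<in> S \<Longrightarrow> ip z (axpy a x y) = a * ip z x + ip z y"
  by (metis axpy_in ip_axpy ip_commute)

lemma nrm_sq: "x \<in> S \<Longrightarrow> (nrm x)\<^sup>2 = ip x x"
  by (simp add: nrm_def ip_nonneg)

lemma nrm_nonneg [simp]: "x \<in> S \<Longrightarrow> 0 \<le> nrm x"
  by (simp add: nrm_def ip_nonneg)

lemma dst_nonneg: "x \<in> S \<Longrightarrow> y \<in> S \<Longrightarrow> 0 \<le> dst x y"
  by (simp add: dst_def axpy_in)

text \<open>The square norm of t x + y is a nonnegative quadratic in t. If x is null it is affine,
  so its slope must vanish; this case is separate because a null vector need not be zero. Otherwise
  t is taken at the minimum.\<close>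

lemma cauchy_schwarz:
  assumes "x \<in> S" "y \<in> S"
  shows "\<bar>ip x y\<bar> \<le> nrm x * nrm y"
proof -
  have q: "0 \<le> t\<^sup>2 * ip x x + 2 * t * ip x y + ip y y" for t
  proof -
    have "0 \<le> ip (axpy t x y) (axpy t x y)"
      using assms axpy_in ip_nonneg by blast
    also have "\<dots> = t\<^sup>2 * ip x x + 2 * t * ip x y + ip y y"
      using assms by (simp add: ip_axpy ip_axpy_right axpy_in ip_commute[of y x] algebra_simps power2_eq_square)
    finally show ?thesis .
  qed
  have "(ip x y)\<^sup>2 \<le> ip x x * ip y y"
  proof (cases "ip x x = 0")
    case True
    have "ip x y = 0"
    proof (rule ccontr)
      assume n: "ip x y \<noteq> 0"
      \<comment> \<open>This value of t makes the affine function equal to -1.\<close>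
      have "0 \<le> 2 * (-(ip y y + 1) / (2 * ip x y)) * ip x y + ip y y"
        using q[of "-(ip y y + 1) / (2 * ip x y)"] True by simp
      then show False using n by (simp add: field_simps)
    qed
    then show ?thesis using True by simp
  next
    case False
    then have p: "ip x x > 0" using ip_nonneg[OF assms(1)] by simp
    have "0 \<le> ip x x * ((- ip x y / ip x x)\<^sup>2 * ip x x + 2 * (- ip x y / ip x x) * ip x y + ip y y)"
      using q[of "- ip x y / ip x x"] p by (simp only: mult_nonneg_nonneg less_imp_le)
    also have "\<dots> = ip x x * ip y y - (ip x y)\<^sup>2"
      using p by (simp add: field_simps power2_eq_square)
    finally show ?thesis by simp
  qed
  then have "sqrt ((ip x y)\<^sup>2) \<le> sqrt (ip x x * ip y y)" by (rule real_sqrt_le_mono)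
  then show ?thesis by (simp add: nrm_def real_sqrt_mult)
qed

lemma dst_sq:
  assumes "x \<in> S" "y \<in> S"
  shows "(dst x y)\<^sup>2 = ip x x - 2 * ip x y + ip y y"
  using assms by (simp add: dst_def nrm_sq axpy_in ip_axpy ip_axpy_right ip_commute[of y x])

lemma dst_commute: "x \<in> S \<Longrightarrow> y \<in> S \<Longrightarrow> dst x y = dst y x"
  by (rule power2_eq_imp_eq) (auto simp: dst_sq dst_nonneg ip_commute[of y x])

lemma dst_refl [simp]: "x \<in> S \<Longrightarrow> dst x x = 0"
  using dst_sq[of x x] by simp

lemma nrm_axpy_le:
  assumes "x \<in> S" "y \<in> S"
  shows "nrm (axpy a x y) \<le> \<bar>a\<bar> * nrm x + nrm y"
proof (rule power2_le_imp_le)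
  have "a * ip x y \<le> \<bar>a\<bar> * (nrm x * nrm y)"
    using mult_left_mono[OF cauchy_schwarz[OF assms], of "\<bar>a\<bar>"]
    by (simp flip: abs_mult)
  then show "(nrm (axpy a x y))\<^sup>2 \<le> (\<bar>a\<bar> * nrm x + nrm y)\<^sup>2"
    using assms
    by (simp add: nrm_sq axpy_in ip_axpy ip_axpy_right ip_commute[of y x] power2_sum power_mult_distrib)
       (simp add: algebra_simps power2_eq_square)
qed (use assms in simp)

text \<open>The elements x - z and (x - y) + (y - z) may differ, as no vector space law is
  available. Their square norms agree, which suffices.\<close>

lemma dst_triangle:
  assumes "x \<in> S" "y \<in> S" "z \<in> S"
  shows "dst x z \<le> dst x y + dst y z"
proof -
  let ?p = "axpy (-1) y x" and ?q = "axpy (-1) z y"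
  have "(dst x z)\<^sup>2 = (nrm (axpy 1 ?p ?q))\<^sup>2"
    using assms by (simp add: dst_sq nrm_sq axpy_in ip_axpy ip_axpy_right ip_commute[of y x]
        ip_commute[of z x] ip_commute[of z y])
  then have "dst x z = nrm (axpy 1 ?p ?q)"
    using assms by (auto simp: dst_nonneg axpy_in intro: power2_eq_imp_eq)
  also have "\<dots> \<le> dst x y + dst y z"
    using nrm_axpy_le[of ?p ?q 1] assms by (simp add: axpy_in dst_def)
  finally show ?thesis .
qed

lemma ip_tendsto:
  assumes "\<And>n. X n \<in> S" "x \<in> S" "(\<lambda>n. dst (X n) x) \<longlonglongrightarrow> 0" "y \<in> S"
  shows "(\<lambda>n. ip (X n) y) \<longlonglongrightarrow> ip x y"
proof -
  have "(\<lambda>n. ip (X n) y - ip x y) \<longlonglongrightarrow> 0"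
  proof (rule Lim_null_comparison)
    have "norm (ip (X n) y - ip x y) \<le> dst (X n) x * nrm y" for n
      using cauchy_schwarz[of "axpy (-1) x (X n)" y] assms by (simp add: axpy_in ip_axpy dst_def)
    then show "\<forall>\<^sub>F n in sequentially. norm (ip (X n) y - ip x y) \<le> dst (X n) x * nrm y" by simp
    show "(\<lambda>n. dst (X n) x * nrm y) \<longlonglongrightarrow> 0"
      using tendsto_mult_right[OF assms(3), of "nrm y"] by simp
  qed
  then show ?thesis by (simp add: LIM_zero_iff)
qed

lemma complete_dst:
  assumes "\<And>n::nat. X n \<in> S" "\<And>e. 0 < e \<Longrightarrow> \<exists>N. \<forall>m\<ge>N. \<forall>n\<ge>N. dst (X m) (X n) < e"
  obtains x where "x \<in> S" "(\<lambda>n. dst (X n) x) \<longlonglongrightarrow> 0"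
  using complete[of X] assms unfolding dst_def nrm_def by blast

text \<open>Banach's theorem. The conclusion is distance 0 instead of \<open>T x = x\<close>,
  because a limit is determined only up to null vectors; for the same reason closedness of
  \<open>K\<close> is required for every limit of a sequence.\<close>

lemma contraction_fixed_point:
  assumes K: "K \<subseteq> S" "K \<noteq> {}"
    and closed: "\<And>X x. (\<And>n. X n \<in> K) \<Longrightarrow> x \<in> S \<Longrightarrow> (\<lambda>n::nat. dst (X n) x) \<longlonglongrightarrow> 0 \<Longrightarrow> x \<in> K"
    and T: "\<And>x. x \<in> K \<Longrightarrow> T x \<in> K"
    and c: "0 \<le> c" "c < 1" "\<And>x y. x \<in> K \<Longrightarrow> y \<in> K \<Longrightarrow> dst (T x) (T y) \<le> c * dst x y"
  shows "\<exists>x\<in>K. dst (T x) x = 0"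
proof -
  obtain x0 where x0: "x0 \<in> K" using K by auto
  define X where "X n = (T ^^ n) x0" for n
  have XK: "X n \<in> K" for n by (induction n) (auto simp: X_def x0 T)
  then have XS: "X n \<in> S" for n using K by auto
  define d where "d = dst (X 1) (X 0)"
  have d0: "0 \<le> d" by (simp add: d_def dst_nonneg XS)
  have step: "dst (X (Suc n)) (X n) \<le> c ^ n * d" for n
  proof (induction n)
    case (Suc n)
    have "dst (X (Suc (Suc n))) (X (Suc n)) \<le> c * dst (X (Suc n)) (X n)"
      using c(3)[OF XK[of "Suc n"] XK[of n]] by (simp add: X_def)
    also have "\<dots> \<le> c * (c ^ n * d)" using Suc c by (intro mult_left_mono) auto
    finally show ?case by (simp add: mult.assoc)
  qed (simp add: d_def)
  \<comment> \<open>The closed form of the geometric sum is kept, since the cruder bound without the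
    last factor is not inductive in k.\<close>
  have far: "dst (X (n + k)) (X n) \<le> c ^ n * d / (1 - c) * (1 - c ^ k)" for n k
  proof (induction k)
    case (Suc k)
    have "dst (X (n + Suc k)) (X n) \<le> dst (X (Suc (n + k))) (X (n + k)) + dst (X (n + k)) (X n)"
      using dst_triangle[of "X (Suc (n + k))" "X (n + k)" "X n"] XS by simp
    also have "\<dots> \<le> c ^ (n + k) * d + c ^ n * d / (1 - c) * (1 - c ^ k)"
      using Suc step[of "n + k"] by simp
    also have "\<dots> = c ^ n * d / (1 - c) * (1 - c ^ Suc k)"
      using c by (simp add: field_simps power_add)
    finally show ?case .
  qed (simp add: XS)
  have far': "dst (X m) (X n) \<le> c ^ n * d / (1 - c)" if "n \<le> m" for m n
  proof -
    have "c ^ n * d / (1 - c) * (1 - c ^ (m - n)) \<le> c ^ n * d / (1 - c) * 1"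
      using c d0 by (intro mult_left_mono) auto
    then show ?thesis using far[of n "m - n"] that by simp
  qed
  have lim0: "(\<lambda>n. c ^ n * d / (1 - c)) \<longlonglongrightarrow> 0"
    using tendsto_mult_right[OF LIMSEQ_power_zero[of c], of "d / (1 - c)"] c by simp
  have "\<exists>N. \<forall>m\<ge>N. \<forall>n\<ge>N. dst (X m) (X n) < e" if e: "0 < e" for e
  proof -
    obtain N where N: "\<And>n. n \<ge> N \<Longrightarrow> c ^ n * d / (1 - c) < e"
      using order_tendstoD(2)[OF lim0 e] by (auto simp: eventually_sequentially)
    have "dst (X m) (X n) < e" if "m \<ge> N" "n \<ge> N" for m n
    proof (cases "n \<le> m")
      case True then show ?thesis using far' N that by (meson le_less_trans)
    next
      case False
      then have "dst (X n) (X m) < e" using far'[of m n] N[of m] that by simp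
      then show ?thesis using dst_commute XS by simp
    qed
    then show ?thesis by blast
  qed
  then obtain x where x: "x \<in> S" "(\<lambda>n. dst (X n) x) \<longlonglongrightarrow> 0"
    using complete_dst[of X] XS by blast
  have xK: "x \<in> K" using closed[of X x] XK x by blast
  then have TxS: "T x \<in> S" using T K by auto
  have "dst (T x) x \<le> c * dst (X n) x + dst (X (Suc n)) x" for n
  proof -
    have "dst (T x) x \<le> dst (T x) (X (Suc n)) + dst (X (Suc n)) x"
      using dst_triangle XS x TxS by blast
    also have "dst (T x) (X (Suc n)) \<le> c * dst (X n) x"
      using c(3)[OF xK XK[of n]] dst_commute[OF XS[of n] x(1)] by (simp add: X_def)
    finally show ?thesis by simp
  qed
  moreover have "(\<lambda>n. c * dst (X n) x + dst (X (Suc n)) x) \<longlonglongrightarrow> c * 0 + 0"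
    by (intro tendsto_intros x(2) LIMSEQ_Suc)
  ultimately have "dst (T x) x \<le> 0"
    by (simp add: LIMSEQ_le_const)
  then show ?thesis using xK dst_nonneg[OF TxS x(1)] by force
qed

text \<open>The representative minimises \<open>J\<close>, half the square norm minus
  \<open>l\<close>. The parallelogram identity turns a minimising sequence into a Cauchy sequence,
  and the first variation at its limit is the claim.\<close>

lemma riesz:
  assumes lin: "\<And>a x y. x \<in> S \<Longrightarrow> y \<in> S \<Longrightarrow> l (axpy a x y) = a * l x + l y"
    and bnd: "\<And>x. x \<in> S \<Longrightarrow> \<bar>l x\<bar> \<le> C * nrm x"
  obtains g where "g \<in> S" "\<And>x. x \<in> S \<Longrightarrow> ip g x = l x"
proof -
  define J where "J x = ip x x / 2 - l x" for x
  have Jbd: "- (C\<^sup>2 / 2) \<le> J x" if "x \<in> S" for x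
  proof -
    have "l x \<le> C * nrm x" using bnd[OF that] by simp
    moreover have "0 \<le> (nrm x)\<^sup>2 - 2 * (C * nrm x) + C\<^sup>2"
      using zero_le_power2[of "nrm x - C"] by (simp add: power2_diff algebra_simps)
    ultimately show ?thesis
      unfolding J_def using nrm_sq[OF that] by simp
  qed
  define m where "m = Inf (J ` S)"
  have bb: "bdd_below (J ` S)" using Jbd by (auto intro!: bdd_belowI)
  have mJ: "m \<le> J x" if "x \<in> S" for x unfolding m_def using that bb by (auto intro: cINF_lower)
  have "\<exists>x\<in>S. J x < m + 1 / real (Suc n)" for n
  proof -
    have "Inf (J ` S) < m + 1 / real (Suc n)" by (simp add: m_def)
    then show ?thesis using nonempty bb by (subst (asm) cInf_less_iff) auto
  qed
  then obtain X where X: "\<And>n. X n \<in> S" "\<And>n. J (X n) < m + 1 / real (Suc n)" by metis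
  have par: "(dst x y)\<^sup>2 \<le> 4 * (J x + J y - 2 * m)" if "x \<in> S" "y \<in> S" for x y
  proof -
    \<comment> \<open>Scaling alone is not an operation, so y / 2 is written as -(1/2) y + y;
      \<open>?z\<close> is the midpoint of x and y.\<close>
    let ?h = "axpy (-1/2) y y" let ?z = "axpy (1/2) x ?h"
    have "m \<le> J ?z" using that by (intro mJ axpy_in)
    also have "J ?z = (J x + J y) / 2 - (dst x y)\<^sup>2 / 8"
      unfolding J_def using that
      by (simp add: lin axpy_in ip_axpy ip_axpy_right dst_sq ip_commute[of y x] field_simps)
    finally show ?thesis by (simp add: field_simps)
  qed
  have "\<exists>N. \<forall>m\<ge>N. \<forall>n\<ge>N. dst (X m) (X n) < e" if e: "0 < e" for e
  proof -
    obtain N where N: "8 / e\<^sup>2 < real (Suc N)"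
      by (metis reals_Archimedean2 less_trans lessI of_nat_less_iff)
    then have N': "8 / real (Suc N) < e\<^sup>2" using e by (simp add: field_simps)
    have "dst (X i) (X j) < e" if "i \<ge> N" "j \<ge> N" for i j
    proof -
      have "1 / real (Suc i) \<le> 1 / real (Suc N)" "1 / real (Suc j) \<le> 1 / real (Suc N)"
        using that by (auto simp: field_simps)
      then have "(dst (X i) (X j))\<^sup>2 < e\<^sup>2"
        using par[OF X(1) X(1), of i j] X(2)[of i] X(2)[of j] N' by simp
      then show ?thesis using e power2_less_imp_less by fastforce
    qed
    then show ?thesis by blast
  qed
  then obtain g where g: "g \<in> S" "(\<lambda>n. dst (X n) g) \<longlonglongrightarrow> 0"
    using complete_dst[of X] X by blast
  have l_lim: "(\<lambda>n. l (X n)) \<longlonglongrightarrow> l g"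
  proof -
    have "(\<lambda>n. l (X n) - l g) \<longlonglongrightarrow> 0"
    proof (rule Lim_null_comparison)
      have "norm (l (X n) - l g) \<le> C * dst (X n) g" for n
        using bnd[of "axpy (-1) g (X n)"] X g by (simp add: axpy_in lin dst_def)
      then show "\<forall>\<^sub>F n in sequentially. norm (l (X n) - l g) \<le> C * dst (X n) g" by simp
      show "(\<lambda>n. C * dst (X n) g) \<longlonglongrightarrow> 0" using tendsto_mult_left[OF g(2), of C] by simp
    qed
    then show ?thesis by (simp add: LIM_zero_iff)
  qed
  have Jg: "J g \<le> m"
  proof -
    \<comment> \<open>The quadratic part lies above its tangent at g. The tangent is linear in
      \<open>X n\<close>, so it passes to the limit without convergence of norms.\<close>
    have le: "ip (X n) g - ip g g / 2 - l (X n) \<le> m + 1 / real (Suc n)" for n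
    proof -
      have "0 \<le> (dst (X n) g)\<^sup>2" by simp
      then have "ip (X n) g - ip g g / 2 \<le> ip (X n) (X n) / 2"
        using dst_sq[OF X(1)[of n] g(1)] by simp
      then show ?thesis using X(2)[of n] by (simp add: J_def)
    qed
    have "(\<lambda>n. ip (X n) g - ip g g / 2 - l (X n)) \<longlonglongrightarrow> J g"
      unfolding J_def
      using tendsto_diff[OF tendsto_diff[OF ip_tendsto[OF X(1) g(1) g(2) g(1)] tendsto_const[of "ip g g / 2"]] l_lim]
      by simp
    moreover have "(\<lambda>n. m + 1 / real (Suc n)) \<longlonglongrightarrow> m + 0"
      by (intro tendsto_intros LIMSEQ_Suc lim_1_over_n)
    ultimately show ?thesis using le by (auto intro: LIMSEQ_le)
  qed
  have "ip g x = l x" if x: "x \<in> S" for x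
  proof (rule ccontr)
    assume ne: "ip g x \<noteq> l x"
    let ?D = "ip g x - l x"
    have q: "0 \<le> t * ?D + t\<^sup>2 * ip x x / 2" for t
    proof -
      have "J g \<le> J (axpy t x g)" using Jg mJ[of "axpy t x g"] x g axpy_in by fastforce
      then show ?thesis unfolding J_def using x g
        by (simp add: lin axpy_in ip_axpy ip_axpy_right ip_commute[of x g])
           (simp add: field_simps power2_eq_square)
    qed
    \<comment> \<open>Close to the minimiser of the quadratic in \<open>q\<close>; the added 1 keeps
      the denominator positive when x is null.\<close>
    define t where "t = - ?D / (ip x x + 1)"
    have p: "ip x x + 1 > 0" using ip_nonneg[OF x] by simp
    have tD: "?D = - t * (ip x x + 1)" using p by (simp add: t_def)
    have "0 \<le> - t\<^sup>2 * (ip x x / 2 + 1)"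
      using q[of t] unfolding tD by (simp add: field_simps power2_eq_square)
    moreover have "t \<noteq> 0" using ne p by (simp add: t_def)
    moreover have "0 < t\<^sup>2 * (ip x x / 2 + 1)" using \<open>t \<noteq> 0\<close> ip_nonneg[OF x] by simp
    ultimately show False by simp
  qed
  then show ?thesis using that g by blast
qed

text \<open>\<open>B\<close> need not be symmetric, so there is no functional to minimise. Instead
  \<open>R x\<close> represents the residual \<open>B x - l\<close>, and x - \<rho> R x is iterated.
  Its squared Lipschitz factor 1 - 2 \<rho> \<alpha> + \<rho>^2 N^2 is smallest at \<rho> = \<alpha>
  / N^2.\<close>

lemma lax_milgram:
  assumes B1: "\<And>a x y z. x \<in> S \<Longrightarrow> y \<in> S \<Longrightarrow> z \<in> S \<Longrightarrow> B (axpy a x y) z = a * B x z + B y z"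
    and B2: "\<And>a x y z. x \<in> S \<Longrightarrow> y \<in> S \<Longrightarrow> z \<in> S \<Longrightarrow> B z (axpy a x y) = a * B z x + B z y"
    and bnd: "\<And>x y. x \<in> S \<Longrightarrow> y \<in> S \<Longrightarrow> \<bar>B x y\<bar> \<le> M * nrm x * nrm y"
    and coer: "0 < \<alpha>" "\<And>x. x \<in> S \<Longrightarrow> \<alpha> * (nrm x)\<^sup>2 \<le> B x x"
    and lin: "\<And>a x y. x \<in> S \<Longrightarrow> y \<in> S \<Longrightarrow> l (axpy a x y) = a * l x + l y"
    and lbnd: "\<And>x. x \<in> S \<Longrightarrow> \<bar>l x\<bar> \<le> C * nrm x"
  obtains u where "u \<in> S" "\<And>v. v \<in> S \<Longrightarrow> B u v = l v"
proof -
  have "\<exists>r\<in>S. \<forall>v\<in>S. ip r v = B x v - l v" if x: "x \<in> S" for x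
  proof -
    have "\<bar>B x v - l v\<bar> \<le> (M * nrm x + C) * nrm v" if "v \<in> S" for v
      using bnd[OF x that] lbnd[OF that] by (simp add: algebra_simps)
    then show ?thesis
      using riesz[of "\<lambda>v. B x v - l v" "M * nrm x + C"] B2[OF _ _ x] lin
      by (smt (verit) right_diff_distrib)
  qed
  then obtain R where R: "\<And>x. x \<in> S \<Longrightarrow> R x \<in> S"
      "\<And>x v. x \<in> S \<Longrightarrow> v \<in> S \<Longrightarrow> ip (R x) v = B x v - l v" by metis
  \<comment> \<open>The maximum makes \<open>N\<close> positive and keeps 1 - \<alpha>^2 / N^2
    nonnegative under the root, whatever \<open>M\<close> is.\<close>
  define N where "N = max M \<alpha>"
  have N: "M \<le> N" "\<alpha> \<le> N" "0 < N" using coer(1) by (auto simp: N_def)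
  define \<rho> where "\<rho> = \<alpha> / N\<^sup>2"
  have \<rho>: "0 < \<rho>" using coer N by (simp add: \<rho>_def)
  define c where "c = sqrt (1 - \<alpha>\<^sup>2 / N\<^sup>2)"
  have aN: "\<alpha>\<^sup>2 / N\<^sup>2 \<le> 1" "0 < \<alpha>\<^sup>2 / N\<^sup>2" using N coer by (auto simp: power_mono)
  then have c: "0 \<le> c" "c < 1" "c\<^sup>2 = 1 - \<alpha>\<^sup>2 / N\<^sup>2" by (auto simp: c_def)
  define T where "T x = axpy (- \<rho>) (R x) x" for x
  have TS: "x \<in> S \<Longrightarrow> T x \<in> S" for x by (simp add: T_def R axpy_in)
  have contr: "dst (T x) (T y) \<le> c * dst x y" if xy: "x \<in> S" "y \<in> S" for x y
  proof -
    let ?e = "axpy (-1) y x" and ?w = "axpy (-1) (R y) (R x)"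
    have eS: "?e \<in> S" and wS: "?w \<in> S" using xy R axpy_in by auto
    have ipw: "ip ?w v = B ?e v" if "v \<in> S" for v
      using xy that R by (simp add: ip_axpy B1)
    have "(dst (T x) (T y))\<^sup>2 = ip ?e ?e - 2 * \<rho> * ip ?w ?e + \<rho>\<^sup>2 * ip ?w ?w"
    proof -
      have "(dst (T x) (T y))\<^sup>2 = ip (T x) (T x) - 2 * ip (T x) (T y) + ip (T y) (T y)"
        using xy TS dst_sq by blast
      also have "\<dots> = ip ?e ?e - 2 * \<rho> * ip ?w ?e + \<rho>\<^sup>2 * ip ?w ?w"
        unfolding T_def using xy R(1)[OF xy(1)] R(1)[OF xy(2)]
        by (simp only: ip_axpy ip_axpy_right axpy_in)
           (simp add: ip_commute[of x "R x"] ip_commute[of y "R y"] ip_commute[of x "R y"] ip_commute[of y "R x"]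
             ip_commute[of "R y" "R x"] ip_commute[of y x] algebra_simps power2_eq_square)
      finally show ?thesis .
    qed
    moreover have "ip ?w ?e \<ge> \<alpha> * (nrm ?e)\<^sup>2" using ipw[OF eS] coer(2)[OF eS] by simp
    moreover have "ip ?w ?w \<le> N\<^sup>2 * (nrm ?e)\<^sup>2"
    proof -
      have "(nrm ?w)\<^sup>2 \<le> M * nrm ?e * nrm ?w"
        using ipw[OF wS] bnd[OF eS wS] nrm_sq[OF wS] by simp
      also have "\<dots> \<le> N * nrm ?e * nrm ?w" using N eS wS by (intro mult_right_mono) auto
      finally have "nrm ?w * nrm ?w \<le> (N * nrm ?e) * nrm ?w" by (simp add: power2_eq_square)
      then have "nrm ?w \<le> N * nrm ?e"
        using nrm_nonneg[OF wS] nrm_nonneg[OF eS] N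
        by (metis less_eq_real_def mult_nonneg_nonneg mult_right_le_imp_le)
      then have "(nrm ?w)\<^sup>2 \<le> (N * nrm ?e)\<^sup>2" using wS by (intro power_mono) auto
      then show ?thesis using nrm_sq[OF wS] by (simp add: power_mult_distrib)
    qed
    ultimately have "(dst (T x) (T y))\<^sup>2 \<le> (nrm ?e)\<^sup>2 - 2 * \<rho> * (\<alpha> * (nrm ?e)\<^sup>2) + \<rho>\<^sup>2 * (N\<^sup>2 * (nrm ?e)\<^sup>2)"
      using \<rho> nrm_sq[OF eS] by (smt (verit, best) mult_left_mono zero_le_power2 mult_pos_pos)
    also have "\<dots> = (c * dst x y)\<^sup>2"
      unfolding power_mult_distrib c(3) dst_def using N by (simp add: \<rho>_def field_simps power2_eq_square)
    finally show ?thesis using c dst_nonneg xy by (auto intro: power2_le_imp_le)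
  qed
  obtain u where u: "u \<in> S" "dst (T u) u = 0"
    using contraction_fixed_point[of S T c] nonempty TS c contr by blast
  have "B u v = l v" if v: "v \<in> S" for v
  proof -
    have "\<bar>ip (axpy (-1) u (T u)) v\<bar> \<le> 0"
      using cauchy_schwarz[of "axpy (-1) u (T u)" v] u v TS by (simp add: axpy_in dst_def)
    then have "ip (T u) v = ip u v" using u v TS by (simp add: ip_axpy)
    then have "\<rho> * ip (R u) v = 0" using u v R unfolding T_def by (simp add: ip_axpy)
    then show ?thesis using \<rho> R(2)[OF u(1) v] by simp
  qed
  then show ?thesis using that u by blast
qed

text \<open>Supplies the Hilbert structure of the two subspaces in use: the kernel of the constraint
  in the saddle point problem, and the pressures of mean zero.\<close>

lemma closed_subspace:
  assumes ne: "Z \<noteq> {}" and ZS: "Z \<subseteq> S"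
    and ax: "\<And>a x y. x \<in> Z \<Longrightarrow> y \<in> Z \<Longrightarrow> axpy a x y \<in> Z"
    and closed: "\<And>X x. (\<And>n::nat. X n \<in> Z) \<Longrightarrow> x \<in> S \<Longrightarrow> (\<lambda>n. dst (X n) x) \<longlonglongrightarrow> 0 \<Longrightarrow> x \<in> Z"
  shows "semi_hilbert Z axpy ip"
proof
  fix X :: "nat \<Rightarrow> 'a"
  assume X: "\<And>n. X n \<in> Z"
    and C: "\<And>e. 0 < e \<Longrightarrow> \<exists>N. \<forall>m\<ge>N. \<forall>n\<ge>N. sqrt (ip (axpy (-1) (X n) (X m)) (axpy (-1) (X n) (X m))) < e"
  obtain x where "x \<in> S" "(\<lambda>n. dst (X n) x) \<longlonglongrightarrow> 0"
    using complete[of X] X ZS C unfolding dst_def nrm_def by blast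
  then show "\<exists>x\<in>Z. (\<lambda>n. sqrt (ip (axpy (-1) x (X n)) (axpy (-1) x (X n)))) \<longlonglongrightarrow> 0"
    using closed[of X x] X unfolding dst_def nrm_def by blast
next
  show "Z \<noteq> {}" by (rule ne)
  show "axpy a x y \<in> Z" if "x \<in> Z" "y \<in> Z" for a x y using that by (rule ax)
  show "ip (axpy a x y) z = a * ip x z + ip y z" if "x \<in> Z" "y \<in> Z" "z \<in> Z" for a x y z
    using that ZS by (intro ip_axpy) auto
  show "ip x y = ip y x" if "x \<in> Z" "y \<in> Z" for x y
    using that ZS by (intro ip_commute) auto
  show "0 \<le> ip x x" if "x \<in> Z" for x
    using that ZS by (intro ip_nonneg) auto
qed

end

text \<open>Brezzi's theorem. The pressure is found by applying Lax--Milgram on \<open>Q\<close> to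
  \<open>(p, q) \<mapsto> \<langle>T p, T q\<rangle>\<close>, where \<open>T q\<close> is the Riesz representative of \<open>b(\<cdot>, q)\<close>; the residual of the
  first equation is then in the kernel of \<open>b\<close> and orthogonal to it.\<close>

theorem saddle_point:
  assumes V: "semi_hilbert S aV iV" and Q: "semi_hilbert Q aQ iQ"
    and b1: "\<And>a x y q. x \<in> S \<Longrightarrow> y \<in> S \<Longrightarrow> q \<in> Q \<Longrightarrow> b (aV a x y) q = a * b x q + b y q"
    and b2: "\<And>a p q x. x \<in> S \<Longrightarrow> p \<in> Q \<Longrightarrow> q \<in> Q \<Longrightarrow> b x (aQ a p q) = a * b x p + b x q"
    and bbnd: "\<And>x q. x \<in> S \<Longrightarrow> q \<in> Q \<Longrightarrow> \<bar>b x q\<bar> \<le> Mb * sqrt (iV x x) * sqrt (iQ q q)"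
    and infsup: "0 < \<beta>" "\<And>q M. q \<in> Q \<Longrightarrow> 0 \<le> M \<Longrightarrow> (\<And>v. v \<in> S \<Longrightarrow> b v q \<le> M * sqrt (iV v v)) \<Longrightarrow>
        \<beta> * sqrt (iQ q q) \<le> M"
    and A1: "\<And>a x y z. x \<in> S \<Longrightarrow> y \<in> S \<Longrightarrow> z \<in> S \<Longrightarrow> A (aV a x y) z = a * A x z + A y z"
    and A2: "\<And>a x y z. x \<in> S \<Longrightarrow> y \<in> S \<Longrightarrow> z \<in> S \<Longrightarrow> A z (aV a x y) = a * A z x + A z y"
    and Abnd: "\<And>x y. x \<in> S \<Longrightarrow> y \<in> S \<Longrightarrow> \<bar>A x y\<bar> \<le> Ma * sqrt (iV x x) * sqrt (iV y y)"
    and coer: "0 < \<alpha>" "\<And>x. x \<in> S \<Longrightarrow> (\<And>q. q \<in> Q \<Longrightarrow> b x q = 0) \<Longrightarrow> \<alpha> * iV x x \<le> A x x"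
    and l1: "\<And>a x y. x \<in> S \<Longrightarrow> y \<in> S \<Longrightarrow> l (aV a x y) = a * l x + l y"
    and lbnd: "\<And>x. x \<in> S \<Longrightarrow> \<bar>l x\<bar> \<le> C * sqrt (iV x x)"
  shows "\<exists>u\<in>S. \<exists>p\<in>Q. (\<forall>v\<in>S. A u v + b v p = l v) \<and> (\<forall>q\<in>Q. b u q = 0)"
proof -
  interpret V: semi_hilbert S aV iV by (rule V)
  interpret Q: semi_hilbert Q aQ iQ by (rule Q)
  define Z where "Z = {x \<in> S. \<forall>q\<in>Q. b x q = 0}"
  have bbnd': "\<bar>b x q\<bar> \<le> Mb * V.nrm x * Q.nrm q" if "x \<in> S" "q \<in> Q" for x q
    using bbnd[OF that] by (simp add: V.nrm_def Q.nrm_def)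
  interpret Z: semi_hilbert Z aV iV
  proof (rule V.closed_subspace)
    obtain x where x: "x \<in> S" using V.nonempty by auto
    have "aV (-1) x x \<in> Z" using x by (auto simp: Z_def b1 V.axpy_in)
    then show "Z \<noteq> {}" by auto
  next
    fix X :: "nat \<Rightarrow> _" and x
    assume X: "\<And>n. X n \<in> Z" and x: "x \<in> S" and lim: "(\<lambda>n. V.dst (X n) x) \<longlonglongrightarrow> 0"
    have "b x q = 0" if q: "q \<in> Q" for q
    proof -
      have "\<bar>b x q\<bar> \<le> Mb * V.dst (X n) x * Q.nrm q" for n
      proof -
        have Xn: "X n \<in> S" "b (X n) q = 0" using X q by (auto simp: Z_def)
        then have "b (aV (-1) x (X n)) q = - b x q" using x q by (simp add: b1)
        then show ?thesis
          using bbnd'[of "aV (-1) x (X n)" q] x q Xn by (simp add: V.axpy_in V.dst_def)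
      qed
      moreover have "(\<lambda>n. Mb * V.dst (X n) x * Q.nrm q) \<longlonglongrightarrow> Mb * 0 * Q.nrm q"
        by (intro tendsto_intros lim)
      ultimately have "\<bar>b x q\<bar> \<le> Mb * 0 * Q.nrm q" by (meson LIMSEQ_le_const)
      then show ?thesis by simp
    qed
    then show "x \<in> Z" using x by (simp add: Z_def)
  qed (auto simp: Z_def V.axpy_in b1)
  have ZS: "x \<in> Z \<Longrightarrow> x \<in> S" for x by (simp add: Z_def)
  obtain u where u: "u \<in> Z" "\<And>v. v \<in> Z \<Longrightarrow> A u v = l v"
  proof (rule Z.lax_milgram[of A Ma \<alpha> l C])
    show "\<alpha> * (Z.nrm x)\<^sup>2 \<le> A x x" if "x \<in> Z" for x
      using that coer(2)[of x] Z.nrm_sq[OF that] by (auto simp: Z_def)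
  qed (use ZS A1 A2 Abnd coer(1) l1 lbnd in \<open>auto simp: Z.nrm_def\<close>)
  have uS: "u \<in> S" using u ZS by auto
  define m where "m v = l v - A u v" for v
  have m1: "m (aV a x y) = a * m x + m y" if "x \<in> S" "y \<in> S" for a x y
    unfolding m_def using that uS by (simp add: l1 A2 algebra_simps)
  have mbnd: "\<bar>m x\<bar> \<le> (C + Ma * V.nrm u) * V.nrm x" if "x \<in> S" for x
    unfolding m_def using that Abnd[OF uS that] lbnd[OF that] by (simp add: V.nrm_def algebra_simps)
  obtain g where g: "g \<in> S" "\<And>v. v \<in> S \<Longrightarrow> iV g v = m v"
    using V.riesz[of m "C + Ma * V.nrm u"] m1 mbnd by blast
  have "\<exists>t\<in>S. \<forall>v\<in>S. iV t v = b v q" if q: "q \<in> Q" for q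
    using V.riesz[of "\<lambda>v. b v q" "Mb * Q.nrm q"] b1[OF _ _ q] bbnd'[OF _ q]
    by (smt (verit, best) mult.commute mult.left_commute)
  then obtain T where T: "\<And>q. q \<in> Q \<Longrightarrow> T q \<in> S" "\<And>q v. q \<in> Q \<Longrightarrow> v \<in> S \<Longrightarrow> iV (T q) v = b v q"
    by metis
  have Tnrm: "V.nrm (T q) \<le> \<bar>Mb\<bar> * Q.nrm q" if q: "q \<in> Q" for q
  proof -
    have "(V.nrm (T q))\<^sup>2 \<le> Mb * V.nrm (T q) * Q.nrm q"
      using bbnd'[OF T(1)[OF q] q] T(2)[OF q T(1)[OF q]] V.nrm_sq[OF T(1)[OF q]] by simp
    also have "\<dots> \<le> \<bar>Mb\<bar> * V.nrm (T q) * Q.nrm q"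
      using q T by (intro mult_right_mono) auto
    finally have "V.nrm (T q) * V.nrm (T q) \<le> (\<bar>Mb\<bar> * Q.nrm q) * V.nrm (T q)"
      by (simp add: power2_eq_square algebra_simps)
    then show ?thesis
      using V.nrm_nonneg[OF T(1)[OF q]] Q.nrm_nonneg[OF q]
      by (metis abs_ge_zero less_eq_real_def mult_nonneg_nonneg mult_right_le_imp_le)
  qed
  have Tip: "iV (T p) (T q) = b (T q) p" if "p \<in> Q" "q \<in> Q" for p q using T that by auto
  have Tip': "iV (T p) (T q) = b (T p) q" if "p \<in> Q" "q \<in> Q" for p q
    using T that V.ip_commute[of "T p" "T q"] by auto
  obtain p where p: "p \<in> Q" "\<And>q. q \<in> Q \<Longrightarrow> iV (T p) (T q) = b g q"
  proof (rule Q.lax_milgram[of "\<lambda>p q. iV (T p) (T q)" "Mb\<^sup>2" "\<beta>\<^sup>2" "\<lambda>q. b g q" "\<bar>Mb\<bar> * V.nrm g"])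
    show "\<bar>iV (T x) (T y)\<bar> \<le> Mb\<^sup>2 * Q.nrm x * Q.nrm y" if "x \<in> Q" "y \<in> Q" for x y
    proof -
      have "\<bar>iV (T x) (T y)\<bar> \<le> V.nrm (T x) * V.nrm (T y)" using V.cauchy_schwarz T that by blast
      also have "\<dots> \<le> (\<bar>Mb\<bar> * Q.nrm x) * (\<bar>Mb\<bar> * Q.nrm y)"
        using Tnrm T that by (intro mult_mono) auto
      also have "\<dots> = Mb\<^sup>2 * Q.nrm x * Q.nrm y"
        by (metis (no_types, opaque_lifting) abs_mult_self_eq mult.assoc mult.left_commute power2_eq_square)
      finally show ?thesis .
    qed
    show "\<beta>\<^sup>2 * (Q.nrm x)\<^sup>2 \<le> iV (T x) (T x)" if x: "x \<in> Q" for x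
    proof -
      \<comment> \<open>The norm of \<open>T x\<close> bounds the functional b(., x), so the inf-sup
        condition becomes coercivity of the form on \<open>Q\<close>, with constant
        \<beta>^2.\<close>
      have "b v x \<le> V.nrm (T x) * sqrt (iV v v)" if v: "v \<in> S" for v
        using V.cauchy_schwarz[OF T(1)[OF x] v] T(2)[OF x v] by (simp add: V.nrm_def)
      then have "\<beta> * Q.nrm x \<le> V.nrm (T x)"
        using infsup(2)[OF x, of "V.nrm (T x)"] T x by (simp add: Q.nrm_def)
      then have "(\<beta> * Q.nrm x)\<^sup>2 \<le> (V.nrm (T x))\<^sup>2" using infsup(1) x by (intro power_mono) auto
      then show ?thesis using V.nrm_sq T x by (simp add: power_mult_distrib)
    qed
    show "\<bar>b g x\<bar> \<le> \<bar>Mb\<bar> * V.nrm g * Q.nrm x" if "x \<in> Q" for x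
    proof -
      have "Mb * V.nrm g * Q.nrm x \<le> \<bar>Mb\<bar> * V.nrm g * Q.nrm x"
        using that g by (intro mult_right_mono) auto
      then show ?thesis using bbnd'[OF g(1) that] by simp
    qed
  qed (use Tip Tip' b2 T g infsup(1) Q.axpy_in in auto)
  define h where "h = aV (-1) (T p) g"
  have hS: "h \<in> S" using g T p by (simp add: h_def V.axpy_in)
  have bh: "b h q = 0" if q: "q \<in> Q" for q
    using p(2)[OF q] Tip'[OF p(1) q] q g T p(1) by (simp add: h_def b1)
  have hZ: "h \<in> Z" using hS bh by (simp add: Z_def)
  have "iV h h = m h - b h p"
    using g T p hS V.ip_axpy[OF T(1)[OF p(1)] g(1) hS, of "-1"] by (simp flip: h_def)
  also have "\<dots> = 0" using bh[OF p(1)] u(2)[OF hZ] by (simp add: m_def)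
  finally have h0: "V.nrm h = 0" by (simp add: V.nrm_def)
  have "m v = b v p" if v: "v \<in> S" for v
  proof -
    have "\<bar>iV h v\<bar> \<le> 0" using V.cauchy_schwarz[OF hS v] h0 by simp
    then show ?thesis using g(2)[OF v] T(2)[OF p(1) v] V.ip_axpy[OF T(1)[OF p(1)] g(1) v, of "-1"]
      by (simp add: h_def)
  qed
  then have "\<forall>v\<in>S. A u v + b v p = l v" by (force simp: m_def)
  moreover have "\<forall>q\<in>Q. b u q = 0" using u by (simp add: Z_def)
  ultimately show ?thesis using uS p by blast
qed

section \<open>Square integrable functions\<close>

text \<open>Integrability of the limit is part of the conclusion. This is what puts limits into L2
  in the completeness proof, and fields of V into L4.\<close>

lemma fatou_integral:
  fixes f :: "nat \<Rightarrow> 'a \<Rightarrow> real"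
  assumes f: "\<And>n. integrable M (f n)" "\<And>n x. 0 \<le> f n x"
    and lim: "AE x in M. (\<lambda>n. f n x) \<longlonglongrightarrow> g x"
    and g: "g \<in> borel_measurable M"
    and C: "\<And>n. (\<integral>x. f n x \<partial>M) \<le> C"
  shows "integrable M g \<and> (\<integral>x. g x \<partial>M) \<le> C"
proof -
  have C0: "0 \<le> C" using C[of 0] f(2) by (meson Bochner_Integration.integral_nonneg order_trans)
  have gnn: "AE x in M. 0 \<le> g x"
    using lim by eventually_elim (use f(2) in \<open>auto intro: LIMSEQ_le_const\<close>)
  have "(\<integral>\<^sup>+x. ennreal (g x) \<partial>M) = (\<integral>\<^sup>+x. liminf (\<lambda>n. ennreal (f n x)) \<partial>M)"
    using lim by (intro nn_integral_cong_AE, eventually_elim)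
      (simp add: lim_imp_Liminf[OF _ tendsto_ennrealI])
  also have "\<dots> \<le> liminf (\<lambda>n. \<integral>\<^sup>+x. ennreal (f n x) \<partial>M)"
    using f(1) by (intro nn_integral_liminf) auto
  also have "\<dots> \<le> liminf (\<lambda>n::nat. ennreal C)"
    using f C by (intro Liminf_mono always_eventually allI) (simp add: nn_integral_eq_integral ennreal_leI)
  also have "\<dots> = ennreal C" by (simp add: Liminf_const)
  finally have le: "(\<integral>\<^sup>+x. ennreal (g x) \<partial>M) \<le> ennreal C" .
  have "(\<integral>\<^sup>+x. ennreal (norm (g x)) \<partial>M) = (\<integral>\<^sup>+x. ennreal (g x) \<partial>M)"
    using gnn by (intro nn_integral_cong_AE, eventually_elim) simp
  then have "integrable M g" using g le by (auto intro!: integrableI_bounded intro: le_less_trans)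
  moreover from this have "ennreal (\<integral>x. g x \<partial>M) \<le> ennreal C"
    using le gnn by (simp add: nn_integral_eq_integral)
  ultimately show ?thesis using C0 by simp
qed

section \<open>The inner product of L2 and its elementary rules\<close>

definition fun_axpy :: "real \<Rightarrow> (real^3 \<Rightarrow> 'b::real_vector) \<Rightarrow> (real^3 \<Rightarrow> 'b) \<Rightarrow> real^3 \<Rightarrow> 'b" where
  "fun_axpy a u v = (\<lambda>x. a *\<^sub>R u x + v x)"

definition l2ip :: "(real^3) set \<Rightarrow> (real^3 \<Rightarrow> 'b::euclidean_space) \<Rightarrow> (real^3 \<Rightarrow> 'b) \<Rightarrow> real" where
  "l2ip \<Omega> u v = (\<integral>x. u x \<bullet> v x \<partial>lebesgue_on \<Omega>)"

lemma Lp_measurable: "u \<in> Lp p \<Omega> \<Longrightarrow> u \<in> borel_measurable (lebesgue_on \<Omega>)"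
  by (simp add: Lp_def)

lemma integrable_inner_L2:
  fixes u v :: "real^3 \<Rightarrow> 'b::euclidean_space"
  assumes "u \<in> Lp 2 \<Omega>" "v \<in> Lp 2 \<Omega>"
  shows "integrable (lebesgue_on \<Omega>) (\<lambda>x. u x \<bullet> v x)"
proof (rule Bochner_Integration.integrable_bound)
  show "integrable (lebesgue_on \<Omega>) (\<lambda>x. norm (u x) ^ 2 + norm (v x) ^ 2)"
    using assms by (simp add: Lp_def)
  show "(\<lambda>x. u x \<bullet> v x) \<in> borel_measurable (lebesgue_on \<Omega>)"
    using assms by (intro borel_measurable_inner) (auto simp: Lp_def)
  have "\<bar>a \<bullet> b\<bar> \<le> norm a ^ 2 + norm b ^ 2" for a b :: 'b
  proof -
    have "\<bar>a \<bullet> b\<bar> \<le> norm a * norm b" by (rule Cauchy_Schwarz_ineq2)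
    moreover have "0 \<le> (norm a - norm b)\<^sup>2" by simp
    moreover have "0 \<le> norm a * norm b" by simp
    ultimately show ?thesis unfolding power2_diff by linarith
  qed
  then show "AE x in lebesgue_on \<Omega>. norm (u x \<bullet> v x) \<le> norm (norm (u x) ^ 2 + norm (v x) ^ 2)"
    by (simp add: abs_of_nonneg)
qed

lemma Lp2_scaleR_add:
  fixes u v :: "real^3 \<Rightarrow> 'b::euclidean_space"
  assumes "u \<in> Lp 2 \<Omega>" "v \<in> Lp 2 \<Omega>"
  shows "(\<lambda>x. a *\<^sub>R u x + v x) \<in> Lp 2 \<Omega>"
proof -
  have "norm (a *\<^sub>R u x + v x) ^ 2 = a\<^sup>2 * norm (u x) ^ 2 + 2 * a * (u x \<bullet> v x) + norm (v x) ^ 2" for x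
    by (simp only: power2_norm_eq_inner)
       (simp add: inner_add_left inner_add_right inner_commute power2_eq_square algebra_simps)
  then show ?thesis using assms integrable_inner_L2[OF assms]
    by (auto simp: Lp_def intro!: borel_measurable_add borel_measurable_scaleR)
qed

lemma Lp2_zero: "(\<lambda>x. 0) \<in> Lp 2 \<Omega>"
  by (simp add: Lp_def)

lemma Lp2_bounded:
  fixes u :: "real^3 \<Rightarrow> 'b::euclidean_space" and v :: "real^3 \<Rightarrow> 'c::euclidean_space"
  assumes v: "v \<in> Lp 2 \<Omega>" and u: "u \<in> borel_measurable (lebesgue_on \<Omega>)"
    and le: "AE x in lebesgue_on \<Omega>. norm (u x) \<le> C * norm (v x)"
  shows "u \<in> Lp 2 \<Omega>"
proof -
  have "integrable (lebesgue_on \<Omega>) (\<lambda>x. norm (u x) ^ 2)"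
  proof (rule Bochner_Integration.integrable_bound)
    show "integrable (lebesgue_on \<Omega>) (\<lambda>x. C\<^sup>2 * norm (v x) ^ 2)" using v by (simp add: Lp_def)
    show "AE x in lebesgue_on \<Omega>. norm (norm (u x) ^ 2) \<le> norm (C\<^sup>2 * norm (v x) ^ 2)"
      using le
    proof eventually_elim
      case (elim x)
      then have "(norm (u x))\<^sup>2 \<le> (C * norm (v x))\<^sup>2" by (intro power_mono) auto
      then show ?case by (simp add: power_mult_distrib)
    qed
  qed (use u in measurable)
  then show ?thesis using u by (simp add: Lp_def)
qed

lemma Lp2_scaleR:
  fixes u :: "real^3 \<Rightarrow> 'b::euclidean_space"
  shows "u \<in> Lp 2 \<Omega> \<Longrightarrow> (\<lambda>x. a *\<^sub>R u x) \<in> Lp 2 \<Omega>"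
  using Lp2_scaleR_add[OF _ Lp2_zero, of u \<Omega> a] by simp

lemma Lp2_add:
  fixes u v :: "real^3 \<Rightarrow> 'b::euclidean_space"
  shows "u \<in> Lp 2 \<Omega> \<Longrightarrow> v \<in> Lp 2 \<Omega> \<Longrightarrow> (\<lambda>x. u x + v x) \<in> Lp 2 \<Omega>"
  using Lp2_scaleR_add[of u \<Omega> v 1] by simp

lemma Lp2_diff:
  fixes u v :: "real^3 \<Rightarrow> 'b::euclidean_space"
  shows "u \<in> Lp 2 \<Omega> \<Longrightarrow> v \<in> Lp 2 \<Omega> \<Longrightarrow> (\<lambda>x. u x - v x) \<in> Lp 2 \<Omega>"
  using Lp2_scaleR_add[of v \<Omega> u "-1"] by simp

lemma Lp2_norm: "u \<in> Lp 2 \<Omega> \<Longrightarrow> (\<lambda>x. norm (u x)) \<in> Lp 2 \<Omega>"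
  by (auto simp: Lp_def intro: borel_measurable_norm)

lemma borel_measurable_vec_nth:
  "u \<in> borel_measurable M \<Longrightarrow> (\<lambda>x. (u x :: real^'n) $ i) \<in> borel_measurable M"
  by (simp add: cart_eq_inner_axis)

lemma Lp2_nth: "u \<in> Lp 2 \<Omega> \<Longrightarrow> (\<lambda>x. (u x :: real^'n) $ i) \<in> Lp 2 \<Omega>"
  by (rule Lp2_bounded[of "\<lambda>x. norm (u x)" _ _ 1])
     (auto simp: Lp2_norm component_le_norm_cart intro: borel_measurable_vec_nth Lp_measurable)

lemma l2ip_self: "l2ip \<Omega> u u = (\<integral>x. norm (u x) ^ 2 \<partial>lebesgue_on \<Omega>)"
  by (simp add: l2ip_def power2_norm_eq_inner)

lemma Lp_norm_2: "Lp_norm 2 \<Omega> u = sqrt (l2ip \<Omega> u u)"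
  by (simp add: Lp_norm_def l2ip_self sqrt_def)

lemma Lp_norm_2_sq: "(Lp_norm 2 \<Omega> u)\<^sup>2 = l2ip \<Omega> u u"
  by (simp add: Lp_norm_2 l2ip_self)

lemma Lp_norm_nonneg [simp]: "0 \<le> Lp_norm 2 \<Omega> u"
  by (simp add: Lp_norm_def)

lemma l2ip_commute: "l2ip \<Omega> u v = l2ip \<Omega> v u"
  by (simp add: l2ip_def inner_commute)

lemma l2ip_axpy:
  "u \<in> Lp 2 \<Omega> \<Longrightarrow> v \<in> Lp 2 \<Omega> \<Longrightarrow> w \<in> Lp 2 \<Omega> \<Longrightarrow>
    l2ip \<Omega> (fun_axpy a u v) w = a * l2ip \<Omega> u w + l2ip \<Omega> v w"
  by (simp add: l2ip_def fun_axpy_def inner_add_left integrable_inner_L2)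

lemma l2ip_cong:
  assumes "AE x in lebesgue_on \<Omega>. u x = u' x" "AE x in lebesgue_on \<Omega>. v x = v' x"
    "u \<in> Lp 2 \<Omega>" "u' \<in> Lp 2 \<Omega>" "v \<in> Lp 2 \<Omega>" "v' \<in> Lp 2 \<Omega>"
  shows "l2ip \<Omega> u v = l2ip \<Omega> u' v'"
  unfolding l2ip_def
proof (rule integral_cong_AE)
  show "AE x in lebesgue_on \<Omega>. u x \<bullet> v x = u' x \<bullet> v' x"
    using assms(1,2) by eventually_elim simp
qed (use assms integrable_inner_L2 in \<open>blast intro: borel_measurable_integrable\<close>)+

lemma l2ip_self_eq_0_iff:
  assumes "u \<in> Lp 2 \<Omega>"
  shows "l2ip \<Omega> u u = 0 \<longleftrightarrow> (AE x in lebesgue_on \<Omega>. u x = 0)"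
  unfolding l2ip_self using assms
  by (subst integral_nonneg_eq_0_iff_AE) (auto simp: Lp_def)

section \<open>L2 on a bounded open set: finite measure, completeness, Cauchy-Schwarz\<close>

locale bounded_open =
  fixes \<Omega> :: "(real^3) set"
  assumes open_dom: "open \<Omega>" and bounded_dom: "bounded \<Omega>"
begin

lemma lmeasurable_dom: "\<Omega> \<in> lmeasurable"
  by (simp add: lmeasurable_open open_dom bounded_dom)

sublocale finite_measure "lebesgue_on \<Omega>"
  by (rule finite_measure_lebesgue_on[OF lmeasurable_dom])

lemma Lp2_const: "(\<lambda>x. c) \<in> Lp 2 \<Omega>"
  by (simp add: Lp_def)

lemma Lp2_bdd:
  fixes u :: "real^3 \<Rightarrow> 'b::euclidean_space"
  assumes "u \<in> borel_measurable (lebesgue_on \<Omega>)" "\<And>x. x \<in> \<Omega> \<Longrightarrow> norm (u x) \<le> C"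
  shows "u \<in> Lp 2 \<Omega>"
proof -
  have "norm (u x) ^ 2 \<le> C ^ 2" if "x \<in> \<Omega>" for x using assms(2)[OF that] by (intro power_mono) auto
  then have "integrable (lebesgue_on \<Omega>) (\<lambda>x. norm (u x) ^ 2)"
    using assms(1) by (intro integrable_const_bound[where B="C^2"] AE_I2) (auto)
  then show ?thesis using assms(1) by (simp add: Lp_def)
qed

lemma integrable_L2:
  fixes u :: "real^3 \<Rightarrow> 'b::euclidean_space"
  assumes "u \<in> Lp 2 \<Omega>"
  shows "integrable (lebesgue_on \<Omega>) u"
proof (rule Bochner_Integration.integrable_bound)
  show "integrable (lebesgue_on \<Omega>) (\<lambda>x. 1 + norm (u x) ^ 2)" using assms by (simp add: Lp_def)
  have "t \<le> 1 + t\<^sup>2" for t :: real using zero_le_power2[of "t - 1/2"] by (simp add: power2_eq_square algebra_simps)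
  then show "AE x in lebesgue_on \<Omega>. norm (u x) \<le> norm (1 + norm (u x) ^ 2)"
    by (intro AE_I2) (smt (verit) real_norm_def)
qed (use assms in \<open>simp add: Lp_def\<close>)

text \<open>Cauchy-Schwarz against the constant 1, by a discriminant. It is done by hand because the
  general inequality is drawn from the Hilbert structure of L2, whose completeness rests on this
  estimate.\<close>

lemma norm_integral_le_L2:
  fixes u :: "real^3 \<Rightarrow> 'b::euclidean_space"
  assumes "u \<in> Lp 2 \<Omega>"
  shows "(\<integral>x. norm (u x) \<partial>lebesgue_on \<Omega>)\<^sup>2 \<le> measure (lebesgue_on \<Omega>) \<Omega> * l2ip \<Omega> u u"
proof -
  let ?m = "measure (lebesgue_on \<Omega>) \<Omega>" and ?I = "\<integral>x. norm (u x) \<partial>lebesgue_on \<Omega>"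
  have sp: "space (lebesgue_on \<Omega>) = \<Omega>" by simp
  have iu: "integrable (lebesgue_on \<Omega>) (\<lambda>x. norm (u x))" using integrable_L2[OF assms] by simp
  have iu2: "integrable (lebesgue_on \<Omega>) (\<lambda>x. norm (u x) ^ 2)" using assms by (simp add: Lp_def)
  have q: "0 \<le> t\<^sup>2 * ?m - 2 * t * ?I + l2ip \<Omega> u u" for t
  proof -
    have "0 \<le> (\<integral>x. (t - norm (u x)) ^ 2 \<partial>lebesgue_on \<Omega>)" by simp
    also have "\<dots> = (\<integral>x. t\<^sup>2 - 2 * t * norm (u x) + norm (u x) ^ 2 \<partial>lebesgue_on \<Omega>)"
      by (simp add: power2_diff algebra_simps)
    also have "\<dots> = t\<^sup>2 * ?m - 2 * t * ?I + l2ip \<Omega> u u"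
      using iu iu2 by (simp add: l2ip_self)
    finally show ?thesis .
  qed
  show ?thesis
  proof (cases "?m = 0")
    case True
    have "emeasure (lebesgue_on \<Omega>) \<Omega> = 0" using True emeasure_eq_measure by simp
    then have "\<Omega> \<in> null_sets (lebesgue_on \<Omega>)" by (auto simp: null_sets_def intro: sets.top[of "lebesgue_on \<Omega>", simplified])
    then have "AE x in lebesgue_on \<Omega>. norm (u x) = 0" by (rule AE_I'[where N=\<Omega>]) auto
    then have "?I = 0" by (rule integral_eq_zero_AE)
    then show ?thesis using True by simp
  next
    case False
    then have m: "0 < ?m" by (simp add: zero_less_measure_iff)
    have "0 \<le> ?m * ((?I / ?m)\<^sup>2 * ?m - 2 * (?I / ?m) * ?I + l2ip \<Omega> u u)"
      using q m by (simp only: mult_nonneg_nonneg less_imp_le)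
    also have "\<dots> = ?m * l2ip \<Omega> u u - ?I\<^sup>2" using m by (simp add: field_simps power2_eq_square)
    finally show ?thesis by simp
  qed
qed

text \<open>As the measure is finite, a Cauchy sequence in L2 is Cauchy in L1 and has a subsequence
  converging almost everywhere. Fatou's lemma, applied to the differences with a fixed member of the
  sequence, returns from there to L2.\<close>

lemma L2_complete:
  fixes X :: "nat \<Rightarrow> real^3 \<Rightarrow> 'b::euclidean_space"
  assumes X: "\<And>n. X n \<in> Lp 2 \<Omega>"
    and C: "\<And>e. 0 < e \<Longrightarrow> \<exists>N. \<forall>m\<ge>N. \<forall>n\<ge>N. Lp_norm 2 \<Omega> (\<lambda>x. X m x - X n x) < e"
  obtains u where "u \<in> Lp 2 \<Omega>" "(\<lambda>n. Lp_norm 2 \<Omega> (\<lambda>x. X n x - u x)) \<longlonglongrightarrow> 0"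
proof -
  let ?M = "lebesgue_on \<Omega>" and ?m = "measure (lebesgue_on \<Omega>) \<Omega>"
  have D: "(\<lambda>x. X m x - X n x) \<in> Lp 2 \<Omega>" for m n by (intro Lp2_diff X)
  have "\<exists>N. \<forall>i\<ge>N. \<forall>j\<ge>N. (LINT x|?M. norm (X i x - X j x)) < e" if e: "0 < e" for e
  proof -
    \<comment> \<open>The summand 1 prevents a division by zero without a case distinction on the
      measure.\<close>
    obtain N where N: "\<And>i j. i \<ge> N \<Longrightarrow> j \<ge> N \<Longrightarrow> Lp_norm 2 \<Omega> (\<lambda>x. X i x - X j x) < e / sqrt (?m + 1)"
      using C[of "e / sqrt (?m + 1)"] e by (auto simp: add_nonneg_pos)
    have "(LINT x|?M. norm (X i x - X j x)) < e" if "i \<ge> N" "j \<ge> N" for i j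
    proof (rule power2_less_imp_less)
      let ?L = "Lp_norm 2 \<Omega> (\<lambda>x. X i x - X j x)"
      have "(LINT x|?M. norm (X i x - X j x))\<^sup>2 \<le> ?m * ?L\<^sup>2"
        using norm_integral_le_L2[OF D] by (simp add: Lp_norm_2_sq)
      also have "\<dots> \<le> (?m + 1) * ?L\<^sup>2" by (intro mult_right_mono) auto
      also have "\<dots> < (?m + 1) * (e / sqrt (?m + 1))\<^sup>2"
        using N[OF that] by (intro mult_strict_left_mono power_strict_mono) (auto simp: add_nonneg_pos)
      also have "\<dots> = e\<^sup>2"
        by (simp add: power_divide add_nonneg_pos abs_of_nonneg less_imp_neq[symmetric])
      finally show "(LINT x|?M. norm (X i x - X j x))\<^sup>2 < e\<^sup>2" .
    qed (use e in simp)
    then show ?thesis by blast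
  qed
  then obtain r where r: "strict_mono r" "AE x in ?M. Cauchy (\<lambda>i. X (r i) x)"
    using cauchy_L1_AE_cauchy_subseq[of ?M X] integrable_L2[OF X] by blast
  define u where "u x = lim (\<lambda>i. X (r i) x)" for x
  have um: "u \<in> borel_measurable ?M"
    unfolding u_def[abs_def] using X by (intro borel_measurable_lim_metric) (simp add: Lp_def)
  have lim: "AE x in ?M. (\<lambda>i. X (r i) x) \<longlonglongrightarrow> u x"
    using r(2) by eventually_elim (simp add: u_def Cauchy_convergent_iff convergent_LIMSEQ_iff)
  have key: "(\<lambda>x. X n x - u x) \<in> Lp 2 \<Omega> \<and> Lp_norm 2 \<Omega> (\<lambda>x. X n x - u x) \<le> e"
    if N: "\<And>i. i \<ge> N \<Longrightarrow> Lp_norm 2 \<Omega> (\<lambda>x. X n x - X i x) \<le> e" for n N e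
  proof -
    have e: "0 \<le> e" using N[of N] Lp_norm_nonneg order_trans by blast
    have m: "(\<lambda>x. X n x - u x) \<in> borel_measurable ?M" using um X by (intro borel_measurable_diff) (simp_all add: Lp_def)
    have "integrable ?M (\<lambda>x. norm (X n x - u x) ^ 2) \<and> (\<integral>x. norm (X n x - u x) ^ 2 \<partial>?M) \<le> e\<^sup>2"
    proof (rule fatou_integral[where f="\<lambda>i x. norm (X n x - X (r (i + N)) x) ^ 2"])
      show "integrable ?M (\<lambda>x. norm (X n x - X (r (i + N)) x) ^ 2)" for i using D by (simp add: Lp_def)
      show "AE x in ?M. (\<lambda>i. norm (X n x - X (r (i + N)) x) ^ 2) \<longlonglongrightarrow> norm (X n x - u x) ^ 2"
        using lim by eventually_elim (intro tendsto_intros LIMSEQ_ignore_initial_segment)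
      show "(\<lambda>x. norm (X n x - u x) ^ 2) \<in> borel_measurable ?M" using m by measurable
      have "r (i + N) \<ge> N" for i using seq_suble[OF r(1), of "i + N"] by simp
      then have "(Lp_norm 2 \<Omega> (\<lambda>x. X n x - X (r (i + N)) x))\<^sup>2 \<le> e\<^sup>2" for i
        using N by (intro power_mono) auto
      then show "(\<integral>x. norm (X n x - X (r (i + N)) x) ^ 2 \<partial>?M) \<le> e\<^sup>2" for i
        by (simp add: Lp_norm_2_sq l2ip_self)
    qed simp
    then show ?thesis using m e by (auto simp: Lp_def Lp_norm_2 l2ip_self intro: real_le_lsqrt)
  qed
  obtain N1 where N1: "\<And>i. i \<ge> N1 \<Longrightarrow> Lp_norm 2 \<Omega> (\<lambda>x. X N1 x - X i x) < 1"
    using C[of 1] by auto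
  have "(\<lambda>x. X N1 x - u x) \<in> Lp 2 \<Omega>" using key[of N1 N1 1] N1 by force
  then have "(\<lambda>x. X N1 x - (X N1 x - u x)) \<in> Lp 2 \<Omega>" by (rule Lp2_diff[OF X])
  moreover have "(\<lambda>x. X N1 x - (X N1 x - u x)) = u" by (simp add: fun_eq_iff)
  ultimately have uL: "u \<in> Lp 2 \<Omega>" by simp
  have "(\<lambda>n. Lp_norm 2 \<Omega> (\<lambda>x. X n x - u x)) \<longlonglongrightarrow> 0"
  proof (rule LIMSEQ_I)
    fix e :: real assume e: "0 < e"
    obtain N where N: "\<And>i j. i \<ge> N \<Longrightarrow> j \<ge> N \<Longrightarrow> Lp_norm 2 \<Omega> (\<lambda>x. X i x - X j x) < e / 2"
      using C[of "e / 2"] e by auto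
    have "Lp_norm 2 \<Omega> (\<lambda>x. X n x - u x) \<le> e / 2" if "n \<ge> N" for n
      using key[of N n "e/2"] N[OF that] by force
    then have "\<forall>n\<ge>N. norm (Lp_norm 2 \<Omega> (\<lambda>x. X n x - u x) - 0) < e"
      using e by force
    then show "\<exists>no. \<forall>n\<ge>no. norm (Lp_norm 2 \<Omega> (\<lambda>x. X n x - u x) - 0) < e" by blast
  qed
  then show ?thesis using that uL by blast
qed

lemma semi_hilbert_L2: "semi_hilbert (Lp 2 \<Omega> :: (real^3 \<Rightarrow> 'b::euclidean_space) set) fun_axpy (l2ip \<Omega>)"
proof
  show "Lp 2 \<Omega> \<noteq> ({} :: (real^3 \<Rightarrow> 'b) set)" using Lp2_zero by blast
  show "fun_axpy a x y \<in> Lp 2 \<Omega>" if "x \<in> Lp 2 \<Omega>" "y \<in> Lp 2 \<Omega>" for a and x y :: "real^3 \<Rightarrow> 'b"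
    unfolding fun_axpy_def using that by (rule Lp2_scaleR_add)
  show "l2ip \<Omega> (fun_axpy a x y) z = a * l2ip \<Omega> x z + l2ip \<Omega> y z"
    if "x \<in> Lp 2 \<Omega>" "y \<in> Lp 2 \<Omega>" "z \<in> Lp 2 \<Omega>" for a and x y z :: "real^3 \<Rightarrow> 'b"
    using that by (rule l2ip_axpy)
  show "l2ip \<Omega> x y = l2ip \<Omega> y x" for x y :: "real^3 \<Rightarrow> 'b" by (rule l2ip_commute)
  show "0 \<le> l2ip \<Omega> x x" for x :: "real^3 \<Rightarrow> 'b" by (simp add: l2ip_self)
  fix X :: "nat \<Rightarrow> real^3 \<Rightarrow> 'b"
  assume X: "\<And>n. X n \<in> Lp 2 \<Omega>"
    and C: "\<And>e. 0 < e \<Longrightarrow> \<exists>N. \<forall>m\<ge>N. \<forall>n\<ge>N.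
      sqrt (l2ip \<Omega> (fun_axpy (-1) (X n) (X m)) (fun_axpy (-1) (X n) (X m))) < e"
  have e: "fun_axpy (-1) u v = (\<lambda>x. v x - u x)" for u v :: "real^3 \<Rightarrow> 'b" by (simp add: fun_axpy_def)
  obtain u where "u \<in> Lp 2 \<Omega>" "(\<lambda>n. Lp_norm 2 \<Omega> (\<lambda>x. X n x - u x)) \<longlonglongrightarrow> 0"
    using L2_complete[of X] X C unfolding e Lp_norm_2[symmetric] by blast
  then show "\<exists>x\<in>Lp 2 \<Omega>. (\<lambda>n. sqrt (l2ip \<Omega> (fun_axpy (-1) x (X n)) (fun_axpy (-1) x (X n)))) \<longlonglongrightarrow> 0"
    unfolding e Lp_norm_2[symmetric] by blast
qed

lemma l2_cauchy_schwarz: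
  fixes u v :: "real^3 \<Rightarrow> 'b::euclidean_space"
  assumes "u \<in> Lp 2 \<Omega>" "v \<in> Lp 2 \<Omega>"
  shows "\<bar>l2ip \<Omega> u v\<bar> \<le> Lp_norm 2 \<Omega> u * Lp_norm 2 \<Omega> v"
  using semi_hilbert.cauchy_schwarz[OF semi_hilbert_L2 assms]
  by (simp add: semi_hilbert.nrm_def[OF semi_hilbert_L2] Lp_norm_2)

lemma l2ip_tendsto:
  fixes u v :: "real^3 \<Rightarrow> 'b::euclidean_space"
  assumes "\<And>n. X n \<in> Lp 2 \<Omega>" "u \<in> Lp 2 \<Omega>" "v \<in> Lp 2 \<Omega>"
    and "(\<lambda>n. Lp_norm 2 \<Omega> (\<lambda>x. X n x - u x)) \<longlonglongrightarrow> 0"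
  shows "(\<lambda>n. l2ip \<Omega> (X n) v) \<longlonglongrightarrow> l2ip \<Omega> u v"
  by (rule semi_hilbert.ip_tendsto[OF semi_hilbert_L2])
     (use assms in \<open>auto simp: semi_hilbert.dst_def[OF semi_hilbert_L2] semi_hilbert.nrm_def[OF semi_hilbert_L2]
        Lp_norm_2 fun_axpy_def\<close>)

end

section \<open>Smooth bump functions\<close>

text \<open>The derivative is quantified anew at each stage, which makes closure under sums,
  products and affine substitutions a direct induction. Continuity is not recorded, as it follows
  from one further derivative.\<close>

primrec smooth_n :: "nat \<Rightarrow> (real \<Rightarrow> real) \<Rightarrow> bool" where
  "smooth_n 0 f \<longleftrightarrow> True"
| "smooth_n (Suc n) f \<longleftrightarrow> (\<exists>f'. (\<forall>t. (f has_real_derivative f' t) (at t)) \<and> smooth_n n f')"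

lemma smooth_n_SucI:
  "(\<And>t. (f has_real_derivative f' t) (at t)) \<Longrightarrow> smooth_n n f' \<Longrightarrow> smooth_n (Suc n) f"
  by auto

lemma smooth_n_Suc_D: "smooth_n (Suc n) f \<Longrightarrow> smooth_n n f"
proof (induction n arbitrary: f)
  case (Suc n)
  then obtain f' where f': "\<forall>t. (f has_real_derivative f' t) (at t)" "smooth_n (Suc n) f'" by auto
  then show ?case using Suc.IH by auto
qed simp

lemma smooth_n_lincomb:
  "smooth_n n f \<Longrightarrow> smooth_n n g \<Longrightarrow> smooth_n n (\<lambda>t. a * f t + b * g t)"
proof (induction n arbitrary: f g)
  case (Suc n)
  then obtain f' g' where d: "\<forall>t. (f has_real_derivative f' t) (at t)" "smooth_n n f'"
    "\<forall>t. (g has_real_derivative g' t) (at t)" "smooth_n n g'" by auto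
  have "((\<lambda>t. a * f t + b * g t) has_real_derivative a * f' t + b * g' t) (at t)" for t
    using d by (auto intro!: derivative_eq_intros)
  then show ?case using Suc.IH[OF d(2) d(4)] by (rule smooth_n_SucI)
qed simp

lemma smooth_n_mult:
  "smooth_n n f \<Longrightarrow> smooth_n n g \<Longrightarrow> smooth_n n (\<lambda>t. f t * g t)"
proof (induction n arbitrary: f g)
  case (Suc n)
  then obtain f' g' where d: "\<forall>t. (f has_real_derivative f' t) (at t)" "smooth_n n f'"
    "\<forall>t. (g has_real_derivative g' t) (at t)" "smooth_n n g'" by auto
  have "((\<lambda>t. f t * g t) has_real_derivative 1 * (f' t * g t) + 1 * (f t * g' t)) (at t)" for t
    using d by (auto intro!: derivative_eq_intros)
  moreover have "smooth_n n (\<lambda>t. 1 * (f' t * g t) + 1 * (f t * g' t))"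
    using smooth_n_lincomb[OF Suc.IH[OF d(2) smooth_n_Suc_D[OF Suc.prems(2)]]
        Suc.IH[OF smooth_n_Suc_D[OF Suc.prems(1)] d(4)], of 1 1] .
  ultimately show ?case by (rule smooth_n_SucI)
qed simp

lemma smooth_n_affine: "smooth_n n f \<Longrightarrow> smooth_n n (\<lambda>t. f (a * t + b))"
proof (induction n arbitrary: f)
  case (Suc n)
  then obtain f' where d: "\<forall>t. (f has_real_derivative f' t) (at t)" "smooth_n n f'" by auto
  have "((\<lambda>t. f (a * t + b)) has_real_derivative a * f' (a * t + b) + 0 * f' (a * t + b)) (at t)" for t
  proof -
    have "((\<lambda>t. a * t + b) has_real_derivative a) (at t)" by (auto intro!: derivative_eq_intros)
    then have "((\<lambda>t. f (a * t + b)) has_real_derivative f' (a * t + b) * a) (at t)"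
      using d(1) by (intro DERIV_chain2[of f]) auto
    then show ?thesis by (simp add: mult.commute)
  qed
  moreover have "smooth_n n (\<lambda>t. a * f' (a * t + b) + 0 * f' (a * t + b))"
    using smooth_n_lincomb[OF Suc.IH[OF d(2)] Suc.IH[OF d(2)], of a 0] .
  ultimately show ?case by (rule smooth_n_SucI)
qed simp

text \<open>The classical function exp(-1/t), extended by 0. The factor t^-m makes the family closed
  under differentiation up to linear combinations, so one induction proves all its members
  smooth.\<close>

definition flat :: "nat \<Rightarrow> real \<Rightarrow> real" where
  "flat m t = (if 0 < t then inverse t ^ m * exp (- inverse t) else 0)"

lemma flat_tendsto_0: "(flat m \<longlongrightarrow> 0) (at_right 0)"
proof -
  have "((\<lambda>t. inverse t ^ m / exp (inverse t)) \<longlongrightarrow> 0) (at_right (0::real))"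
    by (rule filterlim_compose[OF tendsto_power_div_exp_0 filterlim_inverse_at_top_right])
  then show ?thesis
    by (rule Lim_transform_eventually) (auto simp: eventually_at_filter flat_def exp_minus divide_inverse)
qed

lemma flat_deriv: "(flat m has_real_derivative flat (m + 2) t - real m * flat (m + 1) t) (at t)"
proof (cases "t = 0")
  case True
  have "((\<lambda>h. (flat m h - flat m 0) / (h - 0)) \<longlongrightarrow> 0) (at_left 0)"
    by (rule Lim_transform_eventually[OF tendsto_const]) (auto simp: eventually_at_filter flat_def)
  \<comment> \<open>To the right of 0 the difference quotient of \<open>flat m\<close> is
    \<open>flat (Suc m)\<close>, which tends to 0.\<close>
  moreover have "((\<lambda>h. (flat m h - flat m 0) / (h - 0)) \<longlongrightarrow> 0) (at_right 0)"
    by (rule Lim_transform_eventually[OF flat_tendsto_0[of "Suc m"]])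
       (auto simp: eventually_at_filter flat_def field_simps)
  ultimately have "((\<lambda>h. (flat m h - flat m 0) / (h - 0)) \<longlongrightarrow> 0) (at 0)"
    by (simp add: filterlim_split_at)
  then show ?thesis unfolding has_field_derivative_iff using True by (simp add: flat_def)
next
  case False
  show ?thesis
  proof (cases "0 < t")
    case True
    have "((\<lambda>t. inverse t ^ m * exp (- inverse t)) has_real_derivative
        inverse t ^ (m + 2) * exp (- inverse t) - real m * (inverse t ^ (m + 1) * exp (- inverse t))) (at t)"
    proof (cases m)
      case 0
      then show ?thesis using True
        by (auto intro!: derivative_eq_intros simp: field_simps power2_eq_square)
    next
      case (Suc k)
      have "((\<lambda>t. inverse t ^ Suc k) has_real_derivative - real (Suc k) * inverse t ^ (k + 2)) (at t)"
        using True DERIV_power[OF DERIV_inverse[of t UNIV], of "Suc k"] by (simp add: algebra_simps)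
      moreover have "((\<lambda>t. exp (- inverse t)) has_real_derivative exp (- inverse t) * inverse t ^ 2) (at t)"
        using True by (auto intro!: derivative_eq_intros simp: field_simps power2_eq_square)
      ultimately have "((\<lambda>t. inverse t ^ Suc k * exp (- inverse t)) has_real_derivative
          - real (Suc k) * inverse t ^ (k + 2) * exp (- inverse t)
          + exp (- inverse t) * inverse t ^ 2 * inverse t ^ Suc k) (at t)"
        by (rule DERIV_mult)
      moreover have "- real (Suc k) * inverse t ^ (k + 2) * exp (- inverse t)
          + exp (- inverse t) * inverse t ^ 2 * inverse t ^ Suc k
          = inverse t ^ (m + 2) * exp (- inverse t) - real m * (inverse t ^ (m + 1) * exp (- inverse t))"
        by (simp add: Suc power2_eq_square algebra_simps)
      ultimately show ?thesis by (simp only: Suc)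
    qed
    then have "(flat m has_real_derivative
        inverse t ^ (m + 2) * exp (- inverse t) - real m * (inverse t ^ (m + 1) * exp (- inverse t))) (at t)"
      by (rule has_field_derivative_transform_within_open[of _ _ _ "{0<..}"]) (use True in \<open>auto simp: flat_def\<close>)
    then show ?thesis using True by (simp add: flat_def)
  next
    case neg: False
    have "((\<lambda>t. 0) has_real_derivative 0) (at t)" by simp
    then have "(flat m has_real_derivative 0) (at t)"
      by (rule has_field_derivative_transform_within_open[of _ _ _ "{..<0}"])
         (use False neg in \<open>auto simp: flat_def\<close>)
    then show ?thesis using neg by (simp add: flat_def)
  qed
qed

lemma flat_smooth: "smooth_n n (flat m)"
proof (induction n arbitrary: m)
  case (Suc n)
  have "smooth_n n (\<lambda>t. 1 * flat (m + 2) t + (- real m) * flat (m + 1) t)"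
    by (intro smooth_n_lincomb Suc)
  then show ?case using flat_deriv[of m] by (intro smooth_n_SucI[of "flat m"]) auto
qed simp

text \<open>A product of two reflected copies of exp(-1/t), positive exactly on (-1, 1), together
  with all its derivatives. Collecting the derivatives in one family lets \<open>bump\<close> carry
  a multi-index.\<close>

definition bump1 :: "nat \<Rightarrow> real \<Rightarrow> real" where
  "bump1 k = (deriv ^^ k) (\<lambda>t. flat 0 ((-1) * t + 1) * flat 0 (1 * t + 1))"

lemma smooth_n_deriv_funpow:
  "smooth_n (Suc k) f \<Longrightarrow> ((deriv ^^ k) f has_real_derivative (deriv ^^ Suc k) f t) (at t)"
proof (induction k arbitrary: f)
  case 0
  then obtain f' where d: "\<forall>t. (f has_real_derivative f' t) (at t)" by auto
  then have "f' = deriv f" by (metis DERIV_imp_deriv ext)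
  then show ?case using d by auto
next
  case (Suc k)
  then obtain f' where d: "\<forall>t. (f has_real_derivative f' t) (at t)" "smooth_n (Suc k) f'" by auto
  then have "f' = deriv f" by (metis DERIV_imp_deriv ext)
  then show ?case using Suc.IH[OF d(2)] by (simp add: funpow_swap1)
qed

lemma bump1_deriv: "(bump1 k has_real_derivative bump1 (Suc k) t) (at t)"
  unfolding bump1_def
  by (intro smooth_n_deriv_funpow smooth_n_mult smooth_n_affine flat_smooth)

lemma bump1_zero: "1 < \<bar>t\<bar> \<Longrightarrow> bump1 k t = 0"
proof (induction k arbitrary: t)
  case 0
  then show ?case by (auto simp: bump1_def flat_def)
next
  case (Suc k)
  have "open {t. 1 < \<bar>t::real\<bar>}" by (intro open_Collect_less continuous_intros)
  then have "(bump1 k has_real_derivative 0) (at t)"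
    by (rule has_field_derivative_transform_within_open[OF DERIV_const[of 0]])
       (simp_all add: Suc.prems Suc.IH)
  then show ?case using DERIV_unique[OF bump1_deriv[of k t]] by simp
qed

lemma bump1_nonneg: "0 \<le> bump1 0 t"
  by (simp add: bump1_def flat_def)

lemma bump1_pos: "0 < bump1 0 0"
  by (simp add: bump1_def flat_def)

lemma bump1_continuous: "continuous_on UNIV (bump1 k)"
  using bump1_deriv by (auto intro!: DERIV_continuous_on)

text \<open>The multi-index \<open>m\<close> counts the derivatives taken in each coordinate direction.\<close>

definition bump :: "(3 \<Rightarrow> nat) \<Rightarrow> real \<Rightarrow> real^3 \<Rightarrow> real" where
  "bump m s z = (\<Prod>i\<in>UNIV. bump1 (m i) (s * z $ i))"

lemma bump_has_derivative:
  "((\<lambda>y. bump m s (y - c)) has_derivative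
     (\<lambda>h. \<Sum>i\<in>UNIV. h $ i * (s * bump (m(i := Suc (m i))) s (y - c)))) (at y)"
proof -
  have 1: "((\<lambda>y. bump1 (m i) (s * (y - c) $ i)) has_derivative
      (\<lambda>h. bump1 (Suc (m i)) (s * (y - c) $ i) * (s * h $ i))) (at y)" for i
  proof -
    have "((\<lambda>y. s * (y - c) $ i) has_derivative (\<lambda>h. s * h $ i)) (at y)"
      by (auto intro!: derivative_eq_intros bounded_linear_imp_has_derivative bounded_linear_vec_nth)
    from has_derivative_compose[OF this bump1_deriv[unfolded has_field_derivative_def]]
    show ?thesis by simp
  qed
  have 2: "bump1 (Suc (m i)) (s * (y - c) $ i) * (\<Prod>j\<in>UNIV - {i}. bump1 (m j) (s * (y - c) $ j))
      = bump (m(i := Suc (m i))) s (y - c)" for i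
    unfolding bump_def by (subst (2) prod.remove[of _ i]) auto
  show ?thesis
    unfolding bump_def[of m, abs_def]
    by (rule has_derivative_eq_rhs[OF has_derivative_prod[OF 1]])
       (auto simp: fun_eq_iff 2[symmetric] algebra_simps intro!: sum.cong)
qed

lemma partial_derivI:
  assumes "(f has_derivative f') (at x)"
  shows "partial_deriv i f x = f' (axis i 1)"
  using frechet_derivative_at[OF assms] by (simp add: partial_deriv_def)

lemma partial_deriv_bump:
  "partial_deriv j (\<lambda>y. r * bump m s (y - c)) = (\<lambda>y. (r * s) * bump (m(j := Suc (m j))) s (y - c))"
proof
  fix y
  have "((\<lambda>y. r * bump m s (y - c)) has_derivative
     (\<lambda>h. r * (\<Sum>i\<in>UNIV. h $ i * (s * bump (m(i := Suc (m i))) s (y - c))))) (at y)"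
    by (intro derivative_intros bump_has_derivative)
  then show "partial_deriv j (\<lambda>y. r * bump m s (y - c)) y = (r * s) * bump (m(j := Suc (m j))) s (y - c)"
    by (simp add: partial_derivI axis_def if_distrib[where f="\<lambda>x. x * _"] fun_upd_def cong: if_cong)
qed

text \<open>A partial derivative of a multiple of a bump is again a multiple of a bump with another
  multi-index; hence the induction over all \<open>r\<close> and \<open>m\<close>.\<close>

lemma C_k_bump: "C_k k (\<lambda>y. r * bump m s (y - c))"
proof (induction k arbitrary: r m)
  case 0
  have "continuous_on UNIV (\<lambda>y. bump1 (m i) (s * (y - c) $ i))" for i
    by (rule continuous_on_compose2[OF bump1_continuous]) (auto intro!: continuous_intros)
  then show ?case unfolding bump_def by (auto intro!: continuous_intros)
next
  case (Suc k)
  have "(\<lambda>y. r * bump m s (y - c)) differentiable (at y)" for y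
    using has_derivative_mult_right[OF bump_has_derivative] by (rule differentiableI)
  then show ?case using Suc by (simp add: partial_deriv_bump)
qed

text \<open>The support is a cube of half-width 1/s. Its half diagonal, sqrt 3 / s, is rounded up to
  2 / s; this is the origin of the radius 2 / (n + 1) of the mollifiers.\<close>

lemma bump_zero:
  assumes "0 < s" "2 < s * norm z"
  shows "bump m s z = 0"
proof -
  have "\<exists>i. 1 < \<bar>s * z $ i\<bar>"
  proof (rule ccontr)
    assume "\<not> ?thesis"
    then have le: "\<bar>s * z $ i\<bar> \<le> 1" for i by (simp add: not_less)
    have "(norm (s *\<^sub>R z))\<^sup>2 = (\<Sum>i\<in>UNIV. (s * z $ i)\<^sup>2)"
      by (simp only: power2_norm_eq_inner) (simp add: inner_vec_def power2_eq_square)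
    also have "\<dots> \<le> (\<Sum>i\<in>(UNIV::3 set). 1)"
      using le by (intro sum_mono) (auto simp: abs_le_square_iff[of _ 1, simplified])
    finally have "(norm (s *\<^sub>R z))\<^sup>2 \<le> 2\<^sup>2" by simp
    then have "norm (s *\<^sub>R z) \<le> 2" by (rule power2_le_imp_le) simp
    then show False using assms by simp
  qed
  then show ?thesis unfolding bump_def using bump1_zero by auto
qed

lemma bump_nonneg: "0 \<le> bump (\<lambda>_. 0) s z"
  unfolding bump_def by (intro prod_nonneg) (auto simp: bump1_nonneg)

lemma bump_pos: "0 < bump (\<lambda>_. 0) s 0"
  unfolding bump_def by (intro prod_pos) (auto simp: bump1_pos)

lemma bump_test_function:
  assumes s: "0 < s" and sub: "cball c (2 / s) \<subseteq> \<Omega>"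
  shows "(\<lambda>y. r * bump m s (y - c)) \<in> test_functions \<Omega>"
proof -
  have "{y. r * bump m s (y - c) \<noteq> 0} \<subseteq> cball c (2 / s)"
  proof
    fix y assume "y \<in> {y. r * bump m s (y - c) \<noteq> 0}"
    then have "\<not> 2 < s * norm (y - c)" using bump_zero[OF s] by auto
    then show "y \<in> cball c (2 / s)" using s by (simp add: dist_norm norm_minus_commute field_simps)
  qed
  then have c: "closure {y. r * bump m s (y - c) \<noteq> 0} \<subseteq> cball c (2 / s)"
    by (simp add: closure_minimal)
  then have "compact (closure {y. r * bump m s (y - c) \<noteq> 0})"
    by (metis bounded_cball bounded_subset closed_closure compact_eq_bounded_closed)
  then show ?thesis using c sub C_k_bump by (auto simp: test_functions_def)
qed

section \<open>Integration by parts\<close>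

definition Cc :: "(real^3 \<Rightarrow> real) \<Rightarrow> bool" where
  "Cc f \<longleftrightarrow> continuous_on UNIV f \<and> (\<exists>R. \<forall>x. R < norm x \<longrightarrow> f x = 0)"

lemma integrable_bounded_support:
  fixes f :: "real^3 \<Rightarrow> 'b::euclidean_space"
  assumes "f \<in> borel_measurable borel" "\<And>x. norm (f x) \<le> B" "\<And>x. R < norm x \<Longrightarrow> f x = 0"
  shows "integrable lborel f"
proof (rule integrableI_bounded_set[where A="cball 0 R" and B=B])
  show "emeasure lborel (cball (0::real^3) R) < \<infinity>"
    using emeasure_bounded_finite[OF bounded_cball] by simp
qed (use assms in auto)

lemma Cc_bounded:
  assumes "Cc f" obtains B where "\<And>x. \<bar>f x\<bar> \<le> B" "0 \<le> B"
proof -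
  obtain R where R: "\<And>x. R < norm x \<Longrightarrow> f x = 0" and c: "continuous_on UNIV f"
    using assms by (auto simp: Cc_def)
  have "compact (f ` cball 0 R)"
    by (intro compact_continuous_image continuous_on_subset[OF c]) auto
  then obtain B where "\<forall>x\<in>cball 0 R. \<bar>f x\<bar> \<le> B"
    by (metis (no_types, lifting) bounded_iff compact_imp_bounded imageI real_norm_def)
  then have "\<bar>f x\<bar> \<le> \<bar>B\<bar>" for x
    using R[of x] by (cases "R < norm x") (auto simp: not_less intro: order_trans[OF _ abs_ge_self])
  then show ?thesis using that[of "\<bar>B\<bar>"] by simp
qed

lemma Cc_measurable: "Cc f \<Longrightarrow> f \<in> borel_measurable borel"
  by (auto simp: Cc_def intro: borel_measurable_continuous_onI)

lemma Cc_integrable: "Cc f \<Longrightarrow> integrable lborel f"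
  by (metis Cc_bounded Cc_def Cc_measurable integrable_bounded_support real_norm_def)

lemma Cc_mult: "Cc f \<Longrightarrow> continuous_on UNIV g \<Longrightarrow> Cc (\<lambda>x. f x * g x)"
  by (auto simp: Cc_def intro!: continuous_intros)

lemma Cc_uminus: "Cc f \<Longrightarrow> Cc (\<lambda>x. - f x)"
  by (auto simp: Cc_def intro!: continuous_intros)

lemma Cc_add: "Cc f \<Longrightarrow> Cc g \<Longrightarrow> Cc (\<lambda>x. f x + g x)"
  unfolding Cc_def
proof (elim conjE exE, intro conjI)
  fix R S assume "\<forall>x. R < norm x \<longrightarrow> f x = 0" "\<forall>x. S < norm x \<longrightarrow> g x = 0"
  then show "\<exists>R. \<forall>x. R < norm x \<longrightarrow> f x + g x = 0" by (intro exI[of _ "max R S"]) auto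
qed (auto intro!: continuous_intros)

lemma Cc_reflect: "Cc f \<Longrightarrow> Cc (\<lambda>x. f (y - x))"
  unfolding Cc_def
proof (elim conjE exE, intro conjI)
  fix R assume R: "\<forall>x. R < norm x \<longrightarrow> f x = 0"
  have "f (y - x) = 0" if "R + norm y < norm x" for x
    using R that norm_triangle_ineq2[of x y] by (simp add: norm_minus_commute)
  then show "\<exists>R. \<forall>x. R < norm x \<longrightarrow> f (y - x) = 0" by blast
qed (auto intro!: continuous_on_compose2[of UNIV f] continuous_intros)

lemma Cc_bump: "0 < s \<Longrightarrow> Cc (\<lambda>y. r * bump m s (y - c))"
  unfolding Cc_def
proof (intro conjI)
  assume s: "0 < s"
  have "bump m s (y - c) = 0" if "2 / s + norm c < norm y" for y
  proof -
    have "2 / s < norm (y - c)" using that norm_triangle_ineq2[of y c] by simp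
    then show ?thesis using s by (intro bump_zero) (auto simp: field_simps)
  qed
  then show "\<exists>R. \<forall>x. R < norm x \<longrightarrow> r * bump m s (x - c) = 0" by auto
qed (use C_k_bump[of 0] in simp)

lemma integral_translate:
  fixes f :: "real^3 \<Rightarrow> real"
  assumes "f \<in> borel_measurable borel"
  shows "(\<integral>x. f (x + c) \<partial>lborel) = (\<integral>x. f x \<partial>lborel)"
proof -
  have "(\<integral>x. f x \<partial>lborel) = (\<integral>x. f x \<partial>distr lborel borel ((+) c))" by (simp add: lborel_distr_plus)
  also have "\<dots> = (\<integral>x. f (c + x) \<partial>lborel)" using assms by (subst integral_distr) auto
  finally show ?thesis by (simp add: add.commute)
qed

text \<open>The integral of \<open>F\<close> is translation invariant, so the integrals of its difference quotients
  vanish; they converge to the integral of the directional derivative.\<close>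

lemma integral_directional_deriv_zero:
  assumes F: "Cc F" and D: "Cc D"
    and deriv: "\<And>x. ((\<lambda>t. F (x + t *\<^sub>R e)) has_real_derivative D x) (at 0)"
  shows "(\<integral>x. D x \<partial>lborel) = 0"
proof -
  obtain R where R: "\<And>x. R < norm x \<Longrightarrow> F x = 0" using F by (auto simp: Cc_def)
  obtain B where B: "\<And>x. \<bar>D x\<bar> \<le> B" "0 \<le> B" using Cc_bounded[OF D] by blast
  have deriv': "((\<lambda>t. F (x + t *\<^sub>R e)) has_real_derivative D (x + t *\<^sub>R e)) (at t)" for x t
    using DERIV_shift[of "\<lambda>t. F (x + t *\<^sub>R e)" "D (x + t *\<^sub>R e)" 0 t] deriv[of "x + t *\<^sub>R e"]
    by (simp add: algebra_simps)
  define q where "q n x = real (Suc n) * (F (x + (1 / real (Suc n)) *\<^sub>R e) - F x)" for n x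
  have qB: "\<bar>q n x\<bar> \<le> B" for n x
  proof -
    let ?h = "1 / real (Suc n)"
    \<comment> \<open>By the mean value theorem each quotient is a value of \<open>D\<close>, which
      gives the uniform bound needed for dominated convergence.\<close>
    have "\<exists>z. 0 < z \<and> z < ?h \<and> F (x + ?h *\<^sub>R e) - F (x + 0 *\<^sub>R e) = (?h - 0) * D (x + z *\<^sub>R e)"
      by (rule MVT2[of 0 ?h "\<lambda>t. F (x + t *\<^sub>R e)"]) (use deriv' in auto)
    then obtain z where "F (x + ?h *\<^sub>R e) - F x = ?h * D (x + z *\<^sub>R e)" by auto
    then have "q n x = D (x + z *\<^sub>R e)" by (simp add: q_def)
    then show ?thesis using B by simp
  qed
  have qR: "q n x = 0" if "R + norm e < norm x" for n x
  proof -
    have "norm ((1 / real (Suc n)) *\<^sub>R e) \<le> norm e" by (simp add: divide_le_eq algebra_simps)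
    moreover have "norm x \<le> norm (x + (1 / real (Suc n)) *\<^sub>R e) + norm ((1 / real (Suc n)) *\<^sub>R e)"
      using norm_triangle_ineq4[of "x + (1 / real (Suc n)) *\<^sub>R e" "(1 / real (Suc n)) *\<^sub>R e"] by simp
    ultimately have "R < norm (x + (1 / real (Suc n)) *\<^sub>R e)" using that by linarith
    moreover have "R < norm x" using that norm_ge_zero[of e] by linarith
    ultimately show ?thesis using R by (simp add: q_def)
  qed
  have qlim: "(\<lambda>n. q n x) \<longlonglongrightarrow> D x" for x
  proof -
    have "((\<lambda>h. (F (x + h *\<^sub>R e) - F x) / h) \<longlongrightarrow> D x) (at 0)"
      using deriv[of x] by (simp add: has_field_derivative_iff)
    moreover have "filterlim (\<lambda>n. 1 / real (Suc n)) (at 0) sequentially"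
      unfolding filterlim_at using LIMSEQ_Suc[OF lim_1_over_n] by auto
    ultimately have "(\<lambda>n. (F (x + (1 / real (Suc n)) *\<^sub>R e) - F x) / (1 / real (Suc n))) \<longlonglongrightarrow> D x"
      by (rule filterlim_compose)
    then show ?thesis by (simp add: q_def mult.commute)
  qed
  have Fm[measurable]: "F \<in> borel_measurable borel" and Dm: "D \<in> borel_measurable borel"
    using F D Cc_measurable by auto
  have qm: "q n \<in> borel_measurable borel" for n unfolding q_def by measurable
  have "(\<integral>x. q n x \<partial>lborel) = 0" for n
  proof -
    have "Cc (\<lambda>x. F (x + c))" for c
      using Cc_reflect[OF Cc_reflect[OF F, of c], of 0] by (simp add: algebra_simps)
    then have "integrable lborel (\<lambda>x. F (x + c))" for c by (rule Cc_integrable)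
    then show ?thesis unfolding q_def using Cc_integrable[OF F] integral_translate[OF Fm]
      by simp
  qed
  moreover have "(\<lambda>n. \<integral>x. q n x \<partial>lborel) \<longlonglongrightarrow> (\<integral>x. D x \<partial>lborel)"
  proof (rule integral_dominated_convergence[where w="\<lambda>x. B * indicator (cball 0 (R + norm e)) x"])
    show "integrable lborel (\<lambda>x. B * indicator (cball 0 (R + norm e)) x :: real)"
      by (intro integrable_mult_right integrable_real_indicator) (use emeasure_bounded_finite[OF bounded_cball] in auto)
    show "AE x in lborel. norm (q n x) \<le> B * indicator (cball 0 (R + norm e)) x" for n
      using qB qR by (intro AE_I2) (auto simp: indicator_def not_le)
  qed (use qm qlim Dm in auto)
  ultimately show ?thesis by (simp add: LIMSEQ_const_iff)
qed

lemma partial_deriv_directional: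
  assumes "(f has_derivative f') (at x)"
  shows "((\<lambda>t. f (x + t *\<^sub>R axis i 1)) has_real_derivative partial_deriv i f x) (at 0)"
proof -
  have 1: "((\<lambda>t::real. x + t *\<^sub>R axis i 1) has_derivative (\<lambda>t. t *\<^sub>R axis i 1)) (at 0)"
    by (auto intro!: derivative_eq_intros)
  have 2: "(f has_derivative f') (at (x + 0 *\<^sub>R axis i 1))" using assms by simp
  have "((\<lambda>t. f (x + t *\<^sub>R axis i 1)) has_derivative (\<lambda>t. f' (t *\<^sub>R axis i 1))) (at 0)"
    using has_derivative_compose[OF 1 2] .
  moreover have "f' (t *\<^sub>R axis i 1) = partial_deriv i f x * t" for t
    using linear_cmul[OF has_derivative_linear[OF assms]] partial_derivI[OF assms] by simp
  ultimately show ?thesis by (simp add: has_field_derivative_def)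
qed

text \<open>The product f g has compact support, so the integral of its directional derivative
  vanishes; the product rule splits it into the two sides.\<close>

lemma integration_by_parts:
  assumes f: "Cc f" "\<And>x. f differentiable (at x)" "continuous_on UNIV (partial_deriv i f)"
    and g: "Cc g" "\<And>x. g differentiable (at x)" "continuous_on UNIV (partial_deriv i g)"
  shows "(\<integral>x. f x * partial_deriv i g x \<partial>lborel) = - (\<integral>x. partial_deriv i f x * g x \<partial>lborel)"
proof -
  have fd: "((\<lambda>t. f (x + t *\<^sub>R axis i 1)) has_real_derivative partial_deriv i f x) (at 0)" for x
    using f(2)[of x] partial_deriv_directional unfolding differentiable_def by blast
  have gd: "((\<lambda>t. g (x + t *\<^sub>R axis i 1)) has_real_derivative partial_deriv i g x) (at 0)" for x
    using g(2)[of x] partial_deriv_directional unfolding differentiable_def by blast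
  have c1: "Cc (\<lambda>x. f x * partial_deriv i g x)" using f g by (intro Cc_mult)
  have c2: "Cc (\<lambda>x. partial_deriv i f x * g x)"
    using Cc_mult[OF g(1) f(3)] by (simp add: mult.commute)
  have "(\<integral>x. (f x * partial_deriv i g x + partial_deriv i f x * g x) \<partial>lborel) = 0"
  proof (rule integral_directional_deriv_zero)
    show "Cc (\<lambda>x. f x * g x)" using f g by (intro Cc_mult) (auto simp: Cc_def)
    show "((\<lambda>t. f (x + t *\<^sub>R axis i 1) * g (x + t *\<^sub>R axis i 1)) has_real_derivative
        f x * partial_deriv i g x + partial_deriv i f x * g x) (at 0)" for x
      using DERIV_mult[OF fd gd, of x x] by (simp add: algebra_simps)
  qed (intro Cc_add c1 c2)
  then show ?thesis using Cc_integrable[OF c1] Cc_integrable[OF c2] by simp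
qed

lemma test_function_Cc:
  assumes "\<phi> \<in> test_functions \<Omega>"
  shows "Cc \<phi>" "Cc (partial_deriv i \<phi>)" "\<And>x. \<phi> differentiable (at x)"
    "\<And>x. x \<notin> \<Omega> \<Longrightarrow> \<phi> x = 0" "\<And>x. x \<notin> \<Omega> \<Longrightarrow> partial_deriv i \<phi> x = 0"
proof -
  define S where "S = closure {x. \<phi> x \<noteq> 0}"
  have C: "\<And>k. C_k k \<phi>" and comp: "compact S" and sub: "S \<subseteq> \<Omega>"
    using assms by (simp_all add: test_functions_def S_def)
  show d: "\<phi> differentiable (at x)" for x using C[of 1] by simp
  have z: "x \<notin> S \<Longrightarrow> \<phi> x = 0" for x unfolding S_def using closure_subset[of "{x. \<phi> x \<noteq> 0}"] by auto
  have z': "partial_deriv i \<phi> x = 0" if "x \<notin> S" for x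
  proof -
    have "((\<lambda>_. 0) has_derivative (\<lambda>_. 0)) (at x)" by simp
    then have "(\<phi> has_derivative (\<lambda>_. 0)) (at x)"
      by (rule has_derivative_transform_within_open[of _ _ _ _ "- S"]) (use that z comp compact_imp_closed in auto)
    then show ?thesis by (rule partial_derivI)
  qed
  obtain R where R: "\<forall>x\<in>S. norm x \<le> R" using comp compact_imp_bounded bounded_iff by metis
  have "R < norm x \<Longrightarrow> x \<notin> S" for x using R by force
  then show "Cc \<phi>" "Cc (partial_deriv i \<phi>)"
    using C[of 0] C[of 1] z z' by (auto simp: Cc_def)
  show "x \<notin> \<Omega> \<Longrightarrow> \<phi> x = 0" "x \<notin> \<Omega> \<Longrightarrow> partial_deriv i \<phi> x = 0" for x using sub z z' by auto
qed

section \<open>Mollification\<close>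

text \<open>For \<open>k\<close> smooth, \<open>y \<mapsto> k (y - x)\<close> is the test function with which \<open>conv k f x\<close> pairs \<open>f\<close>; the
  sign of the argument is chosen so that no reflection of \<open>k\<close> is needed.\<close>

definition conv :: "(real^3 \<Rightarrow> real) \<Rightarrow> (real^3 \<Rightarrow> real) \<Rightarrow> real^3 \<Rightarrow> real" where
  "conv k f x = (\<integral>y. k (y - x) * f y \<partial>lborel)"

lemma integral_reflect:
  fixes f :: "real^3 \<Rightarrow> real"
  assumes "f \<in> borel_measurable borel"
  shows "(\<integral>x. f (c - x) \<partial>lborel) = (\<integral>x. f x \<partial>lborel)"
proof -
  have "(lborel :: (real^3) measure) = distr lborel borel (\<lambda>x. c - x)"
    using lborel_affine[of "-1" c] by (simp add: density_1)
  then have "(\<integral>x. f x \<partial>lborel) = (\<integral>x. f x \<partial>distr lborel borel (\<lambda>x. c - x))" by simp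
  also have "\<dots> = (\<integral>x. f (c - x) \<partial>lborel)" using assms by (subst integral_distr) auto
  finally show ?thesis by simp
qed

lemma Cc_translate: "Cc k \<Longrightarrow> Cc (\<lambda>y. k (y - x))"
  using Cc_reflect[OF Cc_reflect[of k "-x"], of 0] by simp

lemma Cc_abs: "Cc k \<Longrightarrow> Cc (\<lambda>x. \<bar>k x\<bar>)"
  by (auto simp: Cc_def intro!: continuous_intros)

lemma Cc_mult_integrable:
  assumes "Cc k" "integrable lborel f"
  shows "integrable lborel (\<lambda>y. k y * f y)"
proof -
  obtain B where B: "\<And>x. \<bar>k x\<bar> \<le> B" "0 \<le> B" using Cc_bounded[OF assms(1)] by blast
  show ?thesis
  proof (rule Bochner_Integration.integrable_bound)
    show "integrable lborel (\<lambda>y. B * f y)" using assms by simp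
    show "(\<lambda>y. k y * f y) \<in> borel_measurable lborel"
      using Cc_measurable[OF assms(1)] assms(2) by auto
    show "AE y in lborel. norm (k y * f y) \<le> norm (B * f y)"
      using B by (intro AE_I2) (auto simp: abs_mult intro!: mult_right_mono)
  qed
qed

lemma conv_integrand: "Cc k \<Longrightarrow> integrable lborel f \<Longrightarrow> integrable lborel (\<lambda>y. k (y - x) * f y)"
  by (intro Cc_mult_integrable Cc_translate)

lemma conv_measurable:
  assumes k: "Cc k" and f: "integrable lborel f"
  shows "conv k f \<in> borel_measurable borel"
proof -
  have [measurable]: "k \<in> borel_measurable borel" "f \<in> borel_measurable borel"
    using Cc_measurable[OF k] borel_measurable_integrable[OF f] by auto
  show ?thesis unfolding conv_def[abs_def] by measurable
qed

lemma conv_bound: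
  assumes k: "Cc k" and f: "integrable lborel f" and B: "\<And>x. \<bar>k x\<bar> \<le> B"
  shows "\<bar>conv k f x\<bar> \<le> B * (\<integral>y. \<bar>f y\<bar> \<partial>lborel)"
proof -
  have "\<bar>conv k f x\<bar> \<le> (\<integral>y. \<bar>k (y - x) * f y\<bar> \<partial>lborel)"
    unfolding conv_def using integral_norm_bound[of lborel "\<lambda>y. k (y - x) * f y"] by simp
  also have "\<dots> \<le> (\<integral>y. B * \<bar>f y\<bar> \<partial>lborel)"
    using conv_integrand[OF k f] f B
    by (intro integral_mono integrable_abs integrable_mult_right) (auto simp: abs_mult intro!: mult_right_mono)
  finally show ?thesis by simp
qed

lemma conv_zero:
  assumes "\<And>z. S < norm z \<Longrightarrow> k z = 0" "\<And>y. R < norm y \<Longrightarrow> f y = 0" "R + S < norm x"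
  shows "conv k f x = 0"
proof -
  have "k (y - x) * f y = 0" for y
  proof (cases "R < norm y")
    case False
    have "norm x \<le> norm y + norm (y - x)" using norm_triangle_sub[of x y] by (simp add: norm_minus_commute)
    then have "S < norm (y - x)" using False assms(3) by linarith
    then show ?thesis using assms(1) by simp
  qed (use assms in simp)
  then have "(\<lambda>y. k (y - x) * f y) = (\<lambda>_. 0)" by (rule ext)
  then show ?thesis by (simp add: conv_def)
qed

definition bsupp :: "(real^3 \<Rightarrow> real) \<Rightarrow> bool" where
  "bsupp f \<longleftrightarrow> integrable lborel f \<and> (\<exists>R. \<forall>x. R < norm x \<longrightarrow> f x = 0)"

lemma conv_bsupp:
  assumes k: "Cc k" and f: "bsupp f"
  obtains B R where "\<And>x. \<bar>conv k f x\<bar> \<le> B" "\<And>x. R < norm x \<Longrightarrow> conv k f x = 0"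
    "conv k f \<in> borel_measurable borel"
proof -
  obtain B where "\<And>x. \<bar>k x\<bar> \<le> B" using Cc_bounded[OF k] by blast
  moreover obtain S where "\<And>z. S < norm z \<Longrightarrow> k z = 0" using k by (auto simp: Cc_def)
  moreover obtain R where "\<And>z. R < norm z \<Longrightarrow> f z = 0" using f by (auto simp: bsupp_def)
  moreover have "integrable lborel f" using f by (simp add: bsupp_def)
  ultimately show ?thesis
    using that conv_bound[OF k, of f B] conv_zero[of S k R f] conv_measurable[OF k, of f] by blast
qed

lemma conv_integrable:
  assumes "Cc k" "bsupp f" shows "integrable lborel (conv k f)"
  using conv_bsupp[OF assms] integrable_bounded_support[of "conv k f"] by (metis real_norm_def)

lemma conv_mult_integrable:
  assumes k: "Cc k" and f: "bsupp f" and l: "Cc l" and g: "bsupp g"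
  shows "integrable lborel (\<lambda>x. conv k f x * conv l g x)"
proof -
  obtain B R where B: "\<And>x. \<bar>conv k f x\<bar> \<le> B" "\<And>x. R < norm x \<Longrightarrow> conv k f x = 0"
    "conv k f \<in> borel_measurable borel" using conv_bsupp[OF k f] by blast
  obtain C S where C: "\<And>x. \<bar>conv l g x\<bar> \<le> C" "\<And>x. S < norm x \<Longrightarrow> conv l g x = 0"
    "conv l g \<in> borel_measurable borel" using conv_bsupp[OF l g] by blast
  show ?thesis
  proof (rule integrable_bounded_support)
    show "norm (conv k f x * conv l g x) \<le> B * C" for x
      using mult_mono[OF B(1) C(1), of x x] B(1)[of x] by (simp add: abs_mult)
  qed (use B C in auto)
qed

text \<open>Fubini, with the absolute integrand dominated by a multiple of \<bar>H\<bar>. Every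
  later property of mollification that involves an integral over the whole space is read off from
  this exchange.\<close>

lemma conv_adjoint:
  assumes k: "Cc k" and f: "integrable lborel f" and H: "integrable lborel H"
  shows "(\<integral>x. conv k f x * H x \<partial>lborel) = (\<integral>y. f y * (\<integral>x. k (y - x) * H x \<partial>lborel) \<partial>lborel)"
proof -
  have [measurable]: "k \<in> borel_measurable borel" "f \<in> borel_measurable borel" "H \<in> borel_measurable borel"
    using Cc_measurable[OF k] borel_measurable_integrable[OF f] borel_measurable_integrable[OF H] by auto
  obtain B where B: "\<And>x. \<bar>k x\<bar> \<le> B" "0 \<le> B" using Cc_bounded[OF k] by blast
  have "integrable (lborel \<Otimes>\<^sub>M lborel) (\<lambda>(x, y). H x * (k (y - x) * f y))"
  proof (rule lborel_pair.Fubini_integrable)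
    show "(\<lambda>(x, y). H x * (k (y - x) * f y)) \<in> borel_measurable (lborel \<Otimes>\<^sub>M lborel)" by measurable
    have e: "(\<integral>y. norm (case (x, y) of (x, y) \<Rightarrow> H x * (k (y - x) * f y)) \<partial>lborel)
        = \<bar>H x\<bar> * conv (\<lambda>x. \<bar>k x\<bar>) (\<lambda>y. \<bar>f y\<bar>) x" for x
      by (simp add: conv_def abs_mult)
    show "integrable lborel (\<lambda>x. \<integral>y. norm (case (x, y) of (x, y) \<Rightarrow> H x * (k (y - x) * f y)) \<partial>lborel)"
      unfolding e
    proof (rule Bochner_Integration.integrable_bound)
      show "integrable lborel (\<lambda>x. H x * (B * (\<integral>y. \<bar>\<bar>f y\<bar>\<bar> \<partial>lborel)))" using H by simp
      show "(\<lambda>x. \<bar>H x\<bar> * conv (\<lambda>x. \<bar>k x\<bar>) (\<lambda>y. \<bar>f y\<bar>) x) \<in> borel_measurable lborel"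
        using conv_measurable[OF Cc_abs[OF k] integrable_abs[OF f]] by simp
      have "\<bar>conv (\<lambda>x. \<bar>k x\<bar>) (\<lambda>y. \<bar>f y\<bar>) x\<bar> \<le> \<bar>B * (\<integral>y. \<bar>\<bar>f y\<bar>\<bar> \<partial>lborel)\<bar>" for x
        using conv_bound[OF Cc_abs[OF k] integrable_abs[OF f], of B x] B(1) by simp
      then show "AE x in lborel. norm (\<bar>H x\<bar> * conv (\<lambda>x. \<bar>k x\<bar>) (\<lambda>y. \<bar>f y\<bar>) x)
          \<le> norm (H x * (B * (\<integral>y. \<bar>\<bar>f y\<bar>\<bar> \<partial>lborel)))"
        by (intro AE_I2) (simp add: abs_mult[of "H _"] abs_mult[of "\<bar>H _\<bar>"] mult_left_mono del: abs_abs)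
    qed
    show "AE x in lborel. integrable lborel (\<lambda>y. case (x, y) of (x, y) \<Rightarrow> H x * (k (y - x) * f y))"
      using conv_integrand[OF k f] by simp
  qed
  then have "(\<integral>y. (\<integral>x. H x * (k (y - x) * f y) \<partial>lborel) \<partial>lborel)
      = (\<integral>x. (\<integral>y. H x * (k (y - x) * f y) \<partial>lborel) \<partial>lborel)"
    by (intro lborel_pair.Fubini_integral) simp
  moreover have "(\<integral>x. H x * (k (y - x) * f y) \<partial>lborel) = f y * (\<integral>x. k (y - x) * H x \<partial>lborel)" for y
    by (subst integral_mult_right_zero[symmetric]) (simp add: mult_ac)
  moreover have "(\<integral>y. H x * (k (y - x) * f y) \<partial>lborel) = conv k f x * H x" for x
    by (simp add: conv_def mult.commute)
  ultimately show ?thesis by (simp only:)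
qed

text \<open>Two exchanges write either side as a double integral of f(y) g(z) against the
  correlation of the two kernels. So a symmetry of kernels, which are smooth, transfers to
  mollifications of functions that are only integrable.\<close>

lemma conv_swap:
  assumes k: "Cc k" "Cc k'" and l: "Cc l" "Cc l'" and f: "bsupp f" and g: "bsupp g"
    and swap: "\<And>y z. (\<integral>x. k (y - x) * l (z - x) \<partial>lborel) = (\<integral>x. k' (y - x) * l' (z - x) \<partial>lborel)"
  shows "(\<integral>x. conv k f x * conv l g x \<partial>lborel) = (\<integral>x. conv k' f x * conv l' g x \<partial>lborel)"
proof -
  have e: "(\<integral>x. conv k f x * conv l g x \<partial>lborel)
      = (\<integral>y. f y * (\<integral>z. g z * (\<integral>x. k (y - x) * l (z - x) \<partial>lborel) \<partial>lborel) \<partial>lborel)"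
    if k: "Cc k" and l: "Cc l" for k l
  proof -
    have "(\<integral>x. conv k f x * conv l g x \<partial>lborel)
        = (\<integral>y. f y * (\<integral>x. k (y - x) * conv l g x \<partial>lborel) \<partial>lborel)"
      using f conv_integrable[OF l g] by (intro conv_adjoint k) (auto simp: bsupp_def)
    moreover have "(\<integral>x. k (y - x) * conv l g x \<partial>lborel)
        = (\<integral>z. g z * (\<integral>x. k (y - x) * l (z - x) \<partial>lborel) \<partial>lborel)" for y
    proof -
      have "(\<integral>x. conv l g x * k (y - x) \<partial>lborel)
          = (\<integral>z. g z * (\<integral>x. l (z - x) * k (y - x) \<partial>lborel) \<partial>lborel)"
        using g Cc_integrable[OF Cc_reflect[OF k, of y]] by (intro conv_adjoint l) (auto simp: bsupp_def)
      then show ?thesis by (simp add: mult.commute)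
    qed
    ultimately show ?thesis by simp
  qed
  show ?thesis unfolding e[OF k(1) l(1)] e[OF k(2) l(2)] swap ..
qed

lemma conv_nonneg_le:
  assumes k: "Cc k" "\<And>x. 0 \<le> k x" and k1: "(\<integral>x. k x \<partial>lborel) = 1"
    and f: "bsupp f" "\<And>x. 0 \<le> f x"
  shows "(\<integral>x. conv k f x \<partial>lborel) \<le> (\<integral>x. f x \<partial>lborel)"
proof -
  obtain B R where R: "\<And>x. \<bar>conv k f x\<bar> \<le> B" "\<And>x. R < norm x \<Longrightarrow> conv k f x = 0"
    "conv k f \<in> borel_measurable borel" using conv_bsupp[OF k(1) f(1)] by blast
  \<comment> \<open>The adjoint formula needs an integrable second factor, which the constant 1 is
    not; the indicator of a ball outside which the convolution vanishes replaces it.\<close>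
  define H :: "real^3 \<Rightarrow> real" where "H = indicator (cball 0 R)"
  have Hi: "integrable lborel H"
    unfolding H_def using emeasure_bounded_finite[OF bounded_cball] by (intro integrable_real_indicator) auto
  have fi: "integrable lborel f" using f by (simp add: bsupp_def)
  have kr: "integrable lborel (\<lambda>x. k (y - x))" for y by (intro Cc_integrable Cc_reflect k)
  have kH: "integrable lborel (\<lambda>x. k (y - x) * H x)" for y
    using Cc_mult_integrable[OF Cc_reflect[OF k(1)] Hi] .
  have le: "(\<integral>x. k (y - x) * H x \<partial>lborel) \<le> 1" "0 \<le> (\<integral>x. k (y - x) * H x \<partial>lborel)" for y
  proof -
    have "(\<integral>x. k (y - x) * H x \<partial>lborel) \<le> (\<integral>x. k (y - x) \<partial>lborel)"
      using kr kH k(2) by (intro integral_mono) (auto simp: H_def indicator_def)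
    then show "(\<integral>x. k (y - x) * H x \<partial>lborel) \<le> 1" using k1 integral_reflect[OF Cc_measurable[OF k(1)]] by simp
    show "0 \<le> (\<integral>x. k (y - x) * H x \<partial>lborel)" using k(2) by (simp add: H_def)
  qed
  have "conv k f x = conv k f x * H x" for x using R(2) by (auto simp: H_def indicator_def not_le)
  then have "(\<integral>x. conv k f x \<partial>lborel) = (\<integral>x. conv k f x * H x \<partial>lborel)"
    by (intro arg_cong[where f="integral\<^sup>L lborel"] ext)
  also have "\<dots> = (\<integral>y. f y * (\<integral>x. k (y - x) * H x \<partial>lborel) \<partial>lborel)"
    by (rule conv_adjoint[OF k(1) fi Hi])
  also have "\<dots> \<le> (\<integral>x. f x \<partial>lborel)"
  proof (cases "integrable lborel (\<lambda>y. f y * (\<integral>x. k (y - x) * H x \<partial>lborel))")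
    case True
    show ?thesis using True fi le f(2) by (intro integral_mono) (auto simp: mult_left_le)
  next
    \<comment> \<open>A function that is not integrable has integral 0 by convention, and the
      right-hand side is nonnegative.\<close>
    case False
    then show ?thesis using f(2) by (simp add: not_integrable_integral_eq)
  qed
  finally show ?thesis .
qed

text \<open>Jensen's inequality for the probability density k(. - x): expand the nonnegative mean of
  (f - a)^2, where a is the mean of f. Then the L1 bound is applied to f^2.\<close>

lemma conv_square_le:
  assumes k: "Cc k" "\<And>x. 0 \<le> k x" and k1: "(\<integral>x. k x \<partial>lborel) = 1"
    and f: "bsupp f" and f2: "bsupp (\<lambda>x. (f x)\<^sup>2)"
  shows "(\<integral>x. (conv k f x)\<^sup>2 \<partial>lborel) \<le> (\<integral>x. (f x)\<^sup>2 \<partial>lborel)"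
proof -
  have fi: "integrable lborel f" and f2i: "integrable lborel (\<lambda>x. (f x)\<^sup>2)" using f f2 by (auto simp: bsupp_def)
  have kt: "(\<integral>y. k (y - x) \<partial>lborel) = 1" "integrable lborel (\<lambda>y. k (y - x))" for x
    using k1 integral_translate[OF Cc_measurable[OF k(1)], of "-x"] Cc_integrable[OF Cc_translate[OF k(1)]] by auto
  have "(conv k f x)\<^sup>2 \<le> conv k (\<lambda>x. (f x)\<^sup>2) x" for x
  proof -
    let ?a = "conv k f x"
    have "0 \<le> (\<integral>y. k (y - x) * (f y - ?a)\<^sup>2 \<partial>lborel)" using k(2) by simp
    also have "\<dots> = (\<integral>y. (k (y - x) * (f y)\<^sup>2 - 2 * ?a * (k (y - x) * f y)) + ?a\<^sup>2 * k (y - x) \<partial>lborel)"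
      by (simp add: power2_diff algebra_simps)
    also have "\<dots> = conv k (\<lambda>x. (f x)\<^sup>2) x - 2 * ?a * conv k f x + ?a\<^sup>2"
      using conv_integrand[OF k(1) fi, of x] conv_integrand[OF k(1) f2i, of x] kt[of x]
      by (subst Bochner_Integration.integral_add, simp, simp) (subst Bochner_Integration.integral_diff; simp add: conv_def)
    finally show ?thesis by (simp add: power2_eq_square)
  qed
  then have "(\<integral>x. (conv k f x)\<^sup>2 \<partial>lborel) \<le> (\<integral>x. conv k (\<lambda>x. (f x)\<^sup>2) x \<partial>lborel)"
    using conv_mult_integrable[OF k(1) f k(1) f] conv_integrable[OF k(1) f2]
    by (intro integral_mono) (auto simp: power2_eq_square)
  also have "\<dots> \<le> (\<integral>x. (f x)\<^sup>2 \<partial>lborel)" by (intro conv_nonneg_le k k1 f2) auto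
  finally show ?thesis .
qed

lemma conv_diff:
  "Cc k \<Longrightarrow> integrable lborel f \<Longrightarrow> integrable lborel g \<Longrightarrow> conv k (\<lambda>y. f y - g y) x = conv k f x - conv k g x"
  using conv_integrand[of k f x] conv_integrand[of k g x] by (simp add: conv_def right_diff_distrib)

lemma conv_abs_le:
  assumes "Cc k" "\<And>x. 0 \<le> k x"
  shows "\<bar>conv k f x\<bar> \<le> conv k (\<lambda>y. \<bar>f y\<bar>) x"
  using integral_norm_bound[of lborel "\<lambda>y. k (y - x) * f y"] assms
  by (simp add: conv_def abs_mult)

section \<open>An approximate identity and its convergence in L1\<close>

definition moll :: "nat \<Rightarrow> real^3 \<Rightarrow> real" where
  "moll n z = inverse (\<integral>x. bump (\<lambda>_. 0) (Suc n) x \<partial>lborel) * bump (\<lambda>_. 0) (Suc n) z"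

lemma moll_Cc: "Cc (moll n)"
  using Cc_bump[of "real (Suc n)" "inverse (\<integral>x. bump (\<lambda>_. 0) (Suc n) x \<partial>lborel)" "\<lambda>_. 0" 0]
  by (simp add: moll_def[abs_def])

lemma bump_integral_pos:
  assumes "0 < s" shows "0 < (\<integral>x. bump (\<lambda>_. 0) s x \<partial>lborel)"
proof -
  let ?b = "bump (\<lambda>_. 0) s"
  have Cc: "Cc ?b" using Cc_bump[OF assms, of 1 "\<lambda>_. 0" 0] by simp
  then have c: "continuous_on UNIV ?b" by (simp add: Cc_def)
  have o: "open {x. ?b x \<noteq> 0}" using open_Collect_neq[OF c continuous_on_const] .
  have "(\<integral>x. ?b x \<partial>lborel) \<noteq> 0"
  proof
    assume "(\<integral>x. ?b x \<partial>lborel) = 0"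
    then have "AE x in lborel. ?b x = 0"
      using integral_nonneg_eq_0_iff_AE[OF Cc_integrable[OF Cc]] bump_nonneg by simp
    then have "{x. ?b x \<noteq> 0} \<in> null_sets lborel"
      using o by (subst (asm) AE_iff_null) auto
    then have "negligible {x. ?b x \<noteq> 0}"
      by (simp add: negligible_iff_null_sets null_sets_completionI)
    then show False using open_not_negligible[OF o] bump_pos[of s]
      by (metis (mono_tags, lifting) empty_iff less_irrefl mem_Collect_eq)
  qed
  moreover have "0 \<le> (\<integral>x. ?b x \<partial>lborel)" using bump_nonneg by simp
  ultimately show ?thesis by simp
qed

lemma moll_nonneg: "0 \<le> moll n z"
  using bump_integral_pos[of "real (Suc n)"] bump_nonneg by (simp add: moll_def)

lemma moll_integral: "(\<integral>x. moll n x \<partial>lborel) = 1"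
  using bump_integral_pos[of "real (Suc n)"] by (simp add: moll_def)

lemma moll_zero: "2 / real (Suc n) < norm z \<Longrightarrow> moll n z = 0"
  by (simp add: moll_def bump_zero field_simps)

text \<open>Continuity gives pointwise convergence. The mollifiers have radius at most 2, so all
  functions live on one ball of radius R + 2, where 2 B dominates.\<close>

lemma moll_conv_Cc_L1:
  assumes h: "Cc h"
  shows "(\<lambda>n. \<integral>x. \<bar>conv (moll n) h x - h x\<bar> \<partial>lborel) \<longlonglongrightarrow> 0"
proof -
  obtain R where R: "\<And>x. R < norm x \<Longrightarrow> h x = 0" using h by (auto simp: Cc_def)
  obtain B where B: "\<And>x. \<bar>h x\<bar> \<le> B" "0 \<le> B" using Cc_bounded[OF h] by blast
  have hi: "integrable lborel h" by (rule Cc_integrable[OF h])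
  have hc: "continuous_on UNIV h" using h by (simp add: Cc_def)
  have hm: "h \<in> borel_measurable borel" by (rule Cc_measurable[OF h])
  have kt: "(\<integral>y. moll n (y - x) \<partial>lborel) = 1" "integrable lborel (\<lambda>y. moll n (y - x))" for n x
    using moll_integral integral_translate[OF Cc_measurable[OF moll_Cc], of n "-x"]
      Cc_integrable[OF Cc_translate[OF moll_Cc]] by auto
  \<comment> \<open>The error is at most the oscillation of h over the radius of the mollifier. This
    is used with 2 B for domination, with 0 far away, and with half the tolerance for
    convergence.\<close>
  have osc: "\<bar>conv (moll n) h x - h x\<bar> \<le> e"
    if "\<And>y. norm (y - x) \<le> 2 / real (Suc n) \<Longrightarrow> \<bar>h y - h x\<bar> \<le> e" for n x e
  proof -
    have i: "integrable lborel (\<lambda>y. moll n (y - x) * (h y - h x))"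
      using conv_integrand[OF moll_Cc hi, of n x] kt(2)[of n x] by (simp add: right_diff_distrib)
    have "conv (moll n) h x - h x = (\<integral>y. moll n (y - x) * (h y - h x) \<partial>lborel)"
      using conv_integrand[OF moll_Cc hi, of n x] kt[where x=x and n=n] by (simp add: right_diff_distrib conv_def)
    then have "\<bar>conv (moll n) h x - h x\<bar> \<le> (\<integral>y. \<bar>moll n (y - x) * (h y - h x)\<bar> \<partial>lborel)"
      using integral_norm_bound[of lborel "\<lambda>y. moll n (y - x) * (h y - h x)"] by simp
    also have "\<dots> \<le> (\<integral>y. moll n (y - x) * e \<partial>lborel)"
    proof (rule integral_mono)
      show "\<bar>moll n (y - x) * (h y - h x)\<bar> \<le> moll n (y - x) * e" for y
        using that[of y] moll_zero[of n "y - x"] moll_nonneg[of n "y - x"]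
        by (cases "norm (y - x) \<le> 2 / real (Suc n)") (auto simp: abs_mult intro!: mult_left_mono)
    qed (use i kt in auto)
    also have "\<dots> = e" using kt by simp
    finally show ?thesis .
  qed
  have "(\<lambda>n. \<integral>x. \<bar>conv (moll n) h x - h x\<bar> \<partial>lborel) \<longlonglongrightarrow> (\<integral>x. 0 \<partial>(lborel :: (real^3) measure))"
  proof (rule integral_dominated_convergence[where w="\<lambda>x. (2 * B) * indicator (cball 0 (R + 2)) x"])
    show "(\<lambda>x. \<bar>conv (moll n) h x - h x\<bar>) \<in> borel_measurable lborel" for n
      using conv_measurable[OF moll_Cc hi, of n] hm by measurable
    show "integrable lborel (\<lambda>x. (2 * B) * indicator (cball 0 (R + 2)) x :: real)"
      by (intro integrable_mult_right integrable_real_indicator) (use emeasure_bounded_finite[OF bounded_cball] in auto)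
    show "AE x in lborel. norm \<bar>conv (moll n) h x - h x\<bar> \<le> 2 * B * indicator (cball 0 (R + 2)) x" for n
    proof (rule AE_I2)
      fix x
      show "norm \<bar>conv (moll n) h x - h x\<bar> \<le> 2 * B * indicator (cball 0 (R + 2)) x"
      proof (cases "norm x \<le> R + 2")
        case True
        have "\<bar>h y - h x\<bar> \<le> 2 * B" for y using B(1)[of x] B(1)[of y] by linarith
        then show ?thesis using osc[of x n "2 * B"] True by simp
      next
        case False
        have "h y = 0" if "norm (y - x) \<le> 2 / real (Suc n)" for y
        proof (rule R)
          have "2 / real (Suc n) \<le> 2" by (simp add: divide_le_eq)
          moreover have "norm x \<le> norm y + norm (y - x)"
            using norm_triangle_sub[of x y] by (simp add: norm_minus_commute)
          ultimately show "R < norm y" using that False by linarith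
        qed
        moreover have "h x = 0" using R False by simp
        ultimately show ?thesis using osc[of x n 0] False by simp
      qed
    qed
    show "AE x in lborel. (\<lambda>n. \<bar>conv (moll n) h x - h x\<bar>) \<longlonglongrightarrow> 0"
    proof (rule AE_I2, rule LIMSEQ_I)
      fix x and e :: real assume e: "0 < e"
      obtain d where d: "0 < d" "\<And>y. dist y x < d \<Longrightarrow> dist (h y) (h x) < e / 2"
        using hc e unfolding continuous_on_iff by (metis UNIV_I half_gt_zero)
      obtain N where N: "2 / d < real (Suc N)"
        by (metis reals_Archimedean2 less_trans lessI of_nat_less_iff)
      have "\<bar>conv (moll n) h x - h x\<bar> \<le> e / 2" if "n \<ge> N" for n
      proof (rule osc)
        fix y assume y: "norm (y - x) \<le> 2 / real (Suc n)"
        have "2 / real (Suc n) \<le> 2 / real (Suc N)" using that by (simp add: frac_le)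
        also have "\<dots> < d" using N d(1) by (simp add: field_simps)
        finally show "\<bar>h y - h x\<bar> \<le> e / 2" using y d(2)[of y] by (simp add: dist_norm)
      qed
      then show "\<exists>no. \<forall>n\<ge>no. norm (\<bar>conv (moll n) h x - h x\<bar> - 0) < e"
        using e by (intro exI[of _ N]) (smt (verit) field_sum_of_halves real_norm_def)
    qed
  qed simp
  then show ?thesis by simp
qed

text \<open>Truncating the values at height T costs little in L1 and provides a dominating function.
  Continuous functions converging to f almost everywhere are then truncated at the same height and
  cut off in space.\<close>

lemma Cc_dense_L1:
  assumes f: "bsupp f" and e: "0 < e"
  obtains h where "Cc h" "(\<integral>x. \<bar>f x - h x\<bar> \<partial>lborel) < e"
proof -
  obtain R where R: "\<And>x. R < norm x \<Longrightarrow> f x = 0" and fi: "integrable lborel f"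
    using f by (auto simp: bsupp_def)
  have fm[measurable]: "f \<in> borel_measurable borel" using borel_measurable_integrable[OF fi] by simp
  define cl where "cl T y = max (- T) (min T y)" for T y :: real
  have clb: "\<bar>cl T y\<bar> \<le> \<bar>T\<bar>" for T y by (auto simp: cl_def)
  have clm: "(\<lambda>x. cl T (f x)) \<in> borel_measurable borel" for T unfolding cl_def by measurable
  have "(\<lambda>n. \<integral>x. \<bar>f x - cl (real n) (f x)\<bar> \<partial>lborel) \<longlonglongrightarrow> (\<integral>x. 0 \<partial>(lborel :: (real^3) measure))"
  proof (rule integral_dominated_convergence[where w="\<lambda>x. \<bar>f x\<bar>"])
    show "AE x in lborel. norm \<bar>f x - cl (real n) (f x)\<bar> \<le> \<bar>f x\<bar>" for n
      by (intro AE_I2) (auto simp: cl_def)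
    show "AE x in lborel. (\<lambda>n. \<bar>f x - cl (real n) (f x)\<bar>) \<longlonglongrightarrow> 0"
    proof (rule AE_I2)
      fix x
      obtain N where N: "\<bar>f x\<bar> \<le> real N" using real_arch_simple by blast
      have "\<bar>f x - cl (real n) (f x)\<bar> = 0" if "n \<ge> N" for n
      proof -
        have "\<bar>f x\<bar> \<le> real n" using N that by linarith
        then show ?thesis by (auto simp: cl_def)
      qed
      then show "(\<lambda>n. \<bar>f x - cl (real n) (f x)\<bar>) \<longlonglongrightarrow> 0"
        by (intro tendsto_eventually) (auto simp: eventually_sequentially)
    qed
  qed (use fi clm in auto)
  then have "eventually (\<lambda>n. (\<integral>x. \<bar>f x - cl (real n) (f x)\<bar> \<partial>lborel) < e / 2) sequentially"
    using e by (intro order_tendstoD) auto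
  then obtain n where n: "(\<integral>x. \<bar>f x - cl (real n) (f x)\<bar> \<partial>lborel) < e / 2"
    by (auto simp: eventually_sequentially)
  define T where "T = real n"
  have fl: "f \<in> borel_measurable lebesgue" by (simp add: measurable_completion)
  \<comment> \<open>This notion of measurability is the existence of continuous functions converging
    to f off a negligible set.\<close>
  have "f measurable_on UNIV" by (rule lebesgue_measurable_imp_measurable_on[OF fl]) simp
  then obtain N g where N: "negligible N" and gc: "\<And>n::nat. continuous_on UNIV (g n)"
    and gl: "\<And>x. x \<notin> N \<Longrightarrow> (\<lambda>n. g n x) \<longlonglongrightarrow> f x"
    by (auto simp: measurable_on_def)
  define cut where "cut x = max 0 (min 1 (R + 1 - norm x))" for x :: "real^3"
  define h where "h n x = cut x * cl T (g n x)" for n x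
  have hCc: "Cc (h n)" for n
    unfolding Cc_def
  proof (intro conjI exI[of _ "R + 1"] allI impI)
    show "continuous_on UNIV (h n)"
      unfolding h_def cut_def cl_def by (intro continuous_intros gc)
  qed (simp add: h_def cut_def)
  have "(\<lambda>n. \<integral>x. \<bar>cl T (f x) - h n x\<bar> \<partial>lborel) \<longlonglongrightarrow> (\<integral>x. 0 \<partial>(lborel :: (real^3) measure))"
  proof (rule integral_dominated_convergence[where w="\<lambda>x. (2 * T) * indicator (cball 0 (R + 1)) x"])
    show "integrable lborel (\<lambda>x. (2 * T) * indicator (cball 0 (R + 1)) x :: real)"
      by (intro integrable_mult_right integrable_real_indicator) (use emeasure_bounded_finite[OF bounded_cball] in auto)
    show "(\<lambda>x. \<bar>cl T (f x) - h n x\<bar>) \<in> borel_measurable lborel" for n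
      using clm Cc_measurable[OF hCc, of n] by simp
    show "AE x in lborel. norm \<bar>cl T (f x) - h n x\<bar> \<le> 2 * T * indicator (cball 0 (R + 1)) x" for n
    proof (rule AE_I2)
      fix x
      show "norm \<bar>cl T (f x) - h n x\<bar> \<le> 2 * T * indicator (cball 0 (R + 1)) x"
      proof (cases "norm x \<le> R + 1")
        case True
        have "\<bar>h n x\<bar> \<le> 1 * \<bar>T\<bar>"
          unfolding h_def abs_mult by (intro mult_mono clb) (auto simp: cut_def)
        then show ?thesis using clb[of T "f x"] True by (simp add: T_def)
      next
        case False
        then show ?thesis using R[of x] by (simp add: h_def cut_def cl_def T_def)
      qed
    qed
    have "N \<in> null_sets (completion lborel)" using N by (simp add: negligible_iff_null_sets)
    then have "AE x in completion lborel. x \<notin> N" by (rule AE_not_in)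
    then have "AE x in lborel. x \<notin> N" by (simp add: AE_completion_iff)
    then show "AE x in lborel. (\<lambda>n. \<bar>cl T (f x) - h n x\<bar>) \<longlonglongrightarrow> 0"
    proof eventually_elim
      case (elim x)
      have "(\<lambda>n. \<bar>cl T (f x) - h n x\<bar>) \<longlonglongrightarrow> \<bar>cl T (f x) - cut x * cl T (f x)\<bar>"
        unfolding h_def cl_def by (intro tendsto_intros gl elim)
      moreover have "cl T (f x) - cut x * cl T (f x) = 0"
        using R[of x] by (cases "R < norm x") (auto simp: cut_def cl_def T_def)
      ultimately show ?case by simp
    qed
  qed (use clm in auto)
  then have "eventually (\<lambda>n. (\<integral>x. \<bar>cl T (f x) - h n x\<bar> \<partial>lborel) < e / 2) sequentially"
    using e by (intro order_tendstoD) auto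
  then obtain m where m: "(\<integral>x. \<bar>cl T (f x) - h m x\<bar> \<partial>lborel) < e / 2"
    by (auto simp: eventually_sequentially)
  have hi: "integrable lborel (h m)" by (rule Cc_integrable[OF hCc])
  have ci: "integrable lborel (\<lambda>x. cl T (f x))"
    by (rule Bochner_Integration.integrable_bound[OF fi]) (use clm in \<open>auto simp: cl_def T_def\<close>)
  have "(\<integral>x. \<bar>f x - h m x\<bar> \<partial>lborel) \<le> (\<integral>x. \<bar>f x - cl T (f x)\<bar> + \<bar>cl T (f x) - h m x\<bar> \<partial>lborel)"
    using fi hi ci by (intro integral_mono) auto
  also have "\<dots> = (\<integral>x. \<bar>f x - cl T (f x)\<bar> \<partial>lborel) + (\<integral>x. \<bar>cl T (f x) - h m x\<bar> \<partial>lborel)"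
    using fi hi ci by (intro Bochner_Integration.integral_add) auto
  also have "\<dots> < e" using m n by (simp add: T_def)
  finally show ?thesis using that hCc by blast
qed

text \<open>Three terms of size e / 3: approximate f by a continuous h, mollify h, and use that
  mollification does not increase the L1 norm of f - h.\<close>

lemma moll_conv_L1:
  assumes f: "bsupp f"
  shows "(\<lambda>n. \<integral>x. \<bar>conv (moll n) f x - f x\<bar> \<partial>lborel) \<longlonglongrightarrow> 0"
proof (rule LIMSEQ_I)
  fix e :: real assume e: "0 < e"
  have fi: "integrable lborel f" using f by (simp add: bsupp_def)
  obtain h where h: "Cc h" "(\<integral>x. \<bar>f x - h x\<bar> \<partial>lborel) < e / 3"
    using Cc_dense_L1[OF f, of "e / 3"] e by auto
  have hi: "integrable lborel h" by (rule Cc_integrable[OF h(1)])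
  have hb: "bsupp h" using h(1) hi by (simp add: bsupp_def Cc_def)
  have db: "bsupp (\<lambda>x. \<bar>f x - h x\<bar>)"
  proof -
    obtain R S where "\<forall>x. R < norm x \<longrightarrow> f x = 0" "\<forall>x. S < norm x \<longrightarrow> h x = 0"
      using f hb by (auto simp: bsupp_def)
    then have "\<forall>x. max R S < norm x \<longrightarrow> \<bar>f x - h x\<bar> = 0" by simp
    then show ?thesis using fi hi unfolding bsupp_def by (intro conjI exI[of _ "max R S"]) auto
  qed
  obtain N where N: "\<And>n. n \<ge> N \<Longrightarrow> (\<integral>x. \<bar>conv (moll n) h x - h x\<bar> \<partial>lborel) < e / 3"
    using LIMSEQ_D[OF moll_conv_Cc_L1[OF h(1)], of "e / 3"] e by auto
  have "norm ((\<integral>x. \<bar>conv (moll n) f x - f x\<bar> \<partial>lborel) - 0) < e" if "n \<ge> N" for n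
  proof -
    let ?c = "conv (moll n)"
    have i: "integrable lborel (?c f)" "integrable lborel (?c h)" "integrable lborel (?c (\<lambda>y. \<bar>f y - h y\<bar>))"
      by (intro conv_integrable moll_Cc f hb db)+
    have "\<bar>?c f x - f x\<bar> \<le> ?c (\<lambda>y. \<bar>f y - h y\<bar>) x + \<bar>?c h x - h x\<bar> + \<bar>f x - h x\<bar>" for x
      using conv_abs_le[OF moll_Cc moll_nonneg, of n "\<lambda>y. f y - h y" x] conv_diff[OF moll_Cc fi hi, of n x]
      by linarith
    then have "(\<integral>x. \<bar>?c f x - f x\<bar> \<partial>lborel)
        \<le> (\<integral>x. ?c (\<lambda>y. \<bar>f y - h y\<bar>) x + \<bar>?c h x - h x\<bar> + \<bar>f x - h x\<bar> \<partial>lborel)"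
      using i fi hi by (intro integral_mono) auto
    also have "\<dots> = (\<integral>x. ?c (\<lambda>y. \<bar>f y - h y\<bar>) x \<partial>lborel) + (\<integral>x. \<bar>?c h x - h x\<bar> \<partial>lborel)
        + (\<integral>x. \<bar>f x - h x\<bar> \<partial>lborel)"
      using i fi hi by simp
    also have "(\<integral>x. ?c (\<lambda>y. \<bar>f y - h y\<bar>) x \<partial>lborel) \<le> (\<integral>x. \<bar>f x - h x\<bar> \<partial>lborel)"
      by (intro conv_nonneg_le moll_Cc moll_nonneg moll_integral db) auto
    finally show ?thesis using N[OF that] h(2) by simp
  qed
  then show "\<exists>no. \<forall>n\<ge>no. norm ((\<integral>x. \<bar>conv (moll n) f x - f x\<bar> \<partial>lborel) - 0) < e" by blast
qed

subsection \<open>Gradient, divergence and curl of a mollified field\<close>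

lemma partial_deriv_bump_reflect:
  "((\<lambda>x. r * bump m s (y - x)) has_derivative
     (\<lambda>h. r * (\<Sum>i\<in>UNIV. (- h) $ i * (s * bump (m(i := Suc (m i))) s (y - x))))) (at x)"
  "partial_deriv j (\<lambda>x. r * bump m s (y - x)) = (\<lambda>x. (- r * s) * bump (m(j := Suc (m j))) s (y - x))"
proof -
  have d: "((\<lambda>x. r * bump m s (y - x)) has_derivative
     (\<lambda>h. r * (\<Sum>i\<in>UNIV. (- h) $ i * (s * bump (m(i := Suc (m i))) s (y - x))))) (at x)" for x
  proof -
    have "((\<lambda>x. y - x) has_derivative (\<lambda>h. - h)) (at x)" by (auto intro!: derivative_eq_intros)
    from has_derivative_compose[OF this bump_has_derivative[of m s 0, simplified]]
    show ?thesis by (intro has_derivative_mult_right) simp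
  qed
  then show "((\<lambda>x. r * bump m s (y - x)) has_derivative
     (\<lambda>h. r * (\<Sum>i\<in>UNIV. (- h) $ i * (s * bump (m(i := Suc (m i))) s (y - x))))) (at x)" .
  show "partial_deriv j (\<lambda>x. r * bump m s (y - x)) = (\<lambda>x. (- r * s) * bump (m(j := Suc (m j))) s (y - x))"
  proof
    fix x
    have n: "- (axis j 1 :: real^3) $ i = (if i = j then - 1 else 0)" for i by (simp add: axis_def)
    show "partial_deriv j (\<lambda>x. r * bump m s (y - x)) x = (- r * s) * bump (m(j := Suc (m j))) s (y - x)"
      unfolding partial_derivI[OF d] n vector_uminus_component
      by (simp add: if_distrib[where f="\<lambda>x. x * _"] cong: if_cong)
  qed
qed

abbreviation unit_index :: "3 \<Rightarrow> 3 \<Rightarrow> nat" where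
  "unit_index i \<equiv> (\<lambda>_. 0)(i := Suc 0)"

lemma Cc_bump_reflect: "0 < s \<Longrightarrow> Cc (\<lambda>x. r * bump m s (y - x))"
  using Cc_reflect[OF Cc_bump[of s r m 0], of y] by simp

text \<open>Integrating by parts twice moves one derivative across and the other one back.\<close>

lemma bump_swap:
  assumes s: "0 < s"
  shows "(\<integral>x. bump (unit_index i) s (y - x) * bump (unit_index j) s (z - x) \<partial>lborel)
       = (\<integral>x. bump (unit_index j) s (y - x) * bump (unit_index i) s (z - x) \<partial>lborel)"
proof -
  have *: "(\<integral>x. bump (unit_index i) s (y - x) * bump (unit_index j) s (z - x) \<partial>lborel)
      = - (\<integral>x. bump (\<lambda>_. 0) s (y - x) * bump ((unit_index j)(i := Suc (unit_index j i))) s (z - x) \<partial>lborel)" for i j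
  proof -
    let ?f = "\<lambda>x. 1 * bump (\<lambda>_. 0) s (y - x)" and ?g = "\<lambda>x. 1 * bump (unit_index j) s (z - x)"
    have c: "Cc (\<lambda>x. r * bump m s (w - x))" for r m w by (rule Cc_bump_reflect[OF s])
    have "(\<integral>x. ?f x * partial_deriv i ?g x \<partial>lborel) = - (\<integral>x. partial_deriv i ?f x * ?g x \<partial>lborel)"
    proof (rule integration_by_parts)
      show "?f differentiable at x" "?g differentiable at x" for x
        using partial_deriv_bump_reflect(1) by (blast intro: differentiableI)+
      show "continuous_on UNIV (partial_deriv i ?f)" "continuous_on UNIV (partial_deriv i ?g)"
        unfolding partial_deriv_bump_reflect(2) by (rule conjunct1[OF c[unfolded Cc_def]])+
    qed (rule c)+
    then have "- s * (\<integral>x. bump (\<lambda>_. 0) s (y - x) * bump ((unit_index j)(i := Suc (unit_index j i))) s (z - x) \<partial>lborel)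
      = s * (\<integral>x. bump (unit_index i) s (y - x) * bump (unit_index j) s (z - x) \<partial>lborel)"
      unfolding partial_deriv_bump_reflect(2) by (simp add: mult.left_commute mult.assoc)
    then show ?thesis using s by (metis (no_types, lifting) less_irrefl minus_mult_commute mult_left_cancel)
  qed
  \<comment> \<open>Equality of mixed partial derivatives is built into the multi-index, where the
    order of the increments leaves no trace.\<close>
  have "(unit_index j)(i := Suc (unit_index j i)) = (unit_index i)(j := Suc (unit_index i j))"
    by (auto simp: fun_eq_iff)
  then show ?thesis using *[of i j] *[of j i] by simp
qed

text \<open>Up to sign and scale \<open>G i j\<close> is the i-th derivative of the mollified j-th
  component. By \<open>bump_swap\<close> two derivative directions may be exchanged under the
  integral, so the cross terms of the squared divergence cancel those of the squared curl.\<close>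

lemma grad_div_curl_identity:
  fixes f :: "3 \<Rightarrow> real^3 \<Rightarrow> real"
  assumes s: "0 < s" and f: "\<And>j. bsupp (f j)"
  defines "G \<equiv> \<lambda>i j. conv (bump (unit_index i) s) (f j)"
  shows "(\<Sum>j\<in>UNIV. \<Sum>i\<in>UNIV. \<integral>x. (G i j x)\<^sup>2 \<partial>lborel)
    = (\<integral>x. (G 1 1 x + G 2 2 x + G 3 3 x)\<^sup>2 \<partial>lborel)
      + (\<integral>x. (G 2 3 x - G 3 2 x)\<^sup>2 \<partial>lborel) + (\<integral>x. (G 3 1 x - G 1 3 x)\<^sup>2 \<partial>lborel)
      + (\<integral>x. (G 1 2 x - G 2 1 x)\<^sup>2 \<partial>lborel)"
proof -
  have c: "Cc (bump m s)" for m using Cc_bump[OF s, of 1 m 0] by simp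
  define I where "I i j k l = (\<integral>x. G i j x * G k l x \<partial>lborel)" for i j k l
  have int: "integrable lborel (\<lambda>x. G i j x * G k l x)" for i j k l
    unfolding G_def by (intro conv_mult_integrable c f)
  have sw: "I i j k l = I k j i l" for i j k l
    unfolding I_def G_def by (intro conv_swap c f bump_swap s)
  have com: "I i j k l = I k l i j" for i j k l by (simp add: I_def mult.commute)
  have sq: "(\<integral>x. (G i j x - G k l x)\<^sup>2 \<partial>lborel) = I i j i j - 2 * I i j k l + I k l k l" for i j k l
  proof -
    have "(\<integral>x. (G i j x - G k l x)\<^sup>2 \<partial>lborel)
        = (\<integral>x. G i j x * G i j x - 2 * (G i j x * G k l x) + G k l x * G k l x \<partial>lborel)"
      by (simp add: power2_eq_square algebra_simps)
    then show ?thesis using int by (simp add: I_def)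
  qed
  have dv: "(\<integral>x. (G 1 1 x + G 2 2 x + G 3 3 x)\<^sup>2 \<partial>lborel)
      = I 1 1 1 1 + I 2 2 2 2 + I 3 3 3 3 + 2 * I 1 1 2 2 + 2 * I 1 1 3 3 + 2 * I 2 2 3 3"
  proof -
    have "(\<integral>x. (G 1 1 x + G 2 2 x + G 3 3 x)\<^sup>2 \<partial>lborel)
        = (\<integral>x. G 1 1 x * G 1 1 x + G 2 2 x * G 2 2 x + G 3 3 x * G 3 3 x + 2 * (G 1 1 x * G 2 2 x)
            + 2 * (G 1 1 x * G 3 3 x) + 2 * (G 2 2 x * G 3 3 x) \<partial>lborel)"
      by (simp add: power2_eq_square algebra_simps)
    then show ?thesis using int by (simp add: I_def)
  qed
  have l: "(\<integral>x. (G i j x)\<^sup>2 \<partial>lborel) = I i j i j" for i j by (simp add: I_def power2_eq_square)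
  show ?thesis
    unfolding sq dv l sum_3 using sw[of 1 1 2 2] sw[of 1 1 3 3] sw[of 2 2 3 3]
      com[of 2 1 1 2] com[of 3 1 1 3] com[of 3 2 2 3] by simp
qed

section \<open>Weak derivatives\<close>

lemma Cc_continuous: "Cc f \<Longrightarrow> continuous_on UNIV f"
  by (simp add: Cc_def)

lemma Lp2_vecI:
  fixes u :: "real^3 \<Rightarrow> real^3"
  assumes "\<And>i. (\<lambda>x. u x $ i) \<in> Lp 2 \<Omega>"
  shows "u \<in> Lp 2 \<Omega>"
proof -
  have a: "(\<lambda>x. u x $ i *\<^sub>R axis i 1 :: real^3) \<in> Lp 2 \<Omega>" for i
    by (rule Lp2_bounded[OF assms[of i], where C=1])
       (use Lp_measurable[OF assms[of i]] in \<open>auto simp: norm_axis_1\<close>)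
  have "(\<lambda>x. u x $ 1 *\<^sub>R axis 1 1 + u x $ 2 *\<^sub>R axis 2 1 + u x $ 3 *\<^sub>R axis 3 1 :: real^3) \<in> Lp 2 \<Omega>"
    by (rule Lp2_add[OF Lp2_add[OF a a] a])
  moreover have "u x $ 1 *\<^sub>R axis 1 1 + u x $ 2 *\<^sub>R axis 2 1 + u x $ 3 *\<^sub>R axis 3 1 = u x" for x
    by (simp add: vec_eq_iff forall_3 axis_def)
  ultimately show ?thesis by simp
qed

lemma test_function_partial_Cc:
  "\<phi> \<in> test_functions \<Omega> \<Longrightarrow> Cc (partial_deriv i \<phi>)"
  by (rule test_function_Cc)

lemma zero_test_function: "(\<lambda>x. 0) \<in> test_functions \<Omega>"
proof -
  have "C_k k (\<lambda>x. 0)" for k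
  proof (induction k)
    case (Suc k)
    have "partial_deriv i (\<lambda>x. 0) = (\<lambda>x. 0)" for i by (rule ext) (rule partial_derivI, simp)
    then show ?case using Suc by simp
  qed simp
  then show ?thesis by (simp add: test_functions_def)
qed

text \<open>The curl assembled from three given gradients, so that classical and weak gradients
  share one formula.\<close>

definition curl_of :: "(3 \<Rightarrow> real^3 \<Rightarrow> real^3) \<Rightarrow> real^3 \<Rightarrow> real^3" where
  "curl_of g x = vector [g 3 x $ 2 - g 2 x $ 3, g 1 x $ 3 - g 3 x $ 1, g 2 x $ 1 - g 1 x $ 2]"

lemma curl_eq_curl_of: "curl \<phi> = curl_of (\<lambda>i. grad (\<lambda>x. \<phi> x $ i))"
  by (simp add: fun_eq_iff curl_def curl_of_def grad_def)

lemma curl_of_Lp2: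
  assumes "\<And>i. g i \<in> Lp 2 \<Omega>" shows "curl_of g \<in> Lp 2 \<Omega>"
proof (rule Lp2_vecI)
  fix i :: 3
  have "(\<lambda>x. curl_of g x $ 1) \<in> Lp 2 \<Omega>" "(\<lambda>x. curl_of g x $ 2) \<in> Lp 2 \<Omega>" "(\<lambda>x. curl_of g x $ 3) \<in> Lp 2 \<Omega>"
    unfolding curl_of_def vector_3 by (intro Lp2_diff Lp2_nth assms)+
  then show "(\<lambda>x. curl_of g x $ i) \<in> Lp 2 \<Omega>" using exhaust_3[of i] by auto
qed

context bounded_open
begin

lemma sets_dom: "\<Omega> \<inter> space lebesgue \<in> sets lebesgue"
  using open_dom by simp

lemma borel_measurable_dom:
  "f \<in> borel_measurable borel \<Longrightarrow> f \<in> borel_measurable (lebesgue_on \<Omega>)"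
  by (intro measurable_restrict_space1 measurable_completion) simp

lemma integral_dom:
  fixes H :: "real^3 \<Rightarrow> real"
  assumes "H \<in> borel_measurable borel" "\<And>x. x \<notin> \<Omega> \<Longrightarrow> H x = 0"
  shows "(\<integral>x. H x \<partial>lebesgue_on \<Omega>) = (\<integral>x. H x \<partial>lborel)"
    and "integrable (lebesgue_on \<Omega>) H \<longleftrightarrow> integrable lborel H"
proof -
  have e: "(\<lambda>x. indicator \<Omega> x *\<^sub>R H x) = H" using assms(2) by (intro ext) (auto split: split_indicator)
  show "(\<integral>x. H x \<partial>lebesgue_on \<Omega>) = (\<integral>x. H x \<partial>lborel)"
    using integral_restrict_space[OF sets_dom, of H] assms(1) unfolding e by (simp add: integral_completion)
  show "integrable (lebesgue_on \<Omega>) H \<longleftrightarrow> integrable lborel H"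
    using integrable_restrict_space[OF sets_dom, of H] assms(1) unfolding e by (simp add: integrable_completion)
qed

lemma AE_dom: "AE x in lborel. P x \<Longrightarrow> AE x in lebesgue_on \<Omega>. P x"
  unfolding AE_restrict_space_iff[OF sets_dom] by (rule AE_mp[OF AE_completion]) auto

lemma Cc_Lp2: "Cc f \<Longrightarrow> f \<in> Lp 2 \<Omega>"
  by (metis Cc_bounded Cc_measurable Lp2_bdd borel_measurable_dom real_norm_def)

text \<open>The bridge from a Lebesgue class on \<Omega> to the convolutions, which are taken over
  all of space with Borel functions: f is a Borel version of the extension of g by zero. The pairing
  with a Borel H is an equality of integrals under the default value 0, so it needs no integrability
  of the product.\<close>

definition borel_rep :: "(real^3 \<Rightarrow> real) \<Rightarrow> (real^3 \<Rightarrow> real) \<Rightarrow> bool" where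
  "borel_rep g f \<longleftrightarrow> bsupp f \<and> bsupp (\<lambda>x. (f x)\<^sup>2) \<and> (\<forall>x. x \<notin> \<Omega> \<longrightarrow> f x = 0) \<and>
    (AE x in lebesgue_on \<Omega>. g x = f x) \<and> f \<in> borel_measurable borel \<and>
    (\<forall>H\<in>borel_measurable borel. (\<integral>x. g x * H x \<partial>lebesgue_on \<Omega>) = (\<integral>x. H x * f x \<partial>lborel)) \<and>
    (\<integral>x. (f x)\<^sup>2 \<partial>lborel) = l2ip \<Omega> g g"

lemma borel_representative:
  fixes g :: "real^3 \<Rightarrow> real"
  assumes g: "g \<in> Lp 2 \<Omega>"
  obtains f where "borel_rep g f"
proof -
  let ?g = "\<lambda>x. if x \<in> \<Omega> then g x else 0"
  have "?g \<in> borel_measurable lebesgue"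
    using g open_dom by (intro borel_measurable_if_I) (auto simp: Lp_def)
  then obtain f0 where f0: "f0 \<in> borel_measurable lborel" "AE x in lborel. ?g x = f0 x"
    using completion_ex_borel_measurable_real by blast
  define f where "f x = indicator \<Omega> x * f0 x" for x
  have fm[measurable]: "f \<in> borel_measurable borel"
    unfolding f_def[abs_def] using f0(1) open_dom by (intro borel_measurable_times) auto
  have fz: "x \<notin> \<Omega> \<Longrightarrow> f x = 0" for x by (simp add: f_def)
  have "AE x in lebesgue_on \<Omega>. ?g x = f0 x" by (rule AE_dom[OF f0(2)])
  moreover have "AE x in lebesgue_on \<Omega>. x \<in> \<Omega>" using AE_space[of "lebesgue_on \<Omega>"] by simp
  ultimately have ae: "AE x in lebesgue_on \<Omega>. g x = f x"
    by eventually_elim (simp add: f_def)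
  have gm: "g \<in> borel_measurable (lebesgue_on \<Omega>)" using g by (simp add: Lp_def)
  have fL: "f \<in> Lp 2 \<Omega>"
  proof (rule Lp2_bounded[OF g borel_measurable_dom[OF fm]])
    show "AE x in lebesgue_on \<Omega>. norm (f x) \<le> 1 * norm (g x)" using ae by eventually_elim simp
  qed
  have fi: "integrable lborel f" using integral_dom(2)[OF fm fz] integrable_L2[OF fL] by simp
  have f2i: "integrable lborel (\<lambda>x. (f x)\<^sup>2)"
    using integral_dom(2)[of "\<lambda>x. (f x)\<^sup>2"] fL fz by (simp add: Lp_def)
  obtain R where R: "\<And>x. x \<in> \<Omega> \<Longrightarrow> norm x \<le> R" using bounded_dom bounded_iff by metis
  then have fR: "\<forall>x. R < norm x \<longrightarrow> f x = 0" using fz not_le by metis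
  have pair: "(\<integral>x. g x * H x \<partial>lebesgue_on \<Omega>) = (\<integral>x. H x * f x \<partial>lborel)"
    if H: "H \<in> borel_measurable borel" for H
  proof -
    have "(\<integral>x. g x * H x \<partial>lebesgue_on \<Omega>) = (\<integral>x. H x * f x \<partial>lebesgue_on \<Omega>)"
    proof (rule integral_cong_AE)
      show "AE x in lebesgue_on \<Omega>. g x * H x = H x * f x" using ae by eventually_elim simp
      show "(\<lambda>x. g x * H x) \<in> borel_measurable (lebesgue_on \<Omega>)"
        "(\<lambda>x. H x * f x) \<in> borel_measurable (lebesgue_on \<Omega>)"
        using gm borel_measurable_dom[OF H] borel_measurable_dom[OF fm] by measurable
    qed
    also have "\<dots> = (\<integral>x. H x * f x \<partial>lborel)" using H fz by (intro integral_dom) auto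
    finally show ?thesis .
  qed
  have "l2ip \<Omega> g g = l2ip \<Omega> f f" using ae g fL by (intro l2ip_cong)
  also have "\<dots> = (\<integral>x. (f x)\<^sup>2 \<partial>lborel)"
    using integral_dom(1)[of "\<lambda>x. (f x)\<^sup>2"] fz by (simp add: l2ip_self)
  finally have "(\<integral>x. (f x)\<^sup>2 \<partial>lborel) = l2ip \<Omega> g g" by simp
  moreover have "bsupp f" "bsupp (\<lambda>x. (f x)\<^sup>2)" using fi f2i fR by (auto simp: bsupp_def)
  ultimately have "borel_rep g f" using fz ae fm pair by (simp add: borel_rep_def)
  then show ?thesis by (rule that)
qed

lemma moll_test_function:
  assumes "cball x (2 / real (Suc n)) \<subseteq> \<Omega>"
  shows "(\<lambda>y. moll n (y - x)) \<in> test_functions \<Omega>"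
  unfolding moll_def by (rule bump_test_function) (use assms in auto)

text \<open>The mollifications of \<open>g\<close> converge to \<open>g\<close> along a subsequence, and near any point of \<open>\<Omega>\<close> they
  are integrals of \<open>g\<close> against test functions.\<close>

lemma fundamental_lemma:
  fixes g :: "real^3 \<Rightarrow> real"
  assumes g: "g \<in> Lp 2 \<Omega>" and z: "\<And>\<phi>. \<phi> \<in> test_functions \<Omega> \<Longrightarrow> (\<integral>x. g x * \<phi> x \<partial>lebesgue_on \<Omega>) = 0"
  shows "AE x in lebesgue_on \<Omega>. g x = 0"
proof -
  obtain f where "borel_rep g f" by (rule borel_representative[OF g])
  then have f: "bsupp f" "AE x in lebesgue_on \<Omega>. g x = f x"
    "\<And>H. H \<in> borel_measurable borel \<Longrightarrow> (\<integral>x. g x * H x \<partial>lebesgue_on \<Omega>) = (\<integral>x. H x * f x \<partial>lborel)"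
    by (auto simp: borel_rep_def)
  have fi: "integrable lborel f" using f by (simp add: bsupp_def)
  have "\<exists>r::nat\<Rightarrow>nat. strict_mono r \<and> (AE x in lborel. (\<lambda>n. conv (moll (r n)) f x - f x) \<longlonglongrightarrow> 0)"
    by (rule tendsto_L1_AE_subseq)
       (use conv_integrable[OF moll_Cc f(1)] fi moll_conv_L1[OF f(1)] in auto)
  then obtain r where r: "strict_mono r" "AE x in lborel. (\<lambda>n. conv (moll (r n)) f x - f x) \<longlonglongrightarrow> 0" by blast
  have "AE x in lebesgue_on \<Omega>. x \<in> \<Omega>" using AE_space[of "lebesgue_on \<Omega>"] by simp
  with f(2) AE_dom[OF r(2)] show ?thesis
  proof eventually_elim
    case (elim x)
    obtain e where e: "0 < e" "cball x e \<subseteq> \<Omega>"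
      using open_dom elim(3) open_contains_cball by metis
    obtain N where N: "2 / e < real (Suc N)"
      by (metis reals_Archimedean2 less_trans lessI of_nat_less_iff)
    have "conv (moll (r n)) f x = 0" if "n \<ge> N" for n
    proof -
      have "N \<le> r n" using that seq_suble[OF r(1), of n] by simp
      then have "2 / real (Suc (r n)) \<le> 2 / real (Suc N)" by (simp add: frac_le)
      also have "\<dots> < e" using N e by (simp add: field_simps)
      finally have "cball x (2 / real (Suc (r n))) \<subseteq> \<Omega>" using e(2) by auto
      then show ?thesis
        using z[OF moll_test_function] f(3)[OF Cc_measurable[OF Cc_translate[OF moll_Cc]]]
        by (simp add: conv_def)
    qed
    then have "(\<lambda>n. conv (moll (r n)) f x - f x) \<longlonglongrightarrow> 0 - f x"
      by (intro tendsto_diff tendsto_eventually tendsto_const) (auto simp: eventually_sequentially)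
    then have "- f x = 0" using elim(2) LIMSEQ_unique by fastforce
    then show ?case using elim(1) by simp
  qed
qed

section \<open>Uniqueness of weak derivatives\<close>

lemma eq_ae_by_test_functions:
  fixes g h :: "real^3 \<Rightarrow> real"
  assumes g: "g \<in> Lp 2 \<Omega>" and h: "h \<in> Lp 2 \<Omega>"
    and z: "\<And>\<phi>. \<phi> \<in> test_functions \<Omega> \<Longrightarrow> (\<integral>x. g x * \<phi> x \<partial>lebesgue_on \<Omega>) = (\<integral>x. h x * \<phi> x \<partial>lebesgue_on \<Omega>)"
  shows "AE x in lebesgue_on \<Omega>. g x = h x"
proof -
  have "AE x in lebesgue_on \<Omega>. g x - h x = 0"
  proof (rule fundamental_lemma[OF Lp2_diff[OF g h]])
    fix \<phi> assume \<phi>: "\<phi> \<in> test_functions \<Omega>"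
    have "\<phi> \<in> Lp 2 \<Omega>" using Cc_Lp2 test_function_Cc(1)[OF \<phi>] by blast
    then show "(\<integral>x. (g x - h x) * \<phi> x \<partial>lebesgue_on \<Omega>) = 0"
      using z[OF \<phi>] integrable_inner_L2[OF g, of \<phi>] integrable_inner_L2[OF h, of \<phi>]
      by (simp add: left_diff_distrib)
  qed
  then show ?thesis by simp
qed

lemma weak_div_unique:
  assumes "is_weak_div \<Omega> v d" "is_weak_div \<Omega> v d'"
  shows "AE x in lebesgue_on \<Omega>. d x = d' x"
  using assms by (intro eq_ae_by_test_functions) (auto simp: is_weak_div_def)

lemma weak_grad_unique:
  assumes "is_weak_grad \<Omega> w g" "is_weak_grad \<Omega> w g'"
  shows "AE x in lebesgue_on \<Omega>. g x = g' x"
proof -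
  have "AE x in lebesgue_on \<Omega>. g x $ i = g' x $ i" for i
    using assms by (intro eq_ae_by_test_functions) (auto simp: is_weak_grad_def intro: Lp2_nth)
  then have "AE x in lebesgue_on \<Omega>. \<forall>i. g x $ i = g' x $ i" by (simp add: AE_all_countable)
  then show ?thesis by eventually_elim (simp add: vec_eq_iff)
qed

lemma weak_curl_unique:
  assumes "is_weak_curl \<Omega> v c" "is_weak_curl \<Omega> v c'"
  shows "AE x in lebesgue_on \<Omega>. c x = c' x"
proof -
  have "AE x in lebesgue_on \<Omega>. c x $ i = c' x $ i" for i
  proof (rule eq_ae_by_test_functions)
    fix \<phi> assume \<phi>: "\<phi> \<in> test_functions \<Omega>"
    \<comment> \<open>A test field with a single nonzero component isolates the i-th component of
      the curl.\<close>
    let ?\<Phi> = "\<lambda>x. axis i (\<phi> x) :: real^3"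
    have "(\<lambda>x. ?\<Phi> x $ j) \<in> test_functions \<Omega>" for j
      using \<phi> zero_test_function by (cases "i = j") (auto simp: axis_def)
    then have "(\<integral>x. c x \<bullet> ?\<Phi> x \<partial>lebesgue_on \<Omega>) = (\<integral>x. c' x \<bullet> ?\<Phi> x \<partial>lebesgue_on \<Omega>)"
      using assms by (simp add: is_weak_curl_def)
    then show "(\<integral>x. c x $ i * \<phi> x \<partial>lebesgue_on \<Omega>) = (\<integral>x. c' x $ i * \<phi> x \<partial>lebesgue_on \<Omega>)"
      by (simp add: inner_axis)
  qed (use assms in \<open>auto simp: is_weak_curl_def intro: Lp2_nth\<close>)
  then have "AE x in lebesgue_on \<Omega>. \<forall>i. c x $ i = c' x $ i" by (simp add: AE_all_countable)
  then show ?thesis by eventually_elim (simp add: vec_eq_iff)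
qed

lemma weak_grad_is: "w \<in> H1 \<Omega> \<Longrightarrow> is_weak_grad \<Omega> w (weak_grad \<Omega> w)"
  unfolding weak_grad_def H1_def using someI_ex[of "is_weak_grad \<Omega> w"] by auto

lemma weak_div_is: "v \<in> H_div \<Omega> \<Longrightarrow> is_weak_div \<Omega> v (weak_div \<Omega> v)"
  unfolding weak_div_def H_div_def using someI_ex[of "is_weak_div \<Omega> v"] by auto

lemma weak_curl_is: "v \<in> H_curl \<Omega> \<Longrightarrow> is_weak_curl \<Omega> v (weak_curl \<Omega> v)"
  unfolding weak_curl_def H_curl_def using someI_ex[of "is_weak_curl \<Omega> v"] by auto

lemma test_function_grad_Lp2: "\<phi> \<in> test_functions \<Omega> \<Longrightarrow> grad \<phi> \<in> Lp 2 \<Omega>"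
  by (rule Lp2_vecI) (simp add: grad_def Cc_Lp2 test_function_partial_Cc)

text \<open>Shows that fields in \<open>H1_vec\<close> have a genuine weak curl, so that the choice
  in \<open>tangential_trace\<close> is meaningful, and makes that curl explicit for mollifier
  fields.\<close>

lemma is_weak_curl_curl_of:
  assumes w: "\<And>i. (\<lambda>x. w x $ i) \<in> Lp 2 \<Omega>" and g: "\<And>i. is_weak_grad \<Omega> (\<lambda>x. w x $ i) (g i)"
  shows "is_weak_curl \<Omega> w (curl_of g)"
proof -
  have gL: "g i \<in> Lp 2 \<Omega>" for i using g by (simp add: is_weak_grad_def)
  have "(\<integral>x. w x \<bullet> curl \<psi> x \<partial>lebesgue_on \<Omega>) = (\<integral>x. curl_of g x \<bullet> \<psi> x \<partial>lebesgue_on \<Omega>)"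
    if \<psi>: "\<And>i. (\<lambda>x. \<psi> x $ i) \<in> test_functions \<Omega>" for \<psi>
  proof -
    have i1: "integrable (lebesgue_on \<Omega>) (\<lambda>x. w x $ i * partial_deriv j (\<lambda>x. \<psi> x $ k) x)" for i j k
      using integrable_inner_L2[OF w[of i] Cc_Lp2[OF test_function_partial_Cc[OF \<psi>[of k]]], of j] by simp
    have i2: "integrable (lebesgue_on \<Omega>) (\<lambda>x. g i x $ j * \<psi> x $ k)" for i j k
      using integrable_inner_L2[OF Lp2_nth[OF gL[of i], of j] Cc_Lp2[OF test_function_Cc(1)[OF \<psi>[of k]]]] by simp
    have e: "(\<integral>x. w x $ i * partial_deriv j (\<lambda>x. \<psi> x $ k) x \<partial>lebesgue_on \<Omega>)
        = - (\<integral>x. g i x $ j * \<psi> x $ k \<partial>lebesgue_on \<Omega>)" for i j k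
      using g[of i] \<psi>[of k] by (auto simp: is_weak_grad_def)
    have "(\<integral>x. w x \<bullet> curl \<psi> x \<partial>lebesgue_on \<Omega>) =
      (\<integral>x. w x $ 1 * partial_deriv 2 (\<lambda>x. \<psi> x $ 3) x - w x $ 1 * partial_deriv 3 (\<lambda>x. \<psi> x $ 2) x
          + (w x $ 2 * partial_deriv 3 (\<lambda>x. \<psi> x $ 1) x - w x $ 2 * partial_deriv 1 (\<lambda>x. \<psi> x $ 3) x)
          + (w x $ 3 * partial_deriv 1 (\<lambda>x. \<psi> x $ 2) x - w x $ 3 * partial_deriv 2 (\<lambda>x. \<psi> x $ 1) x)
        \<partial>lebesgue_on \<Omega>)"
      by (simp add: curl_def inner_vec_def sum_3 right_diff_distrib)
    also have "\<dots> = (\<integral>x. g 3 x $ 2 * \<psi> x $ 1 - g 2 x $ 3 * \<psi> x $ 1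
          + (g 1 x $ 3 * \<psi> x $ 2 - g 3 x $ 1 * \<psi> x $ 2)
          + (g 2 x $ 1 * \<psi> x $ 3 - g 1 x $ 2 * \<psi> x $ 3) \<partial>lebesgue_on \<Omega>)"
      using i1 i2 by (simp add: e)
    also have "\<dots> = (\<integral>x. curl_of g x \<bullet> \<psi> x \<partial>lebesgue_on \<Omega>)"
      by (simp add: curl_of_def inner_vec_def sum_3 left_diff_distrib)
    finally show ?thesis .
  qed
  then show ?thesis using curl_of_Lp2[OF gL] by (auto simp: is_weak_curl_def)
qed

lemma H1_vec_curl: "w \<in> H1_vec \<Omega> \<Longrightarrow> w \<in> H_curl \<Omega> \<and> is_weak_curl \<Omega> w (curl_of (\<lambda>i. weak_grad \<Omega> (\<lambda>x. w x $ i)))"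
  using is_weak_curl_curl_of[of w "\<lambda>i. weak_grad \<Omega> (\<lambda>x. w x $ i)"] weak_grad_is
  by (auto simp: H1_vec_def H_curl_def H1_def intro!: Lp2_vecI)

lemma test_function_curl_Lp2:
  "(\<And>i. (\<lambda>x. \<phi> x $ i) \<in> test_functions \<Omega>) \<Longrightarrow> curl \<phi> \<in> Lp 2 \<Omega> \<and> \<phi> \<in> Lp 2 \<Omega>"
  unfolding curl_eq_curl_of
  by (intro conjI curl_of_Lp2 test_function_grad_Lp2 Lp2_vecI) (auto intro: Cc_Lp2 test_function_Cc(1))

subsection \<open>The space V\<close>

text \<open>\<open>has_div_curl v d c\<close> says that \<open>v\<close> lies in \<open>V\<close> with divergence \<open>d\<close> and curl \<open>c\<close>, as a list of
  linear \<open>L\<^sup>2\<close>-continuous conditions on the triple.\<close>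

definition has_div_curl :: "(real^3 \<Rightarrow> real^3) \<Rightarrow> (real^3 \<Rightarrow> real) \<Rightarrow> (real^3 \<Rightarrow> real^3) \<Rightarrow> bool" where
  "has_div_curl v d c \<longleftrightarrow> v \<in> Lp 2 \<Omega> \<and> d \<in> Lp 2 \<Omega> \<and> c \<in> Lp 2 \<Omega> \<and>
     (\<forall>\<phi>\<in>test_functions \<Omega>. l2ip \<Omega> v (grad \<phi>) + l2ip \<Omega> d \<phi> = 0) \<and>
     (\<forall>\<phi>\<in>H1 \<Omega>. l2ip \<Omega> v (weak_grad \<Omega> \<phi>) + l2ip \<Omega> d \<phi> = 0) \<and>
     (\<forall>\<phi>. (\<forall>i. (\<lambda>x. \<phi> x $ i) \<in> test_functions \<Omega>) \<longrightarrow> l2ip \<Omega> c \<phi> + - 1 * l2ip \<Omega> v (curl \<phi>) = 0) \<and>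
     (\<forall>\<phi>\<in>H1_vec \<Omega>. l2ip \<Omega> c \<phi> + - 1 * l2ip \<Omega> v (weak_curl \<Omega> \<phi>) = 0)"

lemma has_div_curl_weak:
  assumes "has_div_curl v d c"
  shows "is_weak_div \<Omega> v d" "is_weak_curl \<Omega> v c"
  using assms by (auto simp: has_div_curl_def is_weak_div_def is_weak_curl_def l2ip_def)

lemma trace_spaces_Lp2:
  "\<phi> \<in> H1 \<Omega> \<Longrightarrow> \<phi> \<in> Lp 2 \<Omega> \<and> weak_grad \<Omega> \<phi> \<in> Lp 2 \<Omega>"
  "\<Phi> \<in> H1_vec \<Omega> \<Longrightarrow> \<Phi> \<in> Lp 2 \<Omega> \<and> weak_curl \<Omega> \<Phi> \<in> Lp 2 \<Omega>"
  using weak_grad_is[of \<phi>] H1_vec_curl[of \<Phi>] weak_curl_is[of \<Phi>]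
  by (auto simp: H1_def is_weak_grad_def is_weak_curl_def H_curl_def)

text \<open>By uniqueness of weak derivatives d and c may replace the chosen \<open>weak_div\<close>
  and \<open>weak_curl\<close> in the trace functionals. Closure properties of V can thus be checked
  on explicit triples.\<close>

lemma has_div_curl_imp_V:
  assumes h: "has_div_curl v d c"
  shows "v \<in> V_space \<Omega>" "AE x in lebesgue_on \<Omega>. weak_div \<Omega> v x = d x"
    "AE x in lebesgue_on \<Omega>. weak_curl \<Omega> v x = c x"
proof -
  have L: "v \<in> Lp 2 \<Omega>" "d \<in> Lp 2 \<Omega>" "c \<in> Lp 2 \<Omega>" using h by (auto simp: has_div_curl_def)
  have hd: "v \<in> H_div \<Omega>" and hc: "v \<in> H_curl \<Omega>"
    using has_div_curl_weak[OF h] L by (auto simp: H_div_def H_curl_def)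
  show d: "AE x in lebesgue_on \<Omega>. weak_div \<Omega> v x = d x"
    by (rule weak_div_unique[OF weak_div_is[OF hd] has_div_curl_weak(1)[OF h]])
  show c: "AE x in lebesgue_on \<Omega>. weak_curl \<Omega> v x = c x"
    by (rule weak_curl_unique[OF weak_curl_is[OF hc] has_div_curl_weak(2)[OF h]])
  have Ld: "weak_div \<Omega> v \<in> Lp 2 \<Omega>" "weak_curl \<Omega> v \<in> Lp 2 \<Omega>"
    using weak_div_is[OF hd] weak_curl_is[OF hc] by (auto simp: is_weak_div_def is_weak_curl_def)
  have "normal_trace \<Omega> v \<phi> = 0" if "\<phi> \<in> H1 \<Omega>" for \<phi>
  proof -
    have "l2ip \<Omega> (weak_div \<Omega> v) \<phi> = l2ip \<Omega> d \<phi>"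
      using d L Ld trace_spaces_Lp2(1)[OF that] by (intro l2ip_cong) auto
    then show ?thesis using h that by (auto simp: has_div_curl_def normal_trace_def l2ip_def)
  qed
  moreover have "tangential_trace \<Omega> v \<phi> = 0" if "\<phi> \<in> H1_vec \<Omega>" for \<phi>
  proof -
    have "l2ip \<Omega> (weak_curl \<Omega> v) \<phi> = l2ip \<Omega> c \<phi>"
      using c L Ld trace_spaces_Lp2(2)[OF that] by (intro l2ip_cong) auto
    then show ?thesis using h that by (auto simp: has_div_curl_def tangential_trace_def l2ip_def)
  qed
  ultimately show "v \<in> V_space \<Omega>" using hd hc by (simp add: V_space_def H0_div_def H0_curl_def)
qed

lemma V_has_div_curl:
  assumes "v \<in> V_space \<Omega>"
  shows "has_div_curl v (weak_div \<Omega> v) (weak_curl \<Omega> v)"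
proof -
  have hd: "v \<in> H_div \<Omega>" and hc: "v \<in> H_curl \<Omega>"
    and t: "\<forall>\<phi>\<in>H1 \<Omega>. normal_trace \<Omega> v \<phi> = 0" "\<forall>\<phi>\<in>H1_vec \<Omega>. tangential_trace \<Omega> v \<phi> = 0"
    using assms by (auto simp: V_space_def H0_div_def H0_curl_def)
  then show ?thesis using weak_div_is[OF hd] weak_curl_is[OF hc]
    by (auto simp: has_div_curl_def is_weak_div_def is_weak_curl_def l2ip_def normal_trace_def
        tangential_trace_def H_div_def)
qed

lemma V_Lp2:
  assumes "v \<in> V_space \<Omega>"
  shows "v \<in> Lp 2 \<Omega>" "weak_div \<Omega> v \<in> Lp 2 \<Omega>" "weak_curl \<Omega> v \<in> Lp 2 \<Omega>"
  using V_has_div_curl[OF assms] by (auto simp: has_div_curl_def)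

lemma has_div_curl_axpy:
  assumes "has_div_curl u d c" "has_div_curl v d' c'"
  shows "has_div_curl (fun_axpy a u v) (fun_axpy a d d') (fun_axpy a c c')"
proof -
  have L: "u \<in> Lp 2 \<Omega>" "d \<in> Lp 2 \<Omega>" "c \<in> Lp 2 \<Omega>" "v \<in> Lp 2 \<Omega>" "d' \<in> Lp 2 \<Omega>" "c' \<in> Lp 2 \<Omega>"
    using assms by (auto simp: has_div_curl_def)
  have 1: "(a * p + p') + (a * q + q') = 0" if "p + q = 0" "p' + q' = 0" for p q p' q' :: real
  proof -
    have "(a * p + p') + (a * q + q') = a * (p + q) + (p' + q')" by (simp add: algebra_simps)
    then show ?thesis using that by simp
  qed
  have 2: "(a * p + p') + - 1 * (a * q + q') = 0" if "p + - 1 * q = 0" "p' + - 1 * q' = 0" for p q p' q' :: real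
    using that by simp
  have "fun_axpy a u v \<in> Lp 2 \<Omega>" "fun_axpy a d d' \<in> Lp 2 \<Omega>" "fun_axpy a c c' \<in> Lp 2 \<Omega>"
    unfolding fun_axpy_def by (intro Lp2_scaleR_add L)+
  then show ?thesis
    using assms unfolding has_div_curl_def
    by (auto simp: l2ip_axpy L test_function_grad_Lp2 Cc_Lp2 test_function_Cc(1) trace_spaces_Lp2
        test_function_curl_Lp2 intro!: 1 2 simp del: mult_minus1 mult_1)
qed

lemma has_div_curl_lim:
  assumes X: "\<And>n. has_div_curl (X n) (D n) (C n)"
    and u: "u \<in> Lp 2 \<Omega>" "d \<in> Lp 2 \<Omega>" "c \<in> Lp 2 \<Omega>"
    and lim: "(\<lambda>n. Lp_norm 2 \<Omega> (\<lambda>x. X n x - u x)) \<longlonglongrightarrow> 0"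
      "(\<lambda>n. Lp_norm 2 \<Omega> (\<lambda>x. D n x - d x)) \<longlonglongrightarrow> 0" "(\<lambda>n. Lp_norm 2 \<Omega> (\<lambda>x. C n x - c x)) \<longlonglongrightarrow> 0"
  shows "has_div_curl u d c"
proof -
  have L: "X n \<in> Lp 2 \<Omega>" "D n \<in> Lp 2 \<Omega>" "C n \<in> Lp 2 \<Omega>" for n
    using X[of n] by (auto simp: has_div_curl_def)
  have 1: "l2ip \<Omega> u a + l2ip \<Omega> d b = 0"
    if "a \<in> Lp 2 \<Omega>" "b \<in> Lp 2 \<Omega>" "\<And>n. l2ip \<Omega> (X n) a + l2ip \<Omega> (D n) b = 0" for a b
  proof -
    have "(\<lambda>n. l2ip \<Omega> (X n) a + l2ip \<Omega> (D n) b) \<longlonglongrightarrow> l2ip \<Omega> u a + l2ip \<Omega> d b"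
      by (intro tendsto_add l2ip_tendsto L u that lim)
    then show ?thesis using that(3) by (simp add: LIMSEQ_const_iff)
  qed
  have 2: "l2ip \<Omega> c b + - 1 * l2ip \<Omega> u a = 0"
    if "a \<in> Lp 2 \<Omega>" "b \<in> Lp 2 \<Omega>" "\<And>n. l2ip \<Omega> (C n) b + - 1 * l2ip \<Omega> (X n) a = 0" for a b
  proof -
    have "(\<lambda>n. l2ip \<Omega> (C n) b + - 1 * l2ip \<Omega> (X n) a) \<longlonglongrightarrow> l2ip \<Omega> c b + - 1 * l2ip \<Omega> u a"
      by (intro tendsto_add tendsto_mult tendsto_const l2ip_tendsto L u that lim)
    then show ?thesis using that(3) by (simp add: LIMSEQ_const_iff)
  qed
  show ?thesis
    unfolding has_div_curl_def
  proof (intro conjI ballI allI impI)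
    show "l2ip \<Omega> u (grad \<phi>) + l2ip \<Omega> d \<phi> = 0" if "\<phi> \<in> test_functions \<Omega>" for \<phi>
      using that X by (intro 1) (auto simp: has_div_curl_def test_function_grad_Lp2 Cc_Lp2 test_function_Cc(1))
    show "l2ip \<Omega> u (weak_grad \<Omega> \<phi>) + l2ip \<Omega> d \<phi> = 0" if "\<phi> \<in> H1 \<Omega>" for \<phi>
      using that X by (intro 1) (auto simp: has_div_curl_def trace_spaces_Lp2)
    show "l2ip \<Omega> c \<phi> + - 1 * l2ip \<Omega> u (curl \<phi>) = 0" if "\<forall>i. (\<lambda>x. \<phi> x $ i) \<in> test_functions \<Omega>" for \<phi>
      using that X by (intro 2) (auto simp: has_div_curl_def test_function_curl_Lp2)
    show "l2ip \<Omega> c \<phi> + - 1 * l2ip \<Omega> u (weak_curl \<Omega> \<phi>) = 0" if "\<phi> \<in> H1_vec \<Omega>" for \<phi>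
      using that X by (intro 2) (auto simp: has_div_curl_def trace_spaces_Lp2)
  qed (use u in auto)
qed

lemma zero_has_div_curl: "has_div_curl (\<lambda>x. 0) (\<lambda>x. 0) (\<lambda>x. 0)"
  by (simp add: has_div_curl_def Lp2_zero l2ip_def)

lemma zero_in_V: "(\<lambda>x. 0) \<in> V_space \<Omega>"
  by (rule has_div_curl_imp_V[OF zero_has_div_curl])

lemma V_axpy:
  assumes "u \<in> V_space \<Omega>" "v \<in> V_space \<Omega>"
  shows "fun_axpy a u v \<in> V_space \<Omega>"
    "AE x in lebesgue_on \<Omega>. weak_div \<Omega> (fun_axpy a u v) x = fun_axpy a (weak_div \<Omega> u) (weak_div \<Omega> v) x"
    "AE x in lebesgue_on \<Omega>. weak_curl \<Omega> (fun_axpy a u v) x = fun_axpy a (weak_curl \<Omega> u) (weak_curl \<Omega> v) x"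
  using has_div_curl_imp_V[OF has_div_curl_axpy[OF assms[THEN V_has_div_curl]]] by auto

section \<open>The Hilbert structure of V\<close>

definition V_ip :: "(real^3 \<Rightarrow> real^3) \<Rightarrow> (real^3 \<Rightarrow> real^3) \<Rightarrow> real" where
  "V_ip u v = l2ip \<Omega> u v + l2ip \<Omega> (weak_div \<Omega> u) (weak_div \<Omega> v) + l2ip \<Omega> (weak_curl \<Omega> u) (weak_curl \<Omega> v)"

lemma V_norm_eq: "V_norm \<Omega> v = sqrt (V_ip v v)"
  by (simp add: V_norm_def V_ip_def Lp_norm_2_sq)

lemma l2ip_weak_axpy:
  assumes "u \<in> V_space \<Omega>" "v \<in> V_space \<Omega>"
  shows "w \<in> Lp 2 \<Omega> \<Longrightarrow> l2ip \<Omega> (weak_div \<Omega> (fun_axpy a u v)) w = a * l2ip \<Omega> (weak_div \<Omega> u) w + l2ip \<Omega> (weak_div \<Omega> v) w"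
    "c \<in> Lp 2 \<Omega> \<Longrightarrow> l2ip \<Omega> (weak_curl \<Omega> (fun_axpy a u v)) c = a * l2ip \<Omega> (weak_curl \<Omega> u) c + l2ip \<Omega> (weak_curl \<Omega> v) c"
proof -
  note uv = assms[THEN V_Lp2(1)] assms[THEN V_Lp2(2)] assms[THEN V_Lp2(3)]
  note ax = V_axpy[OF assms, of a]
  have L: "fun_axpy a (weak_div \<Omega> u) (weak_div \<Omega> v) \<in> Lp 2 \<Omega>" "fun_axpy a (weak_curl \<Omega> u) (weak_curl \<Omega> v) \<in> Lp 2 \<Omega>"
    unfolding fun_axpy_def by (intro Lp2_scaleR_add uv)+
  show "l2ip \<Omega> (weak_div \<Omega> (fun_axpy a u v)) w = a * l2ip \<Omega> (weak_div \<Omega> u) w + l2ip \<Omega> (weak_div \<Omega> v) w"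
    if "w \<in> Lp 2 \<Omega>"
  proof -
    have "l2ip \<Omega> (weak_div \<Omega> (fun_axpy a u v)) w = l2ip \<Omega> (fun_axpy a (weak_div \<Omega> u) (weak_div \<Omega> v)) w"
      using ax V_Lp2[OF ax(1)] L that by (intro l2ip_cong) auto
    then show ?thesis using uv that by (simp add: l2ip_axpy)
  qed
  show "l2ip \<Omega> (weak_curl \<Omega> (fun_axpy a u v)) c = a * l2ip \<Omega> (weak_curl \<Omega> u) c + l2ip \<Omega> (weak_curl \<Omega> v) c"
    if "c \<in> Lp 2 \<Omega>"
  proof -
    have "l2ip \<Omega> (weak_curl \<Omega> (fun_axpy a u v)) c = l2ip \<Omega> (fun_axpy a (weak_curl \<Omega> u) (weak_curl \<Omega> v)) c"
      using ax V_Lp2[OF ax(1)] L that by (intro l2ip_cong) auto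
    then show ?thesis using uv that by (simp add: l2ip_axpy)
  qed
qed

lemma V_norm_ge:
  "Lp_norm 2 \<Omega> v \<le> V_norm \<Omega> v" "Lp_norm 2 \<Omega> (weak_div \<Omega> v) \<le> V_norm \<Omega> v" "Lp_norm 2 \<Omega> (weak_curl \<Omega> v) \<le> V_norm \<Omega> v"
  "0 \<le> V_norm \<Omega> v"
  unfolding V_norm_def by (auto intro!: real_le_rsqrt)

text \<open>The derivatives of a difference are chosen afresh; they agree with the differences of
  the chosen derivatives only almost everywhere, which the norm does not see.\<close>

lemma V_norm_diff_sq:
  assumes "u \<in> V_space \<Omega>" "v \<in> V_space \<Omega>"
  shows "(V_norm \<Omega> (fun_axpy (-1) v u))\<^sup>2 = (Lp_norm 2 \<Omega> (\<lambda>x. u x - v x))\<^sup>2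
     + (Lp_norm 2 \<Omega> (\<lambda>x. weak_div \<Omega> u x - weak_div \<Omega> v x))\<^sup>2 + (Lp_norm 2 \<Omega> (\<lambda>x. weak_curl \<Omega> u x - weak_curl \<Omega> v x))\<^sup>2"
proof -
  note uv = assms[THEN V_Lp2(1)] assms[THEN V_Lp2(2)] assms[THEN V_Lp2(3)]
  note ax = V_axpy[OF assms(2,1), of "-1"]
  have L: "fun_axpy (-1) (weak_div \<Omega> v) (weak_div \<Omega> u) \<in> Lp 2 \<Omega>" "fun_axpy (-1) (weak_curl \<Omega> v) (weak_curl \<Omega> u) \<in> Lp 2 \<Omega>"
    unfolding fun_axpy_def by (intro Lp2_scaleR_add uv)+
  have "l2ip \<Omega> (weak_div \<Omega> (fun_axpy (-1) v u)) (weak_div \<Omega> (fun_axpy (-1) v u))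
      = l2ip \<Omega> (fun_axpy (-1) (weak_div \<Omega> v) (weak_div \<Omega> u)) (fun_axpy (-1) (weak_div \<Omega> v) (weak_div \<Omega> u))"
    using ax V_Lp2[OF ax(1)] L by (intro l2ip_cong)
  moreover have "l2ip \<Omega> (weak_curl \<Omega> (fun_axpy (-1) v u)) (weak_curl \<Omega> (fun_axpy (-1) v u))
      = l2ip \<Omega> (fun_axpy (-1) (weak_curl \<Omega> v) (weak_curl \<Omega> u)) (fun_axpy (-1) (weak_curl \<Omega> v) (weak_curl \<Omega> u))"
    using ax V_Lp2[OF ax(1)] L by (intro l2ip_cong)
  ultimately show ?thesis
    by (simp add: V_norm_def Lp_norm_2_sq) (simp add: fun_axpy_def l2ip_self)
qed

text \<open>For completeness, the fields, their divergences and their curls converge separately in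
  L2. The conditions of \<open>has_div_curl\<close> survive the limit, zero traces included, so the
  limit is in V with the expected derivatives.\<close>

lemma semi_hilbert_V: "semi_hilbert (V_space \<Omega>) fun_axpy V_ip"
proof
  show "V_space \<Omega> \<noteq> {}" using zero_in_V by blast
  show "fun_axpy a x y \<in> V_space \<Omega>" if "x \<in> V_space \<Omega>" "y \<in> V_space \<Omega>" for a x y
    using V_axpy(1) that by blast
  show "V_ip (fun_axpy a x y) z = a * V_ip x z + V_ip y z"
    if "x \<in> V_space \<Omega>" "y \<in> V_space \<Omega>" "z \<in> V_space \<Omega>" for a x y z
    using that by (simp add: V_ip_def l2ip_weak_axpy l2ip_axpy V_Lp2 algebra_simps)
  show "V_ip x y = V_ip y x" for x y by (simp add: V_ip_def l2ip_commute)
  show "0 \<le> V_ip x x" for x by (simp add: V_ip_def l2ip_self)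
  fix X :: "nat \<Rightarrow> real^3 \<Rightarrow> real^3"
  assume X: "\<And>n. X n \<in> V_space \<Omega>"
    and "\<And>e. 0 < e \<Longrightarrow> \<exists>N. \<forall>m\<ge>N. \<forall>n\<ge>N.
      sqrt (V_ip (fun_axpy (-1) (X n) (X m)) (fun_axpy (-1) (X n) (X m))) < e"
  then have C: "\<And>e. 0 < e \<Longrightarrow> \<exists>N. \<forall>m\<ge>N. \<forall>n\<ge>N. V_norm \<Omega> (fun_axpy (-1) (X n) (X m)) < e"
    by (simp add: V_norm_eq)
  have part: "Lp_norm 2 \<Omega> (\<lambda>x. X m x - X n x) \<le> V_norm \<Omega> (fun_axpy (-1) (X n) (X m))"
    "Lp_norm 2 \<Omega> (\<lambda>x. weak_div \<Omega> (X m) x - weak_div \<Omega> (X n) x) \<le> V_norm \<Omega> (fun_axpy (-1) (X n) (X m))"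
    "Lp_norm 2 \<Omega> (\<lambda>x. weak_curl \<Omega> (X m) x - weak_curl \<Omega> (X n) x) \<le> V_norm \<Omega> (fun_axpy (-1) (X n) (X m))" for m n
    by (rule power2_le_imp_le; simp add: V_norm_diff_sq[OF X X] V_norm_ge)+
  have cauchy: "\<exists>N. \<forall>m\<ge>N. \<forall>n\<ge>N. F m n < e"
    if "0 < e" and le: "\<And>m n. F m n \<le> V_norm \<Omega> (fun_axpy (-1) (X n) (X m))" for F and e :: real
  proof -
    obtain N where "\<forall>m\<ge>N. \<forall>n\<ge>N. V_norm \<Omega> (fun_axpy (-1) (X n) (X m)) < e" using C[OF \<open>0 < e\<close>] by blast
    then show ?thesis using le by (intro exI[of _ N]) (blast intro: le_less_trans)
  qed
  note L = V_Lp2[OF X]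
  obtain u where u: "u \<in> Lp 2 \<Omega>" "(\<lambda>n. Lp_norm 2 \<Omega> (\<lambda>x. X n x - u x)) \<longlonglongrightarrow> 0"
    by (rule L2_complete[of X, OF L(1)]) (rule cauchy[OF _ part(1)])
  obtain d where d: "d \<in> Lp 2 \<Omega>" "(\<lambda>n. Lp_norm 2 \<Omega> (\<lambda>x. weak_div \<Omega> (X n) x - d x)) \<longlonglongrightarrow> 0"
    by (rule L2_complete[of "\<lambda>n. weak_div \<Omega> (X n)", OF L(2)]) (rule cauchy[OF _ part(2)])
  obtain c where c: "c \<in> Lp 2 \<Omega>" "(\<lambda>n. Lp_norm 2 \<Omega> (\<lambda>x. weak_curl \<Omega> (X n) x - c x)) \<longlonglongrightarrow> 0"
    by (rule L2_complete[of "\<lambda>n. weak_curl \<Omega> (X n)", OF L(3)]) (rule cauchy[OF _ part(3)])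
  have h: "has_div_curl u d c"
    by (rule has_div_curl_lim[OF V_has_div_curl[OF X] u(1) d(1) c(1) u(2) d(2) c(2)])
  have uV: "u \<in> V_space \<Omega>" by (rule has_div_curl_imp_V[OF h])
  have "V_norm \<Omega> (fun_axpy (-1) u (X n)) = sqrt ((Lp_norm 2 \<Omega> (\<lambda>x. X n x - u x))\<^sup>2
     + (Lp_norm 2 \<Omega> (\<lambda>x. weak_div \<Omega> (X n) x - d x))\<^sup>2 + (Lp_norm 2 \<Omega> (\<lambda>x. weak_curl \<Omega> (X n) x - c x))\<^sup>2)" for n
  proof -
    have "l2ip \<Omega> (\<lambda>x. weak_div \<Omega> (X n) x - weak_div \<Omega> u x) (\<lambda>x. weak_div \<Omega> (X n) x - weak_div \<Omega> u x)
        = l2ip \<Omega> (\<lambda>x. weak_div \<Omega> (X n) x - d x) (\<lambda>x. weak_div \<Omega> (X n) x - d x)"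
      by (intro l2ip_cong Lp2_diff L d V_Lp2[OF uV])
         (use has_div_curl_imp_V(2)[OF h] in \<open>auto elim: eventually_mono\<close>)
    moreover have "l2ip \<Omega> (\<lambda>x. weak_curl \<Omega> (X n) x - weak_curl \<Omega> u x) (\<lambda>x. weak_curl \<Omega> (X n) x - weak_curl \<Omega> u x)
        = l2ip \<Omega> (\<lambda>x. weak_curl \<Omega> (X n) x - c x) (\<lambda>x. weak_curl \<Omega> (X n) x - c x)"
      by (intro l2ip_cong Lp2_diff L c V_Lp2[OF uV])
         (use has_div_curl_imp_V(3)[OF h] in \<open>auto elim: eventually_mono\<close>)
    ultimately have "(V_norm \<Omega> (fun_axpy (-1) u (X n)))\<^sup>2 = (Lp_norm 2 \<Omega> (\<lambda>x. X n x - u x))\<^sup>2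
     + (Lp_norm 2 \<Omega> (\<lambda>x. weak_div \<Omega> (X n) x - d x))\<^sup>2 + (Lp_norm 2 \<Omega> (\<lambda>x. weak_curl \<Omega> (X n) x - c x))\<^sup>2"
      using V_norm_diff_sq[OF X uV, of n] by (simp add: Lp_norm_2_sq)
    then show ?thesis using V_norm_ge(4) by (metis real_sqrt_unique)
  qed
  moreover have "(\<lambda>n. sqrt ((Lp_norm 2 \<Omega> (\<lambda>x. X n x - u x))\<^sup>2
     + (Lp_norm 2 \<Omega> (\<lambda>x. weak_div \<Omega> (X n) x - d x))\<^sup>2 + (Lp_norm 2 \<Omega> (\<lambda>x. weak_curl \<Omega> (X n) x - c x))\<^sup>2))
     \<longlonglongrightarrow> sqrt (0\<^sup>2 + 0\<^sup>2 + 0\<^sup>2)"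
    by (intro tendsto_intros u d c)
  ultimately have "(\<lambda>n. V_norm \<Omega> (fun_axpy (-1) u (X n))) \<longlonglongrightarrow> 0" by simp
  then show "\<exists>x\<in>V_space \<Omega>. (\<lambda>n. sqrt (V_ip (fun_axpy (-1) x (X n)) (fun_axpy (-1) x (X n)))) \<longlonglongrightarrow> 0"
    using uV unfolding V_norm_eq by blast
qed

text \<open>The vanishing normal trace is tested with the constant 1, whose weak gradient is 0
  because derivatives of test functions have integral 0. It makes div v an admissible pressure test
  function.\<close>

lemma integral_weak_div_zero:
  assumes "v \<in> V_space \<Omega>"
  shows "(\<integral>x. weak_div \<Omega> v x \<partial>lebesgue_on \<Omega>) = 0"
proof -
  have g: "is_weak_grad \<Omega> (\<lambda>x. 1) (\<lambda>x. 0)"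
  proof -
    have "(\<integral>x. partial_deriv i \<phi> x \<partial>lebesgue_on \<Omega>) = 0" if \<phi>: "\<phi> \<in> test_functions \<Omega>" for \<phi> i
    proof -
      note t = test_function_Cc[OF \<phi>]
      have "(\<integral>x. partial_deriv i \<phi> x \<partial>lebesgue_on \<Omega>) = (\<integral>x. partial_deriv i \<phi> x \<partial>lborel)"
        using t Cc_measurable by (intro integral_dom) auto
      also have "\<dots> = 0"
      proof (rule integral_directional_deriv_zero[OF t(1) t(2)])
        show "((\<lambda>t. \<phi> (x + t *\<^sub>R axis i 1)) has_real_derivative partial_deriv i \<phi> x) (at 0)" for x
          using t(3)[of x] partial_deriv_directional unfolding differentiable_def by blast
      qed
      finally show ?thesis .
    qed
    then show ?thesis by (simp add: is_weak_grad_def Lp2_zero)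
  qed
  then have H: "(\<lambda>x. 1) \<in> H1 \<Omega>" using Lp2_const by (auto simp: H1_def)
  have "l2ip \<Omega> v (weak_grad \<Omega> (\<lambda>x. 1)) = l2ip \<Omega> v (\<lambda>x. 0)"
    using weak_grad_unique[OF weak_grad_is[OF H] g] V_Lp2[OF assms] trace_spaces_Lp2(1)[OF H] Lp2_zero
    by (intro l2ip_cong) auto
  moreover have "l2ip \<Omega> v (weak_grad \<Omega> (\<lambda>x. 1)) + l2ip \<Omega> (weak_div \<Omega> v) (\<lambda>x. 1) = 0"
    using V_has_div_curl[OF assms] H by (simp add: has_div_curl_def)
  ultimately show ?thesis by (simp add: l2ip_def)
qed

end

section \<open>The embedding of V into \<open>L\<^sup>4\<close>\<close>

text \<open>The i-th partial derivative of \<open>moll n\<close>; the factor \<open>Suc n\<close> is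
  that of the chain rule.\<close>

definition dmoll :: "nat \<Rightarrow> 3 \<Rightarrow> real^3 \<Rightarrow> real" where
  "dmoll n i z = (inverse (\<integral>x. bump (\<lambda>_. 0) (Suc n) x \<partial>lborel) * Suc n) * bump (unit_index i) (Suc n) z"

lemma dmoll_Cc: "Cc (dmoll n i)"
  using Cc_bump[of "real (Suc n)" "inverse (\<integral>x. bump (\<lambda>_. 0) (Suc n) x \<partial>lborel) * Suc n" "unit_index i" 0]
  by (simp add: dmoll_def[abs_def])

lemma partial_deriv_moll:
  "partial_deriv i (\<lambda>y. moll n (y - x)) = (\<lambda>y. dmoll n i (y - x))"
  "partial_deriv i (\<lambda>x. moll n (y - x)) = (\<lambda>x. - dmoll n i (y - x))"
  unfolding moll_def dmoll_def partial_deriv_bump partial_deriv_bump_reflect(2) by simp_all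

lemma moll_differentiable:
  "(\<lambda>y. moll n (y - x)) differentiable (at z)" "(\<lambda>x. moll n (y - x)) differentiable (at z)"
  unfolding moll_def
  using has_derivative_mult_right[OF bump_has_derivative] partial_deriv_bump_reflect(1)
  by (blast intro: differentiableI)+

lemma conv_scale: "conv (\<lambda>z. a * k z) f x = a * conv k f x"
  by (simp add: conv_def mult.assoc)

lemma grad_div_curl_moll:
  fixes f :: "3 \<Rightarrow> real^3 \<Rightarrow> real" and n :: nat
  assumes f: "\<And>j. bsupp (f j)"
  defines "G \<equiv> \<lambda>i j. conv (dmoll n i) (f j)"
  shows "(\<Sum>j\<in>UNIV. \<Sum>i\<in>UNIV. \<integral>x. (G i j x)\<^sup>2 \<partial>lborel)
    = (\<integral>x. (G 1 1 x + G 2 2 x + G 3 3 x)\<^sup>2 \<partial>lborel)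
      + (\<integral>x. (G 2 3 x - G 3 2 x)\<^sup>2 \<partial>lborel) + (\<integral>x. (G 3 1 x - G 1 3 x)\<^sup>2 \<partial>lborel)
      + (\<integral>x. (G 1 2 x - G 2 1 x)\<^sup>2 \<partial>lborel)"
proof -
  let ?a = "inverse (\<integral>x. bump (\<lambda>_. 0) (Suc n) x \<partial>lborel) * Suc n"
  have G: "G i j x = ?a * conv (bump (unit_index i) (Suc n)) (f j) x" for i j x
    unfolding G_def dmoll_def[abs_def] conv_scale ..
  have s: "0 < real (Suc n)" by simp
  show ?thesis
    unfolding G distrib_left[symmetric] right_diff_distrib[symmetric] power_mult_distrib integral_mult_right_zero
      sum_distrib_left[symmetric] grad_div_curl_identity[OF s f] ..
qed

context bounded_open
begin

lemma integral_dom_le: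
  fixes H :: "real^3 \<Rightarrow> real"
  assumes "integrable lborel H" "\<And>x. 0 \<le> H x"
  shows "(\<integral>x. H x \<partial>lebesgue_on \<Omega>) \<le> (\<integral>x. H x \<partial>lborel)"
proof -
  have m: "H \<in> borel_measurable borel" using borel_measurable_integrable[OF assms(1)] by simp
  have "(\<integral>x. H x \<partial>lebesgue_on \<Omega>) = (\<integral>x. indicator \<Omega> x * H x \<partial>lebesgue_on \<Omega>)"
    by (intro Bochner_Integration.integral_cong) auto
  also have "\<dots> = (\<integral>x. indicator \<Omega> x * H x \<partial>lborel)"
    using m open_dom by (intro integral_dom) auto
  also have "\<dots> \<le> (\<integral>x. H x \<partial>lborel)"
    using assms integrable_mult_indicator[of \<Omega> lborel H] open_dom
    by (intro integral_mono) (auto split: split_indicator)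
  finally show ?thesis .
qed

lemma conv_Lp2:
  assumes "Cc k" "bsupp f" shows "conv k f \<in> Lp 2 \<Omega>"
proof -
  obtain B R where B: "\<And>x. \<bar>conv k f x\<bar> \<le> B" "\<And>x. R < norm x \<Longrightarrow> conv k f x = 0"
    "conv k f \<in> borel_measurable borel" using conv_bsupp[OF assms] by blast
  show ?thesis by (rule Lp2_bdd[OF borel_measurable_dom[OF B(3)], of B]) (use B(1) in simp)
qed

lemma smooth_weak_grad:
  assumes \<phi>: "Cc \<phi>" "\<And>x. \<phi> differentiable (at x)" "\<And>i. Cc (partial_deriv i \<phi>)"
  shows "is_weak_grad \<Omega> \<phi> (grad \<phi>)" "\<phi> \<in> H1 \<Omega>"
proof -
  have "(\<integral>x. \<phi> x * partial_deriv i \<psi> x \<partial>lebesgue_on \<Omega>) = - (\<integral>x. grad \<phi> x $ i * \<psi> x \<partial>lebesgue_on \<Omega>)"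
    if \<psi>: "\<psi> \<in> test_functions \<Omega>" for \<psi> i
  proof -
    note t = test_function_Cc[OF \<psi>]
    have "(\<integral>x. \<phi> x * partial_deriv i \<psi> x \<partial>lebesgue_on \<Omega>) = (\<integral>x. \<phi> x * partial_deriv i \<psi> x \<partial>lborel)"
      using Cc_measurable[OF \<phi>(1)] Cc_measurable[OF t(2)] t(5) by (intro integral_dom) auto
    also have "\<dots> = - (\<integral>x. partial_deriv i \<phi> x * \<psi> x \<partial>lborel)"
      by (intro integration_by_parts \<phi> t Cc_continuous)
    also have "(\<integral>x. partial_deriv i \<phi> x * \<psi> x \<partial>lborel) = (\<integral>x. partial_deriv i \<phi> x * \<psi> x \<partial>lebesgue_on \<Omega>)"
      using Cc_measurable[OF \<phi>(3)[of i]] Cc_measurable[OF t(1)] t(4) by (intro integral_dom(1)[symmetric]) auto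
    finally show ?thesis by (simp add: grad_def)
  qed
  moreover have "grad \<phi> \<in> Lp 2 \<Omega>" by (rule Lp2_vecI) (simp add: grad_def Cc_Lp2 \<phi>)
  ultimately show "is_weak_grad \<Omega> \<phi> (grad \<phi>)" by (simp add: is_weak_grad_def)
  then show "\<phi> \<in> H1 \<Omega>" using Cc_Lp2[OF \<phi>(1)] by (auto simp: H1_def)
qed

lemma zero_weak_grad: "is_weak_grad \<Omega> (\<lambda>x. 0) (\<lambda>x. 0)" "(\<lambda>x. 0) \<in> H1 \<Omega>"
proof -
  show "is_weak_grad \<Omega> (\<lambda>x. 0) (\<lambda>x. 0)" by (simp add: is_weak_grad_def Lp2_zero)
  then show "(\<lambda>x. 0) \<in> H1 \<Omega>" by (auto simp: H1_def Lp2_zero)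
qed

text \<open>No condition on x: a translated mollifier whose support crosses the boundary is not a
  test function, but it is still in H1(\<Omega>). This is why the vanishing traces, and not just the
  weak derivatives, are what it gets paired with.\<close>

lemma moll_weak_grad:
  "is_weak_grad \<Omega> (\<lambda>y. moll n (y - x)) (\<lambda>y. \<chi> i. dmoll n i (y - x))" "(\<lambda>y. moll n (y - x)) \<in> H1 \<Omega>"
proof -
  have c: "Cc (\<lambda>y. moll n (y - x))" "Cc (partial_deriv i (\<lambda>y. moll n (y - x)))" for i
    unfolding partial_deriv_moll by (intro Cc_translate moll_Cc dmoll_Cc)+
  have "grad (\<lambda>y. moll n (y - x)) = (\<lambda>y. \<chi> i. dmoll n i (y - x))"
    by (simp add: fun_eq_iff grad_def partial_deriv_moll)
  then show "is_weak_grad \<Omega> (\<lambda>y. moll n (y - x)) (\<lambda>y. \<chi> i. dmoll n i (y - x))"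
    using smooth_weak_grad(1)[OF c(1) moll_differentiable(1) c(2)] by simp
  show "(\<lambda>y. moll n (y - x)) \<in> H1 \<Omega>"
    by (rule smooth_weak_grad(2)[OF c(1) moll_differentiable(1) c(2)])
qed

text \<open>The adjoint formula moves the mollifier to the test function, one integration by parts
  is done there, and the adjoint formula moves it back. The minus sign arises because
  \<open>moll n (y - x)\<close> is differentiated in x.\<close>

lemma conv_moll_weak_grad:
  assumes f: "bsupp f"
  shows "is_weak_grad \<Omega> (conv (moll n) f) (\<lambda>x. \<chi> i. - conv (dmoll n i) f x)" "conv (moll n) f \<in> H1 \<Omega>"
proof -
  have fi: "integrable lborel f" using f by (simp add: bsupp_def)
  have "(\<integral>x. conv (moll n) f x * partial_deriv i \<psi> x \<partial>lebesgue_on \<Omega>)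
      = - (\<integral>x. (\<chi> i. - conv (dmoll n i) f x) $ i * \<psi> x \<partial>lebesgue_on \<Omega>)"
    if \<psi>: "\<psi> \<in> test_functions \<Omega>" for \<psi> i
  proof -
    note t = test_function_Cc[OF \<psi>]
    have "(\<integral>x. conv (moll n) f x * partial_deriv i \<psi> x \<partial>lebesgue_on \<Omega>)
        = (\<integral>x. conv (moll n) f x * partial_deriv i \<psi> x \<partial>lborel)"
      using conv_measurable[OF moll_Cc fi] Cc_measurable[OF t(2)] t(5) by (intro integral_dom) auto
    also have "\<dots> = (\<integral>y. f y * (\<integral>x. moll n (y - x) * partial_deriv i \<psi> x \<partial>lborel) \<partial>lborel)"
      by (rule conv_adjoint[OF moll_Cc fi Cc_integrable[OF t(2)]])
    also have "(\<lambda>y. \<integral>x. moll n (y - x) * partial_deriv i \<psi> x \<partial>lborel)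
        = (\<lambda>y. \<integral>x. dmoll n i (y - x) * \<psi> x \<partial>lborel)"
    proof
      fix y
      have c: "Cc (\<lambda>x. moll n (y - x))" "Cc (partial_deriv i (\<lambda>x. moll n (y - x)))"
        unfolding partial_deriv_moll by (intro Cc_reflect Cc_uminus moll_Cc dmoll_Cc)+
      have "(\<integral>x. moll n (y - x) * partial_deriv i \<psi> x \<partial>lborel)
          = - (\<integral>x. partial_deriv i (\<lambda>x. moll n (y - x)) x * \<psi> x \<partial>lborel)"
        by (intro integration_by_parts c t moll_differentiable Cc_continuous)
      then show "(\<integral>x. moll n (y - x) * partial_deriv i \<psi> x \<partial>lborel) = (\<integral>x. dmoll n i (y - x) * \<psi> x \<partial>lborel)"
        by (simp add: partial_deriv_moll)
    qed
    also have "(\<integral>y. f y * (\<integral>x. dmoll n i (y - x) * \<psi> x \<partial>lborel) \<partial>lborel)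
        = (\<integral>x. conv (dmoll n i) f x * \<psi> x \<partial>lborel)"
      by (rule conv_adjoint[OF dmoll_Cc fi Cc_integrable[OF t(1)], symmetric])
    also have "\<dots> = (\<integral>x. conv (dmoll n i) f x * \<psi> x \<partial>lebesgue_on \<Omega>)"
      using conv_measurable[OF dmoll_Cc fi] Cc_measurable[OF t(1)] t(4) by (intro integral_dom(1)[symmetric]) auto
    finally show ?thesis by simp
  qed
  moreover have "(\<lambda>x. - conv (dmoll n i) f x) \<in> Lp 2 \<Omega>" for i
    using Lp2_scaleR[OF conv_Lp2[OF dmoll_Cc f], of "-1" n i] by simp
  then have "(\<lambda>x. \<chi> i. - conv (dmoll n i) f x) \<in> Lp 2 \<Omega>" by (intro Lp2_vecI) simp
  ultimately show "is_weak_grad \<Omega> (conv (moll n) f) (\<lambda>x. \<chi> i. - conv (dmoll n i) f x)"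
    by (simp add: is_weak_grad_def)
  then show "conv (moll n) f \<in> H1 \<Omega>" using conv_Lp2[OF moll_Cc f] by (auto simp: H1_def)
qed

text \<open>The zero traces of \<open>v\<close> make mollification commute with div and curl up to the boundary.\<close>

lemma div_conv_moll:
  assumes v: "v \<in> V_space \<Omega>"
    and f: "\<And>j. borel_rep (\<lambda>x. v x $ j) (f j)" and D: "borel_rep (weak_div \<Omega> v) D"
  shows "conv (dmoll n 1) (f 1) x + conv (dmoll n 2) (f 2) x + conv (dmoll n 3) (f 3) x = - conv (moll n) D x"
proof -
  let ?\<phi> = "\<lambda>y. moll n (y - x)" and ?g = "\<lambda>y. \<chi> i. dmoll n i (y - x) :: real^3"
  note m = moll_weak_grad[of n x]
  have gL: "?g \<in> Lp 2 \<Omega>" using m(1) by (simp add: is_weak_grad_def)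
  have dc: "(\<lambda>y. dmoll n i (y - x)) \<in> borel_measurable borel" "(\<lambda>y. dmoll n i (y - x)) \<in> Lp 2 \<Omega>" for i
    using Cc_translate[OF dmoll_Cc] by (auto intro: Cc_measurable Cc_Lp2)
  have mc: "?\<phi> \<in> borel_measurable borel" using Cc_translate[OF moll_Cc] by (rule Cc_measurable)
  have "l2ip \<Omega> v (weak_grad \<Omega> ?\<phi>) = l2ip \<Omega> v ?g"
    using weak_grad_unique[OF weak_grad_is[OF m(2)] m(1)] V_Lp2[OF v] trace_spaces_Lp2(1)[OF m(2)] gL
    by (intro l2ip_cong) auto
  also have "\<dots> = (\<integral>y. v y $ 1 * dmoll n 1 (y - x) + v y $ 2 * dmoll n 2 (y - x) + v y $ 3 * dmoll n 3 (y - x) \<partial>lebesgue_on \<Omega>)"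
    by (simp add: l2ip_def inner_vec_def sum_3)
  also have "\<dots> = (\<integral>y. v y $ 1 * dmoll n 1 (y - x) \<partial>lebesgue_on \<Omega>)
      + (\<integral>y. v y $ 2 * dmoll n 2 (y - x) \<partial>lebesgue_on \<Omega>) + (\<integral>y. v y $ 3 * dmoll n 3 (y - x) \<partial>lebesgue_on \<Omega>)"
    using integrable_inner_L2[OF Lp2_nth[OF V_Lp2(1)[OF v]] dc(2)] by simp
  also have "\<dots> = conv (dmoll n 1) (f 1) x + conv (dmoll n 2) (f 2) x + conv (dmoll n 3) (f 3) x"
    using f dc(1) by (simp add: borel_rep_def conv_def)
  finally have "l2ip \<Omega> v (weak_grad \<Omega> ?\<phi>) = \<dots>" .
  moreover have "l2ip \<Omega> (weak_div \<Omega> v) ?\<phi> = conv (moll n) D x"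
    using D mc by (simp add: borel_rep_def conv_def l2ip_def)
  moreover have "l2ip \<Omega> v (weak_grad \<Omega> ?\<phi>) + l2ip \<Omega> (weak_div \<Omega> v) ?\<phi> = 0"
    using V_has_div_curl[OF v] m(2) by (simp add: has_div_curl_def)
  ultimately show ?thesis by simp
qed

text \<open>The vanishing tangential trace is tested with the mollifier placed in direction k. The
  signs look opposite to those of a curl because \<open>conv (dmoll n i)\<close> is minus the i-th
  derivative of the mollification.\<close>

lemma curl_conv_moll:
  assumes v: "v \<in> V_space \<Omega>"
    and f: "\<And>j. borel_rep (\<lambda>x. v x $ j) (f j)" and C: "\<And>k. borel_rep (\<lambda>x. weak_curl \<Omega> v x $ k) (c k)"
  shows "conv (dmoll n 3) (f 2) x - conv (dmoll n 2) (f 3) x = conv (moll n) (c 1) x"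
    "conv (dmoll n 1) (f 3) x - conv (dmoll n 3) (f 1) x = conv (moll n) (c 2) x"
    "conv (dmoll n 2) (f 1) x - conv (dmoll n 1) (f 2) x = conv (moll n) (c 3) x"
proof -
  let ?\<phi> = "\<lambda>y. moll n (y - x)" and ?g = "\<lambda>y. \<chi> i. dmoll n i (y - x) :: real^3"
  define \<Phi> where "\<Phi> k y = (axis k (?\<phi> y) :: real^3)" for k y
  define g where "g k i = (if i = k then ?g else (\<lambda>y. 0))" for k i :: 3
  note m = moll_weak_grad[of n x]
  have dc: "(\<lambda>y. dmoll n i (y - x)) \<in> borel_measurable borel" "(\<lambda>y. dmoll n i (y - x)) \<in> Lp 2 \<Omega>" for i
    using Cc_translate[OF dmoll_Cc] by (auto intro: Cc_measurable Cc_Lp2)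
  have mc: "?\<phi> \<in> borel_measurable borel" using Cc_translate[OF moll_Cc] by (rule Cc_measurable)
  have comp: "(\<lambda>y. \<Phi> k y $ i) = (if i = k then ?\<phi> else (\<lambda>y. 0))" for k i
    by (auto simp: \<Phi>_def axis_def)
  have H: "\<Phi> k \<in> H1_vec \<Omega>" for k using m(2) zero_weak_grad by (auto simp: H1_vec_def comp)
  have "(\<lambda>y. \<Phi> k y $ i) \<in> Lp 2 \<Omega>" "is_weak_grad \<Omega> (\<lambda>y. \<Phi> k y $ i) (g k i)" for k i
    using m zero_weak_grad unfolding comp g_def by (auto simp: H1_def)
  then have wc: "is_weak_curl \<Omega> (\<Phi> k) (curl_of (g k))" for k by (rule is_weak_curl_curl_of)
  have key: "l2ip \<Omega> v (curl_of (g k)) = conv (moll n) (c k) x" for k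
  proof -
    have "weak_curl \<Omega> (\<Phi> k) \<in> Lp 2 \<Omega>" "curl_of (g k) \<in> Lp 2 \<Omega>"
      using trace_spaces_Lp2(2)[OF H] wc[of k] by (auto simp: is_weak_curl_def)
    moreover have "AE y in lebesgue_on \<Omega>. weak_curl \<Omega> (\<Phi> k) y = curl_of (g k) y"
      using H1_vec_curl[OF H] weak_curl_is wc by (intro weak_curl_unique[of "\<Phi> k"]) auto
    ultimately have "l2ip \<Omega> v (weak_curl \<Omega> (\<Phi> k)) = l2ip \<Omega> v (curl_of (g k))"
      using V_Lp2[OF v] by (intro l2ip_cong) auto
    moreover have "l2ip \<Omega> (weak_curl \<Omega> v) (\<Phi> k) = conv (moll n) (c k) x"
      using C[of k] mc by (simp add: borel_rep_def conv_def l2ip_def \<Phi>_def inner_axis)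
    moreover have "l2ip \<Omega> (weak_curl \<Omega> v) (\<Phi> k) + - 1 * l2ip \<Omega> v (weak_curl \<Omega> (\<Phi> k)) = 0"
      using V_has_div_curl[OF v] H unfolding has_div_curl_def by blast
    ultimately show ?thesis by simp
  qed
  have int: "integrable (lebesgue_on \<Omega>) (\<lambda>y. v y $ j * dmoll n i (y - x))" for i j
    using integrable_inner_L2[OF Lp2_nth[OF V_Lp2(1)[OF v]] dc(2)] by simp
  have cv: "(\<integral>y. v y $ j * dmoll n i (y - x) \<partial>lebesgue_on \<Omega>) = conv (dmoll n i) (f j) x" for i j
    using f[of j] dc(1) by (simp add: borel_rep_def conv_def)
  have ne: "(1::3) \<noteq> 2" "(1::3) \<noteq> 3" "(2::3) \<noteq> 3" "(2::3) \<noteq> 1" "(3::3) \<noteq> 1" "(3::3) \<noteq> 2" by auto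
  have "l2ip \<Omega> v (curl_of (g 1)) = (\<integral>y. v y $ 2 * dmoll n 3 (y - x) - v y $ 3 * dmoll n 2 (y - x) \<partial>lebesgue_on \<Omega>)"
    by (simp add: l2ip_def inner_vec_def sum_3 curl_of_def g_def ne)
  then show "conv (dmoll n 3) (f 2) x - conv (dmoll n 2) (f 3) x = conv (moll n) (c 1) x"
    using key[of 1] int by (simp add: cv)
  have "l2ip \<Omega> v (curl_of (g 2)) = (\<integral>y. v y $ 3 * dmoll n 1 (y - x) - v y $ 1 * dmoll n 3 (y - x) \<partial>lebesgue_on \<Omega>)"
    by (simp add: l2ip_def inner_vec_def sum_3 curl_of_def g_def ne)
  then show "conv (dmoll n 1) (f 3) x - conv (dmoll n 3) (f 1) x = conv (moll n) (c 2) x"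
    using key[of 2] int by (simp add: cv)
  have "l2ip \<Omega> v (curl_of (g 3)) = (\<integral>y. v y $ 1 * dmoll n 2 (y - x) - v y $ 2 * dmoll n 1 (y - x) \<partial>lebesgue_on \<Omega>)"
    by (simp add: l2ip_def inner_vec_def sum_3 curl_of_def g_def ne)
  then show "conv (dmoll n 2) (f 1) x - conv (dmoll n 1) (f 2) x = conv (moll n) (c 3) x"
    using key[of 3] int by (simp add: cv)
qed

text \<open>The norm over \<Omega> is enlarged to integrals over the whole space, the only place
  where the gradient identity is available. Mollification does not increase the L2 part.\<close>

lemma H1_norm_conv_moll:
  assumes f: "bsupp f" "bsupp (\<lambda>x. (f x)\<^sup>2)"
  shows "(H1_norm \<Omega> (conv (moll n) f))\<^sup>2
    \<le> (\<integral>x. (f x)\<^sup>2 \<partial>lborel) + (\<Sum>i\<in>UNIV. \<integral>x. (conv (dmoll n i) f x)\<^sup>2 \<partial>lborel)"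
proof -
  let ?w = "conv (moll n) f" and ?g = "\<lambda>x. \<chi> i. - conv (dmoll n i) f x :: real^3"
  note m = conv_moll_weak_grad[OF f(1), of n]
  have sqi: "integrable lborel (\<lambda>x. (conv k f x)\<^sup>2)" if "Cc k" for k
    using conv_mult_integrable[OF that f(1) that f(1)] by (simp add: power2_eq_square)
  have "l2ip \<Omega> ?w ?w \<le> (\<integral>x. (?w x)\<^sup>2 \<partial>lborel)"
    using integral_dom_le[OF sqi[OF moll_Cc]] by (simp add: l2ip_self)
  also have "\<dots> \<le> (\<integral>x. (f x)\<^sup>2 \<partial>lborel)" by (intro conv_square_le moll_Cc moll_nonneg moll_integral f)
  finally have 1: "l2ip \<Omega> ?w ?w \<le> (\<integral>x. (f x)\<^sup>2 \<partial>lborel)" .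
  have "l2ip \<Omega> (weak_grad \<Omega> ?w) (weak_grad \<Omega> ?w) = l2ip \<Omega> ?g ?g"
    using weak_grad_unique[OF weak_grad_is[OF m(2)] m(1)] trace_spaces_Lp2(1)[OF m(2)] m(1)
    by (intro l2ip_cong) (auto simp: is_weak_grad_def)
  also have "\<dots> = (\<Sum>i\<in>UNIV. \<integral>x. (conv (dmoll n i) f x)\<^sup>2 \<partial>lebesgue_on \<Omega>)"
  proof -
    have i: "integrable (lebesgue_on \<Omega>) (\<lambda>x. (conv (dmoll n i) f x)\<^sup>2)" for i
      using conv_Lp2[OF dmoll_Cc f(1)] by (simp add: Lp_def)
    have "l2ip \<Omega> ?g ?g = (\<integral>x. (\<Sum>i\<in>UNIV. (conv (dmoll n i) f x)\<^sup>2) \<partial>lebesgue_on \<Omega>)"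
      by (simp add: l2ip_def inner_vec_def power2_eq_square)
    then show ?thesis using i by simp
  qed
  also have "\<dots> \<le> (\<Sum>i\<in>UNIV. \<integral>x. (conv (dmoll n i) f x)\<^sup>2 \<partial>lborel)"
    by (intro sum_mono integral_dom_le sqi dmoll_Cc) auto
  finally have "l2ip \<Omega> (weak_grad \<Omega> ?w) (weak_grad \<Omega> ?w) \<le> \<dots>" .
  moreover have "(H1_norm \<Omega> ?w)\<^sup>2 = l2ip \<Omega> ?w ?w + l2ip \<Omega> (weak_grad \<Omega> ?w) (weak_grad \<Omega> ?w)"
    by (simp add: H1_norm_def Lp_norm_2_sq l2ip_self)
  ultimately show ?thesis using 1 by simp
qed

lemma Lp_norm_triangle:
  fixes u v :: "real^3 \<Rightarrow> 'b::euclidean_space"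
  assumes "u \<in> Lp 2 \<Omega>" "v \<in> Lp 2 \<Omega>"
  shows "Lp_norm 2 \<Omega> (\<lambda>x. u x + v x) \<le> Lp_norm 2 \<Omega> u + Lp_norm 2 \<Omega> v"
  using semi_hilbert.nrm_axpy_le[OF semi_hilbert_L2 assms, of 1]
  by (simp add: semi_hilbert.nrm_def[OF semi_hilbert_L2] fun_axpy_def Lp_norm_2)

lemma V_norm_sq: "(V_norm \<Omega> v)\<^sup>2 = V_ip v v"
  by (simp add: V_norm_eq V_ip_def l2ip_self)

text \<open>The constant \<open>C\<close> is not enlarged by passing to vectors. The L2 norm of the
  sum of the squared components is at most the sum of their L2 norms, each at most C^2 times a
  squared H1 norm; the squared H1 norms add up to at most the squared norm of V. Fatou's lemma
  removes the mollification.\<close>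

theorem V_embeds_L4:
  assumes CS: "0 < C" "\<forall>w\<in>H1 \<Omega>. w \<in> Lp 4 \<Omega> \<and> Lp_norm 4 \<Omega> w \<le> C * H1_norm \<Omega> w"
    and v: "v \<in> V_space \<Omega>"
  shows "v \<in> Lp 4 \<Omega>" "(\<integral>x. norm (v x) ^ 4 \<partial>lebesgue_on \<Omega>) \<le> (C * V_norm \<Omega> v) ^ 4"
proof -
  note L = V_Lp2[OF v]
  have "\<exists>f. borel_rep (\<lambda>x. v x $ j) f" for j by (rule borel_representative[OF Lp2_nth[OF L(1)]]) blast
  then obtain f where f: "\<And>j. borel_rep (\<lambda>x. v x $ j) (f j)" by metis
  obtain D where D: "borel_rep (weak_div \<Omega> v) D" by (rule borel_representative[OF L(2)])
  have "\<exists>f. borel_rep (\<lambda>x. weak_curl \<Omega> v x $ k) f" for k by (rule borel_representative[OF Lp2_nth[OF L(3)]]) blast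
  then obtain c where c: "\<And>k. borel_rep (\<lambda>x. weak_curl \<Omega> v x $ k) (c k)" by metis
  have bf: "bsupp (f j)" "bsupp (\<lambda>x. (f j x)\<^sup>2)" for j using f[of j] by (auto simp: borel_rep_def)
  have bD: "bsupp D" "bsupp (\<lambda>x. (D x)\<^sup>2)" using D by (auto simp: borel_rep_def)
  have bc: "bsupp (c j)" "bsupp (\<lambda>x. (c j x)\<^sup>2)" for j using c[of j] by (auto simp: borel_rep_def)
  have comp: "l2ip \<Omega> w w = (\<Sum>j\<in>UNIV. l2ip \<Omega> (\<lambda>x. w x $ j) (\<lambda>x. w x $ j))"
    if "w \<in> Lp 2 \<Omega>" for w :: "real^3 \<Rightarrow> real^3"
    using integrable_inner_L2[OF Lp2_nth[OF that] Lp2_nth[OF that]] by (simp add: l2ip_def inner_vec_def)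
  define w where "w n j = conv (moll n) (f j)" for n j
  have wH: "w n j \<in> H1 \<Omega>" for n j unfolding w_def by (rule conv_moll_weak_grad(2)[OF bf(1)])
  have H1: "(\<Sum>j\<in>UNIV. (H1_norm \<Omega> (w n j))\<^sup>2) \<le> (V_norm \<Omega> v)\<^sup>2" for n
  proof -
    let ?G = "\<lambda>i j. conv (dmoll n i) (f j)"
    have cs: "(\<integral>x. (conv (moll n) g x)\<^sup>2 \<partial>lborel) \<le> (\<integral>x. (g x)\<^sup>2 \<partial>lborel)"
      if "bsupp g" "bsupp (\<lambda>x. (g x)\<^sup>2)" for g
      by (intro conv_square_le moll_Cc moll_nonneg moll_integral that)
    have "(\<Sum>j\<in>UNIV. (H1_norm \<Omega> (w n j))\<^sup>2)
        \<le> (\<Sum>j\<in>UNIV. (\<integral>x. (f j x)\<^sup>2 \<partial>lborel) + (\<Sum>i\<in>UNIV. \<integral>x. (?G i j x)\<^sup>2 \<partial>lborel))"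
      unfolding w_def by (intro sum_mono H1_norm_conv_moll bf)
    also have "\<dots> = (\<Sum>j\<in>UNIV. \<integral>x. (f j x)\<^sup>2 \<partial>lborel) + (\<Sum>j\<in>UNIV. \<Sum>i\<in>UNIV. \<integral>x. (?G i j x)\<^sup>2 \<partial>lborel)"
      by (rule sum.distrib)
    also have "(\<Sum>j\<in>UNIV. \<Sum>i\<in>UNIV. \<integral>x. (?G i j x)\<^sup>2 \<partial>lborel)
        = (\<integral>x. (conv (moll n) D x)\<^sup>2 \<partial>lborel) + (\<integral>x. (conv (moll n) (c 1) x)\<^sup>2 \<partial>lborel)
          + (\<integral>x. (conv (moll n) (c 2) x)\<^sup>2 \<partial>lborel) + (\<integral>x. (conv (moll n) (c 3) x)\<^sup>2 \<partial>lborel)"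
      unfolding grad_div_curl_moll[OF bf(1)] div_conv_moll[OF v f D] curl_conv_moll[OF v f c, symmetric]
      by (simp add: power2_commute)
    also have "\<dots> \<le> (\<integral>x. (D x)\<^sup>2 \<partial>lborel) + (\<integral>x. (c 1 x)\<^sup>2 \<partial>lborel)
          + (\<integral>x. (c 2 x)\<^sup>2 \<partial>lborel) + (\<integral>x. (c 3 x)\<^sup>2 \<partial>lborel)"
      by (intro add_mono cs bD bc)
    also have "(\<Sum>j\<in>UNIV. \<integral>x. (f j x)\<^sup>2 \<partial>lborel) + \<dots> = (V_norm \<Omega> v)\<^sup>2"
      using f c D L by (simp add: V_norm_sq V_ip_def comp borel_rep_def sum_3)
    finally show ?thesis by simp
  qed
  have w4: "w n j \<in> Lp 4 \<Omega>" for n j using CS wH by blast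
  have wm: "w n j \<in> borel_measurable (lebesgue_on \<Omega>)" for n j using w4 by (simp add: Lp_def)
  define q where "q n j x = (w n j x)\<^sup>2" for n j x
  have qL: "q n j \<in> Lp 2 \<Omega>" for n j
    using w4[of n j] wm[of n j] by (simp add: Lp_def q_def[abs_def] power_mult[symmetric])
  have qn: "Lp_norm 2 \<Omega> (q n j) \<le> C\<^sup>2 * (H1_norm \<Omega> (w n j))\<^sup>2" for n j
  proof -
    let ?I = "\<integral>x. norm (w n j x) ^ 4 \<partial>lebesgue_on \<Omega>"
    have "0 \<le> Lp_norm 4 \<Omega> (w n j)" by (simp add: Lp_norm_def)
    have "(Lp_norm 2 \<Omega> (q n j))\<^sup>2 = ?I"
      by (simp add: Lp_norm_2_sq l2ip_self q_def power_mult[symmetric] del: power_abs)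
    also have "\<dots> = (Lp_norm 4 \<Omega> (w n j)) ^ 4" by (simp add: Lp_norm_def)
    also have "\<dots> \<le> (C * H1_norm \<Omega> (w n j)) ^ 4"
      using CS wH by (intro power_mono) (auto simp: Lp_norm_def)
    also have "\<dots> = (C\<^sup>2 * (H1_norm \<Omega> (w n j))\<^sup>2)\<^sup>2"
      by (simp add: power_mult_distrib power_mult[symmetric])
    finally show ?thesis by (rule power2_le_imp_le) simp
  qed
  have sq: "(\<Sum>j\<in>UNIV. q n j x) = q n 1 x + q n 2 x + q n 3 x" for n x by (simp add: sum_3)
  have sL: "(\<lambda>x. \<Sum>j\<in>UNIV. q n j x) \<in> Lp 2 \<Omega>" for n unfolding sq by (intro Lp2_add qL)
  have bound: "(\<integral>x. (\<Sum>j\<in>UNIV. q n j x)\<^sup>2 \<partial>lebesgue_on \<Omega>) \<le> (C * V_norm \<Omega> v) ^ 4" for n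
  proof -
    have "Lp_norm 2 \<Omega> (\<lambda>x. \<Sum>j\<in>UNIV. q n j x) \<le> Lp_norm 2 \<Omega> (q n 1) + Lp_norm 2 \<Omega> (q n 2) + Lp_norm 2 \<Omega> (q n 3)"
      unfolding sq using Lp_norm_triangle[OF Lp2_add[OF qL qL] qL, of n 1 n 2 n 3] Lp_norm_triangle[OF qL qL, of n 1 n 2] by simp
    also have "\<dots> \<le> C\<^sup>2 * (\<Sum>j\<in>UNIV. (H1_norm \<Omega> (w n j))\<^sup>2)"
      unfolding sum_3 distrib_left by (intro add_mono qn)
    also have "\<dots> \<le> C\<^sup>2 * (V_norm \<Omega> v)\<^sup>2" by (intro mult_left_mono H1) simp
    finally have "(Lp_norm 2 \<Omega> (\<lambda>x. \<Sum>j\<in>UNIV. q n j x))\<^sup>2 \<le> (C\<^sup>2 * (V_norm \<Omega> v)\<^sup>2)\<^sup>2"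
      by (intro power_mono) auto
    then show ?thesis
      by (simp add: Lp_norm_2_sq l2ip_self power_mult_distrib power_mult[symmetric])
  qed
  \<comment> \<open>The three component errors form one vector field, so a single subsequence
    converges almost everywhere for all of them.\<close>
  define u :: "nat \<Rightarrow> real^3 \<Rightarrow> real^3" where "u n x = (\<chi> j. conv (moll n) (f j) x - f j x)" for n x
  have fi: "integrable lborel (f j)" and ci: "integrable lborel (conv (moll n) (f j))" for j n
    using bf conv_integrable[OF moll_Cc] by (auto simp: bsupp_def)
  have um: "u n \<in> borel_measurable lborel" for n
  proof -
    have "(\<lambda>x. u n x $ j) \<in> borel_measurable lborel" for j
      unfolding u_def using fi[of j] ci[of n j] by auto
    then have "(\<lambda>x. u n x \<bullet> i) \<in> borel_measurable lborel" if "i \<in> Basis" for i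
      using that by (auto simp: Basis_vec_def inner_axis)
    then show ?thesis by (subst borel_measurable_euclidean_space) auto
  qed
  have ule: "norm (u n x) \<le> (\<Sum>j\<in>UNIV. \<bar>conv (moll n) (f j) x - f j x\<bar>)" for n x
    using norm_le_l1_cart[of "u n x"] by (simp add: u_def)
  have si: "integrable lborel (\<lambda>x. \<Sum>j\<in>UNIV. \<bar>conv (moll n) (f j) x - f j x\<bar>)" for n
    using fi ci by (intro Bochner_Integration.integrable_sum integrable_abs Bochner_Integration.integrable_diff)
  have ui: "integrable lborel (u n)" for n
    by (rule Bochner_Integration.integrable_bound[OF si um]) (use ule in \<open>auto intro: order_trans\<close>)
  have ulim: "(\<lambda>n. \<integral>x. norm (u n x) \<partial>lborel) \<longlonglongrightarrow> 0"
  proof (rule tendsto_sandwich[OF _ _ tendsto_const])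
    have "(\<lambda>n. \<Sum>j\<in>UNIV. \<integral>x. \<bar>conv (moll n) (f j) x - f j x\<bar> \<partial>lborel) \<longlonglongrightarrow> (\<Sum>j\<in>(UNIV :: 3 set). 0)"
      by (intro tendsto_sum moll_conv_L1 bf)
    then show "(\<lambda>n. \<Sum>j\<in>UNIV. \<integral>x. \<bar>conv (moll n) (f j) x - f j x\<bar> \<partial>lborel) \<longlonglongrightarrow> 0"
      by simp
    have "(\<integral>x. norm (u n x) \<partial>lborel) \<le> (\<Sum>j\<in>UNIV. \<integral>x. \<bar>conv (moll n) (f j) x - f j x\<bar> \<partial>lborel)" for n
    proof -
      have "(\<integral>x. norm (u n x) \<partial>lborel) \<le> (\<integral>x. (\<Sum>j\<in>UNIV. \<bar>conv (moll n) (f j) x - f j x\<bar>) \<partial>lborel)"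
        by (intro integral_mono integrable_norm ui si ule)
      then show ?thesis using fi ci by simp
    qed
    then show "\<forall>\<^sub>F n in sequentially. (\<integral>x. norm (u n x) \<partial>lborel)
        \<le> (\<Sum>j\<in>UNIV. \<integral>x. \<bar>conv (moll n) (f j) x - f j x\<bar> \<partial>lborel)" by simp
  qed simp
  obtain r :: "nat \<Rightarrow> nat" where r: "AE x in lborel. (\<lambda>n. u (r n) x) \<longlonglongrightarrow> 0"
    using tendsto_L1_AE_subseq[OF ui ulim] by blast
  have vf: "AE x in lebesgue_on \<Omega>. \<forall>j. v x $ j = f j x"
    using f by (simp add: AE_all_countable borel_rep_def)
  have vm: "v \<in> borel_measurable (lebesgue_on \<Omega>)" using L(1) by (simp add: Lp_def)
  have "integrable (lebesgue_on \<Omega>) (\<lambda>x. norm (v x) ^ 4)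
      \<and> (\<integral>x. norm (v x) ^ 4 \<partial>lebesgue_on \<Omega>) \<le> (C * V_norm \<Omega> v) ^ 4"
  proof (rule fatou_integral[where f="\<lambda>n x. (\<Sum>j\<in>UNIV. q (r n) j x)\<^sup>2"])
    show "integrable (lebesgue_on \<Omega>) (\<lambda>x. (\<Sum>j\<in>UNIV. q (r n) j x)\<^sup>2)" for n
      using sL[of "r n"] by (simp add: Lp_def)
    show "AE x in lebesgue_on \<Omega>. (\<lambda>n. (\<Sum>j\<in>UNIV. q (r n) j x)\<^sup>2) \<longlonglongrightarrow> norm (v x) ^ 4"
      using vf AE_dom[OF r]
    proof eventually_elim
      case (elim x)
      have "(\<lambda>n. w (r n) j x) \<longlonglongrightarrow> f j x" for j
      proof -
        have "(\<lambda>n. u (r n) x $ j + f j x) \<longlonglongrightarrow> 0 $ j + f j x"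
          by (intro tendsto_intros elim)
        then show ?thesis by (simp add: u_def w_def)
      qed
      then have "(\<lambda>n. (\<Sum>j\<in>UNIV. q (r n) j x)\<^sup>2) \<longlonglongrightarrow> (\<Sum>j\<in>UNIV. (f j x)\<^sup>2)\<^sup>2"
        unfolding q_def by (intro tendsto_intros)
      also have "(\<Sum>j\<in>UNIV. (f j x)\<^sup>2) = (norm (v x))\<^sup>2"
        unfolding power2_norm_eq_inner inner_vec_def using elim(1) by (simp add: power2_eq_square)
      finally show ?case by (simp add: power_mult[symmetric])
    qed
    show "(\<lambda>x. norm (v x) ^ 4) \<in> borel_measurable (lebesgue_on \<Omega>)" using vm by measurable
  qed (use bound in auto)
  then show "v \<in> Lp 4 \<Omega>" "(\<integral>x. norm (v x) ^ 4 \<partial>lebesgue_on \<Omega>) \<le> (C * V_norm \<Omega> v) ^ 4"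
    using vm by (auto simp: Lp_def)
qed

end

section \<open>The linearised problem\<close>

context bounded_open
begin

text \<open>\<open>has_div_curl\<close> sees its field only through L2 pairings, so the divergence
  and curl of u serve for u' as well; uniqueness does the rest.\<close>

lemma V_ae_eq:
  assumes u: "u \<in> V_space \<Omega>" and u': "u' \<in> V_space \<Omega>" and e: "AE x in lebesgue_on \<Omega>. u x = u' x"
  shows "AE x in lebesgue_on \<Omega>. weak_div \<Omega> u x = weak_div \<Omega> u' x"
    "AE x in lebesgue_on \<Omega>. weak_curl \<Omega> u x = weak_curl \<Omega> u' x"
proof -
  have eq: "l2ip \<Omega> u a = l2ip \<Omega> u' a" if "a \<in> Lp 2 \<Omega>" for a
    using e V_Lp2[OF u] V_Lp2[OF u'] that by (intro l2ip_cong) auto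
  have "has_div_curl u' (weak_div \<Omega> u) (weak_curl \<Omega> u)"
    using V_has_div_curl[OF u] V_Lp2[OF u']
    by (auto simp: has_div_curl_def eq[symmetric] test_function_grad_Lp2 test_function_curl_Lp2 trace_spaces_Lp2)
  from has_div_curl_imp_V(2,3)[OF this]
  show "AE x in lebesgue_on \<Omega>. weak_div \<Omega> u x = weak_div \<Omega> u' x"
    "AE x in lebesgue_on \<Omega>. weak_curl \<Omega> u x = weak_curl \<Omega> u' x"
    by (auto elim: eventually_mono)
qed

lemma V_dst: "semi_hilbert.dst fun_axpy V_ip u v = V_norm \<Omega> (fun_axpy (-1) v u)"
  by (simp add: semi_hilbert.dst_def[OF semi_hilbert_V] semi_hilbert.nrm_def[OF semi_hilbert_V] V_norm_eq)

lemma V_diff_norm_eq_0: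
  assumes "u \<in> V_space \<Omega>" "v \<in> V_space \<Omega>"
  shows "V_norm \<Omega> (fun_axpy (-1) v u) = 0 \<longleftrightarrow> (AE x in lebesgue_on \<Omega>. u x = v x)"
proof
  assume "V_norm \<Omega> (fun_axpy (-1) v u) = 0"
  then have "Lp_norm 2 \<Omega> (\<lambda>x. u x - v x) = 0"
    using V_norm_diff_sq[OF assms] by (simp add: add_nonneg_eq_0_iff)
  then have "l2ip \<Omega> (\<lambda>x. u x - v x) (\<lambda>x. u x - v x) = 0" by (simp add: Lp_norm_2)
  then show "AE x in lebesgue_on \<Omega>. u x = v x"
    using l2ip_self_eq_0_iff[OF Lp2_diff[OF V_Lp2(1)[OF assms(1)] V_Lp2(1)[OF assms(2)]]] by simp
next
  assume e: "AE x in lebesgue_on \<Omega>. u x = v x"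
  note L = V_Lp2[OF assms(1)] V_Lp2[OF assms(2)]
  have "l2ip \<Omega> (\<lambda>x. u x - v x) (\<lambda>x. u x - v x) = 0"
    "l2ip \<Omega> (\<lambda>x. weak_div \<Omega> u x - weak_div \<Omega> v x) (\<lambda>x. weak_div \<Omega> u x - weak_div \<Omega> v x) = 0"
    "l2ip \<Omega> (\<lambda>x. weak_curl \<Omega> u x - weak_curl \<Omega> v x) (\<lambda>x. weak_curl \<Omega> u x - weak_curl \<Omega> v x) = 0"
    using e V_ae_eq[OF assms e] by (auto simp: l2ip_self_eq_0_iff Lp2_diff L)
  then have "(V_norm \<Omega> (fun_axpy (-1) v u))\<^sup>2 = 0"
    unfolding V_norm_diff_sq[OF assms] Lp_norm_2_sq by simp
  then show "V_norm \<Omega> (fun_axpy (-1) v u) = 0" by simp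
qed

section \<open>Pressures of mean zero\<close>

lemma L20_Lp2: "q \<in> L20 \<Omega> \<Longrightarrow> q \<in> Lp 2 \<Omega>"
  by (simp add: L20_def)

lemma L20_iff: "q \<in> L20 \<Omega> \<longleftrightarrow> q \<in> Lp 2 \<Omega> \<and> l2ip \<Omega> q (\<lambda>x. 1) = 0"
  by (simp add: L20_def l2ip_def)

lemma semi_hilbert_L20: "semi_hilbert (L20 \<Omega>) fun_axpy (l2ip \<Omega>)"
proof (rule semi_hilbert.closed_subspace[OF semi_hilbert_L2])
  show "L20 \<Omega> \<noteq> {}" using Lp2_zero by (auto simp: L20_def intro!: exI[of _ "\<lambda>x. 0"])
  show "L20 \<Omega> \<subseteq> Lp 2 \<Omega>" by (auto simp: L20_def)
  show "fun_axpy a x y \<in> L20 \<Omega>" if "x \<in> L20 \<Omega>" "y \<in> L20 \<Omega>" for a x y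
    using that Lp2_scaleR_add[of x \<Omega> y a] by (simp add: L20_iff l2ip_axpy Lp2_const) (simp add: fun_axpy_def)
  fix X and x :: "real^3 \<Rightarrow> real"
  assume X: "\<And>n. X n \<in> L20 \<Omega>" and x: "x \<in> Lp 2 \<Omega>"
    and lim: "(\<lambda>n. semi_hilbert.dst fun_axpy (l2ip \<Omega>) (X n) x) \<longlonglongrightarrow> 0"
  have "(\<lambda>n. l2ip \<Omega> (X n) (\<lambda>x. 1)) \<longlonglongrightarrow> l2ip \<Omega> x (\<lambda>x. 1)"
    using X by (intro semi_hilbert.ip_tendsto[OF semi_hilbert_L2] x lim Lp2_const) (simp add: L20_def)
  then show "x \<in> L20 \<Omega>" using X x by (simp add: L20_iff LIMSEQ_const_iff)
qed

lemma weak_div_L20: "v \<in> V_space \<Omega> \<Longrightarrow> weak_div \<Omega> v \<in> L20 \<Omega>"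
  using V_Lp2(2) integral_weak_div_zero by (simp add: L20_def)

lemma l2ip_axpy_right:
  "u \<in> Lp 2 \<Omega> \<Longrightarrow> v \<in> Lp 2 \<Omega> \<Longrightarrow> w \<in> Lp 2 \<Omega> \<Longrightarrow>
    l2ip \<Omega> w (fun_axpy a u v) = a * l2ip \<Omega> w u + l2ip \<Omega> w v"
  using l2ip_axpy[of u \<Omega> v w a] by (simp add: l2ip_commute[of _ w])

lemma Lp_norm_mono:
  fixes u :: "real^3 \<Rightarrow> 'b::euclidean_space" and v :: "real^3 \<Rightarrow> 'c::euclidean_space"
  assumes v: "v \<in> Lp 2 \<Omega>" and u: "u \<in> borel_measurable (lebesgue_on \<Omega>)" and le: "\<And>x. norm (u x) \<le> norm (v x)"
  shows "u \<in> Lp 2 \<Omega>" "Lp_norm 2 \<Omega> u \<le> Lp_norm 2 \<Omega> v"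
proof -
  show uL: "u \<in> Lp 2 \<Omega>" by (rule Lp2_bounded[OF v u, where C=1]) (use le in simp)
  have "l2ip \<Omega> u u \<le> l2ip \<Omega> v v"
    unfolding l2ip_self using uL v le by (intro integral_mono) (auto simp: Lp_def intro!: power_mono)
  then show "Lp_norm 2 \<Omega> u \<le> Lp_norm 2 \<Omega> v" by (simp add: Lp_norm_2)
qed

end

lemma norm_cross_le: "norm (cross3 a b) \<le> norm a * norm b"
proof (rule power2_le_imp_le)
  show "(norm (cross3 a b))\<^sup>2 \<le> (norm a * norm b)\<^sup>2"
    using norm_cross_dot[of a b] by (simp add: power_mult_distrib) (smt (verit) zero_le_power2)
qed simp

lemma cross_triple_cyclic: "cross3 a b \<bullet> c = b \<bullet> cross3 c a"
  by (simp add: cross3_simps)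

text \<open>The inf-sup condition is phrased through upper bounds M rather than a supremum. It is
  applied in this form, with M read off from an equation for the pressure, and no real supremum has
  to be shown bounded.\<close>

locale cbf = bounded_open +
  fixes \<nu> F \<kappa>min \<kappa>max C \<beta> :: real and \<kappa> :: "real^3 \<Rightarrow> real"
  assumes nonempty_dom: "\<Omega> \<noteq> {}"
    and pos: "0 < \<nu>" "0 < F"
    and kappa: "\<kappa> \<in> borel_measurable (lebesgue_on \<Omega>)" "0 < \<kappa>min"
      "AE x in lebesgue_on \<Omega>. \<kappa>min \<le> \<kappa> x \<and> \<kappa> x \<le> \<kappa>max"
    and sobolev: "0 < C" "\<forall>w\<in>H1 \<Omega>. w \<in> Lp 4 \<Omega> \<and> Lp_norm 4 \<Omega> w \<le> C * H1_norm \<Omega> w"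
    and beta_pos: "0 < \<beta>"
    and inf_sup: "\<And>q M. q \<in> L20 \<Omega> \<Longrightarrow> 0 \<le> M \<Longrightarrow>
      (\<And>v. v \<in> V_space \<Omega> \<Longrightarrow> - l2ip \<Omega> q (weak_div \<Omega> v) \<le> M * V_norm \<Omega> v) \<Longrightarrow> \<beta> * Lp_norm 2 \<Omega> q \<le> M"
begin

text \<open>A nonempty open set has positive measure. This extracts
  \<open>\<kappa>min \<le> \<kappa>max\<close> from bounds that hold only almost everywhere.\<close>

lemma AE_const_iff: "(AE x in lebesgue_on \<Omega>. P) \<longleftrightarrow> P"
proof -
  have "\<not> negligible \<Omega>" using open_not_negligible[OF open_dom nonempty_dom] .
  then have "emeasure lebesgue \<Omega> \<noteq> 0" using open_dom by (auto simp: negligible_iff_null_sets null_sets_def)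
  then have "emeasure (lebesgue_on \<Omega>) (space (lebesgue_on \<Omega>)) \<noteq> 0"
    using emeasure_restrict_space[of \<Omega> lebesgue \<Omega>] open_dom by simp
  then have "ae_filter (lebesgue_on \<Omega>) \<noteq> bot" by (simp add: trivial_limit_def[symmetric] ae_filter_eq_bot_iff)
  then show ?thesis by (simp add: eventually_const)
qed

lemma kappa_order: "\<kappa>min \<le> \<kappa>max" "0 < \<kappa>max"
proof -
  have "AE x in lebesgue_on \<Omega>. \<kappa>min \<le> \<kappa>max" using kappa(3) by eventually_elim simp
  then show "\<kappa>min \<le> \<kappa>max" by (simp add: AE_const_iff)
  then show "0 < \<kappa>max" using kappa(2) by simp
qed

text \<open>Tested with a coordinate function minus its mean, which is not a.e. zero.\<close>

lemma beta_le_1: "\<beta> \<le> 1"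
proof -
  let ?m = "measure (lebesgue_on \<Omega>) \<Omega>"
  have cL: "(\<lambda>x. x $ 1) \<in> Lp 2 \<Omega>"
  proof -
    obtain R where "\<And>x. x \<in> \<Omega> \<Longrightarrow> norm x \<le> R" using bounded_dom bounded_iff by metis
    then have "\<And>x. x \<in> \<Omega> \<Longrightarrow> norm (x $ 1) \<le> R" using component_le_norm_cart order_trans by (metis real_norm_def)
    moreover have "(\<lambda>x::real^3. x $ 1) \<in> borel_measurable (lebesgue_on \<Omega>)"
      by (intro borel_measurable_dom borel_measurable_continuous_onI continuous_intros)
    ultimately show ?thesis by (intro Lp2_bdd) auto
  qed
  define a where "a = (\<integral>x. x $ 1 \<partial>lebesgue_on \<Omega>) / ?m"
  define q where "q x = x $ 1 - a" for x :: "real^3"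
  have m: "?m \<noteq> 0"
  proof
    assume "?m = 0"
    then have "emeasure (lebesgue_on \<Omega>) \<Omega> = 0" using emeasure_eq_measure by simp
    then have "\<Omega> \<in> null_sets (lebesgue_on \<Omega>)" by (auto simp: null_sets_def intro: sets.top[of "lebesgue_on \<Omega>", simplified])
    then have "AE x in lebesgue_on \<Omega>. False" by (rule AE_I'[where N=\<Omega>]) auto
    then show False by (simp add: AE_const_iff)
  qed
  have qL: "q \<in> Lp 2 \<Omega>" unfolding q_def[abs_def] by (intro Lp2_diff cL Lp2_const)
  have "(\<integral>x. q x \<partial>lebesgue_on \<Omega>) = (\<integral>x. x $ 1 \<partial>lebesgue_on \<Omega>) - a * ?m"
    unfolding q_def using integrable_L2[OF cL] integrable_L2[OF Lp2_const[of a]] by simp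
  then have q0: "q \<in> L20 \<Omega>" using m qL by (simp add: L20_def a_def)
  have "Lp_norm 2 \<Omega> q \<noteq> 0"
  proof
    assume "Lp_norm 2 \<Omega> q = 0"
    then have z: "AE x in lebesgue_on \<Omega>. q x = 0" using l2ip_self_eq_0_iff[OF qL] by (simp add: Lp_norm_2)
    have "axis 1 1 \<in> (Basis :: (real^3) set)" by (simp add: axis_in_Basis_iff)
    then have "negligible {x :: real^3. x \<bullet> axis 1 1 = a}" by (rule negligible_standard_hyperplane)
    then have "AE x in lebesgue. x \<notin> {x :: real^3. x \<bullet> axis 1 1 = a}"
      by (intro AE_not_in) (simp add: negligible_iff_null_sets)
    then have "AE x in lebesgue_on \<Omega>. x $ 1 \<noteq> a"
      unfolding AE_restrict_space_iff[OF sets_dom] by eventually_elim (simp add: inner_axis)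
    then have "AE x in lebesgue_on \<Omega>. False" using z by eventually_elim (simp add: q_def)
    then show False by (simp add: AE_const_iff)
  qed
  then have p: "0 < Lp_norm 2 \<Omega> q" using Lp_norm_nonneg[of \<Omega> q] by linarith
  have "\<beta> * Lp_norm 2 \<Omega> q \<le> Lp_norm 2 \<Omega> q"
  proof (rule inf_sup[OF q0])
    fix v assume v: "v \<in> V_space \<Omega>"
    have "- l2ip \<Omega> q (weak_div \<Omega> v) \<le> Lp_norm 2 \<Omega> q * Lp_norm 2 \<Omega> (weak_div \<Omega> v)"
      using l2_cauchy_schwarz[OF qL V_Lp2(2)[OF v]] by simp
    also have "\<dots> \<le> Lp_norm 2 \<Omega> q * V_norm \<Omega> v" by (intro mult_left_mono V_norm_ge) simp
    finally show "- l2ip \<Omega> q (weak_div \<Omega> v) \<le> Lp_norm 2 \<Omega> q * V_norm \<Omega> v" .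
  qed simp
  then show ?thesis using p by simp
qed

text \<open>Cauchy-Schwarz for the squares of the two norms, each of which is in L2 by the L4
  embedding. Both trilinear terms are dominated pointwise by this product.\<close>

lemma V_product_L2:
  assumes w: "w \<in> V_space \<Omega>" and v: "v \<in> V_space \<Omega>"
  shows "(\<lambda>x. norm (w x) * norm (v x)) \<in> Lp 2 \<Omega>"
    "Lp_norm 2 \<Omega> (\<lambda>x. norm (w x) * norm (v x)) \<le> C\<^sup>2 * V_norm \<Omega> w * V_norm \<Omega> v"
proof -
  have sq: "(\<lambda>x. (norm (u x))\<^sup>2) \<in> Lp 2 \<Omega>" "Lp_norm 2 \<Omega> (\<lambda>x. (norm (u x))\<^sup>2) \<le> (C * V_norm \<Omega> u)\<^sup>2"
    if u: "u \<in> V_space \<Omega>" for u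
  proof -
    note e = V_embeds_L4[OF sobolev u]
    have um: "(\<lambda>x. (norm (u x))\<^sup>2) \<in> borel_measurable (lebesgue_on \<Omega>)"
      using e(1) by (auto simp: Lp_def)
    then show "(\<lambda>x. (norm (u x))\<^sup>2) \<in> Lp 2 \<Omega>" using e(1) by (simp add: Lp_def power_mult[symmetric])
    have "(Lp_norm 2 \<Omega> (\<lambda>x. (norm (u x))\<^sup>2))\<^sup>2 \<le> ((C * V_norm \<Omega> u)\<^sup>2)\<^sup>2"
      using e(2) by (simp add: Lp_norm_2_sq l2ip_self power_mult[symmetric])
    then show "Lp_norm 2 \<Omega> (\<lambda>x. (norm (u x))\<^sup>2) \<le> (C * V_norm \<Omega> u)\<^sup>2" by (rule power2_le_imp_le) simp
  qed
  let ?p = "\<lambda>x. norm (w x) * norm (v x)"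
  have pm: "?p \<in> borel_measurable (lebesgue_on \<Omega>)"
    using V_Lp2(1)[OF w] V_Lp2(1)[OF v] by (auto simp: Lp_def)
  show L: "?p \<in> Lp 2 \<Omega>"
    using integrable_inner_L2[OF sq(1)[OF w] sq(1)[OF v]] pm by (simp add: Lp_def power_mult_distrib)
  have "(Lp_norm 2 \<Omega> ?p)\<^sup>2 = l2ip \<Omega> (\<lambda>x. (norm (w x))\<^sup>2) (\<lambda>x. (norm (v x))\<^sup>2)"
    by (simp add: Lp_norm_2_sq l2ip_self) (simp add: l2ip_def power_mult_distrib)
  also have "\<dots> \<le> Lp_norm 2 \<Omega> (\<lambda>x. (norm (w x))\<^sup>2) * Lp_norm 2 \<Omega> (\<lambda>x. (norm (v x))\<^sup>2)"
    using l2_cauchy_schwarz[OF sq(1)[OF w] sq(1)[OF v]] by simp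
  also have "\<dots> \<le> (C * V_norm \<Omega> w)\<^sup>2 * (C * V_norm \<Omega> v)\<^sup>2" by (intro mult_mono sq w v) auto
  also have "\<dots> = (C\<^sup>2 * V_norm \<Omega> w * V_norm \<Omega> v)\<^sup>2" by (simp add: power2_eq_square)
  finally show "Lp_norm 2 \<Omega> ?p \<le> C\<^sup>2 * V_norm \<Omega> w * V_norm \<Omega> v"
    by (rule power2_le_imp_le) (simp add: V_norm_ge)
qed

text \<open>The cyclic rule for the triple product rewrites (w x \<omega>) . v as \<omega> . (v x
  w). This leaves \<omega>, which is only in L2, as one factor and collects the two fields of V in
  the other.\<close>

definition cr :: "(real^3 \<Rightarrow> real^3) \<Rightarrow> (real^3 \<Rightarrow> real^3) \<Rightarrow> real^3 \<Rightarrow> real^3" where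
  "cr w v x = cross3 (v x) (w x)"

definition nm :: "(real^3 \<Rightarrow> real^3) \<Rightarrow> (real^3 \<Rightarrow> real^3) \<Rightarrow> real^3 \<Rightarrow> real^3" where
  "nm w v x = norm (w x) *\<^sub>R v x"

definition ki :: "(real^3 \<Rightarrow> real^3) \<Rightarrow> real^3 \<Rightarrow> real^3" where
  "ki u x = inverse (\<kappa> x) *\<^sub>R u x"

lemma cr_L2:
  assumes w: "w \<in> V_space \<Omega>" and v: "v \<in> V_space \<Omega>"
  shows "cr w v \<in> Lp 2 \<Omega>" "Lp_norm 2 \<Omega> (cr w v) \<le> C\<^sup>2 * V_norm \<Omega> w * V_norm \<Omega> v"
proof -
  have [measurable]: "(\<lambda>x. w x $ i) \<in> borel_measurable (lebesgue_on \<Omega>)" "(\<lambda>x. v x $ i) \<in> borel_measurable (lebesgue_on \<Omega>)" for i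
    using V_Lp2(1)[OF w] V_Lp2(1)[OF v] by (auto simp: Lp_def intro: borel_measurable_vec_nth)
  have "(\<lambda>x. cr w v x \<bullet> i) \<in> borel_measurable (lebesgue_on \<Omega>)" if i: "i \<in> Basis" for i
  proof -
    obtain k where "i = axis k 1" using i by (auto simp: Basis_vec_def)
    moreover have "k = 1 \<or> k = 2 \<or> k = 3" using exhaust_3 by auto
    ultimately show ?thesis by (auto simp: cr_def inner_axis cross3_def)
  qed
  then have m: "cr w v \<in> borel_measurable (lebesgue_on \<Omega>)" by (subst borel_measurable_euclidean_space) auto
  have le: "norm (cr w v x) \<le> norm (norm (w x) * norm (v x))" for x
    using norm_cross_le[of "v x" "w x"] by (simp add: cr_def mult.commute)
  show "cr w v \<in> Lp 2 \<Omega>" by (rule Lp_norm_mono(1)[OF V_product_L2(1)[OF w v] m le])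
  show "Lp_norm 2 \<Omega> (cr w v) \<le> C\<^sup>2 * V_norm \<Omega> w * V_norm \<Omega> v"
    using Lp_norm_mono(2)[OF V_product_L2(1)[OF w v] m le] V_product_L2(2)[OF w v] by linarith
qed

lemma nm_L2:
  assumes w: "w \<in> V_space \<Omega>" and v: "v \<in> V_space \<Omega>"
  shows "nm w v \<in> Lp 2 \<Omega>" "Lp_norm 2 \<Omega> (nm w v) \<le> C\<^sup>2 * V_norm \<Omega> w * V_norm \<Omega> v"
proof -
  have m: "nm w v \<in> borel_measurable (lebesgue_on \<Omega>)"
    using V_Lp2(1)[OF w] V_Lp2(1)[OF v] unfolding nm_def[abs_def]
    by (intro borel_measurable_scaleR) (auto simp: Lp_def)
  have le: "norm (nm w v x) \<le> norm (norm (w x) * norm (v x))" for x by (simp add: nm_def)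
  show "nm w v \<in> Lp 2 \<Omega>" by (rule Lp_norm_mono(1)[OF V_product_L2(1)[OF w v] m le])
  show "Lp_norm 2 \<Omega> (nm w v) \<le> C\<^sup>2 * V_norm \<Omega> w * V_norm \<Omega> v"
    using Lp_norm_mono(2)[OF V_product_L2(1)[OF w v] m le] V_product_L2(2)[OF w v] by linarith
qed

lemma ki_L2:
  assumes u: "u \<in> Lp 2 \<Omega>"
  shows "ki u \<in> Lp 2 \<Omega>" "Lp_norm 2 \<Omega> (ki u) \<le> inverse \<kappa>min * Lp_norm 2 \<Omega> u"
    "inverse \<kappa>max * l2ip \<Omega> u u \<le> l2ip \<Omega> (ki u) u"
proof -
  have m: "ki u \<in> borel_measurable (lebesgue_on \<Omega>)"
    using u kappa(1) unfolding ki_def[abs_def] by (intro borel_measurable_scaleR) (auto simp: Lp_def)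
  have le: "AE x in lebesgue_on \<Omega>. norm (ki u x) \<le> inverse \<kappa>min * norm (u x)"
    using kappa(3)
  proof eventually_elim
    case (elim x)
    then have "inverse (\<kappa> x) \<le> inverse \<kappa>min" "0 < \<kappa> x" using kappa(2) by (auto intro: le_imp_inverse_le)
    then show ?case by (simp add: ki_def mult_right_mono abs_of_pos)
  qed
  show L: "ki u \<in> Lp 2 \<Omega>" by (rule Lp2_bounded[OF u m le])
  have "l2ip \<Omega> (ki u) (ki u) \<le> (\<integral>x. (inverse \<kappa>min)\<^sup>2 * norm (u x) ^ 2 \<partial>lebesgue_on \<Omega>)"
    unfolding l2ip_self
  proof (rule integral_mono_AE)
    show "AE x in lebesgue_on \<Omega>. (norm (ki u x))\<^sup>2 \<le> (inverse \<kappa>min)\<^sup>2 * norm (u x) ^ 2"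
      using le by eventually_elim (simp add: power_mult_distrib[symmetric] power_mono)
  qed (use L u in \<open>auto simp: Lp_def\<close>)
  also have "\<dots> = (inverse \<kappa>min * Lp_norm 2 \<Omega> u)\<^sup>2" by (simp add: power_mult_distrib Lp_norm_2_sq l2ip_self)
  finally have "(Lp_norm 2 \<Omega> (ki u))\<^sup>2 \<le> (inverse \<kappa>min * Lp_norm 2 \<Omega> u)\<^sup>2" by (simp add: Lp_norm_2_sq)
  then show "Lp_norm 2 \<Omega> (ki u) \<le> inverse \<kappa>min * Lp_norm 2 \<Omega> u"
    by (rule power2_le_imp_le) (use kappa(2) in simp)
  have "(\<integral>x. inverse \<kappa>max * (u x \<bullet> u x) \<partial>lebesgue_on \<Omega>) \<le> (\<integral>x. ki u x \<bullet> u x \<partial>lebesgue_on \<Omega>)"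
  proof (rule integral_mono_AE)
    show "AE x in lebesgue_on \<Omega>. inverse \<kappa>max * (u x \<bullet> u x) \<le> ki u x \<bullet> u x"
      using kappa(3)
    proof eventually_elim
      case (elim x)
      then have "inverse \<kappa>max \<le> inverse (\<kappa> x)" using kappa(2) by (auto intro: le_imp_inverse_le)
      then show ?case by (simp add: ki_def mult_right_mono)
    qed
  qed (use integrable_inner_L2[OF u u] integrable_inner_L2[OF L u] in auto)
  then show "inverse \<kappa>max * l2ip \<Omega> u u \<le> l2ip \<Omega> (ki u) u" by (simp add: l2ip_def)
qed

text \<open>The momentum form after elimination of \<open>\<omega> = \<surd>\<nu> curl u\<close>. The trilinear terms are written as \<open>L\<^sup>2\<close>
  inner products, so that Cauchy--Schwarz applies to them directly.\<close>

definition B :: "(real^3 \<Rightarrow> real^3) \<Rightarrow> (real^3 \<Rightarrow> real^3) \<Rightarrow> (real^3 \<Rightarrow> real^3) \<Rightarrow> real" where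
  "B w u v = l2ip \<Omega> (ki u) v + \<nu> * l2ip \<Omega> (weak_curl \<Omega> u) (weak_curl \<Omega> v)
     - l2ip \<Omega> (weak_curl \<Omega> u) (cr w v) + F * l2ip \<Omega> u (nm w v)"

section \<open>Bilinearity, boundedness and coercivity of the momentum form\<close>

lemma cr_axpy: "cr w (fun_axpy a u v) = fun_axpy a (cr w u) (cr w v)"
  by (simp add: fun_eq_iff cr_def fun_axpy_def cross_add_left cross_mult_left)

lemma nm_axpy: "nm w (fun_axpy a u v) = fun_axpy a (nm w u) (nm w v)"
  by (simp add: fun_eq_iff nm_def fun_axpy_def scaleR_right_distrib)

lemma ki_axpy: "ki (fun_axpy a u v) = fun_axpy a (ki u) (ki v)"
  by (simp add: fun_eq_iff ki_def fun_axpy_def scaleR_right_distrib)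

lemma B_axpy_left:
  assumes "w \<in> V_space \<Omega>" "u \<in> V_space \<Omega>" "v \<in> V_space \<Omega>" "z \<in> V_space \<Omega>"
  shows "B w (fun_axpy a u v) z = a * B w u z + B w v z"
  unfolding B_def ki_axpy using assms
  by (simp add: l2ip_weak_axpy l2ip_axpy V_Lp2 cr_L2 nm_L2 ki_L2 algebra_simps)

lemma B_axpy_right:
  assumes "w \<in> V_space \<Omega>" "u \<in> V_space \<Omega>" "v \<in> V_space \<Omega>" "z \<in> V_space \<Omega>"
  shows "B w z (fun_axpy a u v) = a * B w z u + B w z v"
proof -
  have "l2ip \<Omega> (weak_curl \<Omega> z) (weak_curl \<Omega> (fun_axpy a u v))
      = a * l2ip \<Omega> (weak_curl \<Omega> z) (weak_curl \<Omega> u) + l2ip \<Omega> (weak_curl \<Omega> z) (weak_curl \<Omega> v)"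
    using l2ip_weak_axpy(2)[OF assms(2,3), of "weak_curl \<Omega> z" a] assms V_Lp2 by (simp add: l2ip_commute[of _ "weak_curl \<Omega> z"])
  then show ?thesis
    unfolding B_def cr_axpy nm_axpy using assms
    by (simp add: l2ip_axpy_right V_Lp2 cr_L2 nm_L2 ki_L2 algebra_simps)
qed

lemma l2ip_le:
  fixes a b :: "real^3 \<Rightarrow> 'b::euclidean_space"
  assumes "a \<in> Lp 2 \<Omega>" "b \<in> Lp 2 \<Omega>" "Lp_norm 2 \<Omega> a \<le> p" "Lp_norm 2 \<Omega> b \<le> q"
  shows "\<bar>l2ip \<Omega> a b\<bar> \<le> p * q"
proof -
  have "\<bar>l2ip \<Omega> a b\<bar> \<le> Lp_norm 2 \<Omega> a * Lp_norm 2 \<Omega> b" using assms by (intro l2_cauchy_schwarz)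
  also have "\<dots> \<le> p * q" using assms(3,4) Lp_norm_nonneg order_trans by (intro mult_mono) blast+
  finally show ?thesis .
qed

lemma B_bounded:
  assumes w: "w \<in> V_space \<Omega>" and u: "u \<in> V_space \<Omega>" and v: "v \<in> V_space \<Omega>"
  shows "\<bar>B w u v\<bar> \<le> (inverse \<kappa>min + \<nu> + C\<^sup>2 * V_norm \<Omega> w * (1 + F)) * V_norm \<Omega> u * V_norm \<Omega> v"
proof -
  note U = V_Lp2[OF u] and V = V_Lp2[OF v]
  have "\<bar>l2ip \<Omega> (ki u) v\<bar> \<le> (inverse \<kappa>min * V_norm \<Omega> u) * V_norm \<Omega> v"
  proof (rule l2ip_le[OF ki_L2(1)[OF U(1)] V(1)])
    have "inverse \<kappa>min * Lp_norm 2 \<Omega> u \<le> inverse \<kappa>min * V_norm \<Omega> u"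
      using kappa(2) V_norm_ge by (intro mult_left_mono) auto
    then show "Lp_norm 2 \<Omega> (ki u) \<le> inverse \<kappa>min * V_norm \<Omega> u" using ki_L2(2)[OF U(1)] by linarith
  qed (rule V_norm_ge)
  moreover have "\<bar>l2ip \<Omega> (weak_curl \<Omega> u) (weak_curl \<Omega> v)\<bar> \<le> V_norm \<Omega> u * V_norm \<Omega> v"
    by (intro l2ip_le U V V_norm_ge)
  then have "\<bar>\<nu> * l2ip \<Omega> (weak_curl \<Omega> u) (weak_curl \<Omega> v)\<bar> \<le> \<nu> * (V_norm \<Omega> u * V_norm \<Omega> v)"
    using pos by (simp add: abs_mult)
  moreover have "\<bar>l2ip \<Omega> (weak_curl \<Omega> u) (cr w v)\<bar> \<le> V_norm \<Omega> u * (C\<^sup>2 * V_norm \<Omega> w * V_norm \<Omega> v)"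
    by (intro l2ip_le U cr_L2 w v V_norm_ge)
  moreover have "\<bar>l2ip \<Omega> u (nm w v)\<bar> \<le> V_norm \<Omega> u * (C\<^sup>2 * V_norm \<Omega> w * V_norm \<Omega> v)"
    by (intro l2ip_le U nm_L2 w v V_norm_ge)
  then have "\<bar>F * l2ip \<Omega> u (nm w v)\<bar> \<le> F * (V_norm \<Omega> u * (C\<^sup>2 * V_norm \<Omega> w * V_norm \<Omega> v))"
    using pos by (simp add: abs_mult)
  ultimately have "\<bar>B w u v\<bar> \<le> (inverse \<kappa>min * V_norm \<Omega> u) * V_norm \<Omega> v + \<nu> * (V_norm \<Omega> u * V_norm \<Omega> v)
      + V_norm \<Omega> u * (C\<^sup>2 * V_norm \<Omega> w * V_norm \<Omega> v) + F * (V_norm \<Omega> u * (C\<^sup>2 * V_norm \<Omega> w * V_norm \<Omega> v))"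
    unfolding B_def by linarith
  then show ?thesis by (simp add: algebra_simps)
qed

text \<open>Kept apart from the norm of V because its second summand is exactly the squared L2 norm
  of the vorticity sqrt \<nu> curl u, which is estimated through it.\<close>

definition energy :: "(real^3 \<Rightarrow> real^3) \<Rightarrow> real" where
  "energy u = inverse \<kappa>max * l2ip \<Omega> u u + \<nu> * l2ip \<Omega> (weak_curl \<Omega> u) (weak_curl \<Omega> u)"

definition \<alpha> :: real where "\<alpha> = min (inverse \<kappa>max) \<nu>"

lemma alpha_pos: "0 < \<alpha>"
  using pos kappa_order by (simp add: \<alpha>_def)

lemma div_free_norm:
  assumes "u \<in> V_space \<Omega>" "AE x in lebesgue_on \<Omega>. weak_div \<Omega> u x = 0"
  shows "(V_norm \<Omega> u)\<^sup>2 = l2ip \<Omega> u u + l2ip \<Omega> (weak_curl \<Omega> u) (weak_curl \<Omega> u)"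
  using l2ip_self_eq_0_iff[OF V_Lp2(2)[OF assms(1)]] assms(2) by (simp add: V_norm_sq V_ip_def)

lemma energy_ge:
  assumes "u \<in> V_space \<Omega>" "AE x in lebesgue_on \<Omega>. weak_div \<Omega> u x = 0"
  shows "\<alpha> * (V_norm \<Omega> u)\<^sup>2 \<le> energy u"
  unfolding div_free_norm[OF assms] energy_def distrib_left
  by (intro add_mono mult_right_mono) (auto simp: \<alpha>_def l2ip_self)

text \<open>For v = u the drag term is nonnegative, but the convective term has no sign. The
  smallness of w bounds it by \<alpha> / 4 times the squared norm, hence by a quarter of the
  energy.\<close>

lemma B_coercive:
  assumes w: "w \<in> V_space \<Omega>" and small: "4 * C\<^sup>2 * V_norm \<Omega> w \<le> \<alpha>"
    and u: "u \<in> V_space \<Omega>" "AE x in lebesgue_on \<Omega>. weak_div \<Omega> u x = 0"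
  shows "3 / 4 * energy u \<le> B w u u"
proof -
  note U = V_Lp2[OF u(1)]
  let ?n = "V_norm \<Omega> u"
  have "\<bar>l2ip \<Omega> (weak_curl \<Omega> u) (cr w u)\<bar> \<le> ?n * (C\<^sup>2 * V_norm \<Omega> w * ?n)"
    by (intro l2ip_le U cr_L2 w u V_norm_ge)
  also have "\<dots> = (C\<^sup>2 * V_norm \<Omega> w) * ?n\<^sup>2" by (simp add: power2_eq_square)
  also have "\<dots> \<le> (\<alpha> / 4) * ?n\<^sup>2" using small by (intro mult_right_mono) auto
  also have "\<dots> \<le> energy u / 4" using energy_ge[OF u] by simp
  finally have "l2ip \<Omega> (weak_curl \<Omega> u) (cr w u) \<le> energy u / 4" by simp
  moreover have "0 \<le> l2ip \<Omega> u (nm w u)"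
    unfolding l2ip_def nm_def by (intro Bochner_Integration.integral_nonneg) simp
  then have "0 \<le> F * l2ip \<Omega> u (nm w u)" using pos by simp
  moreover have "energy u \<le> l2ip \<Omega> (ki u) u + \<nu> * l2ip \<Omega> (weak_curl \<Omega> u) (weak_curl \<Omega> u)"
    using ki_L2(3)[OF U(1)] by (simp add: energy_def)
  ultimately show ?thesis unfolding B_def by linarith
qed

section \<open>Elimination of the vorticity and solvability of the linearised problem\<close>

lemma forms_eq:
  "form_a \<Omega> \<kappa> \<nu> u \<omega> v \<theta> + form_b \<Omega> v \<theta> p + form_c \<Omega> \<nu> F w u \<omega> v \<theta>
    = l2ip \<Omega> (ki u) v + sqrt \<nu> * l2ip \<Omega> \<omega> (weak_curl \<Omega> v) + sqrt \<nu> * l2ip \<Omega> \<theta> (weak_curl \<Omega> u)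
      - l2ip \<Omega> \<omega> \<theta> - l2ip \<Omega> p (weak_div \<Omega> v) - 1 / sqrt \<nu> * l2ip \<Omega> \<omega> (cr w v) + F * l2ip \<Omega> u (nm w v)"
  by (simp add: form_a_def form_b_def form_c_def l2ip_def ki_def cr_def nm_def cross_triple_cyclic)

lemma vorticity_L2:
  "u \<in> V_space \<Omega> \<Longrightarrow> (\<lambda>x. sqrt \<nu> *\<^sub>R weak_curl \<Omega> u x) \<in> Lp 2 \<Omega>"
  by (intro Lp2_scaleR V_Lp2)

lemma l2ip_vorticity:
  assumes u: "u \<in> V_space \<Omega>" and w: "\<omega> \<in> Lp 2 \<Omega>" and z: "z \<in> Lp 2 \<Omega>"
    and e: "AE x in lebesgue_on \<Omega>. \<omega> x = sqrt \<nu> *\<^sub>R weak_curl \<Omega> u x"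
  shows "l2ip \<Omega> \<omega> z = sqrt \<nu> * l2ip \<Omega> (weak_curl \<Omega> u) z"
proof -
  have "l2ip \<Omega> \<omega> z = l2ip \<Omega> (\<lambda>x. sqrt \<nu> *\<^sub>R weak_curl \<Omega> u x) z"
    using e w z vorticity_L2[OF u] by (intro l2ip_cong) auto
  then show ?thesis by (simp add: l2ip_def)
qed

text \<open>With \<omega> = sqrt \<nu> curl u the two terms in \<theta> cancel, whatever \<theta>
  is. The factor sqrt \<nu> of \<omega> also cancels the 1 / sqrt \<nu> of the convective
  term.\<close>

lemma forms_reduced:
  assumes w: "w \<in> V_space \<Omega>" and u: "u \<in> V_space \<Omega>" and om: "\<omega> \<in> Lp 2 \<Omega>" and v: "v \<in> V_space \<Omega>"
    and th: "\<theta> \<in> Lp 2 \<Omega>" and e: "AE x in lebesgue_on \<Omega>. \<omega> x = sqrt \<nu> *\<^sub>R weak_curl \<Omega> u x"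
  shows "form_a \<Omega> \<kappa> \<nu> u \<omega> v \<theta> + form_b \<Omega> v \<theta> p + form_c \<Omega> \<nu> F w u \<omega> v \<theta>
    = B w u v - l2ip \<Omega> p (weak_div \<Omega> v)"
proof -
  note s = l2ip_vorticity[OF u om _ e]
  have "sqrt \<nu> * (sqrt \<nu> * t) = \<nu> * t" "1 / sqrt \<nu> * (sqrt \<nu> * t) = t" for t using pos by simp_all
  then show ?thesis
    unfolding forms_eq s[OF V_Lp2(3)[OF v]] s[OF th] s[OF cr_L2(1)[OF w v]] B_def
    by (simp add: l2ip_commute[of _ \<theta>])
qed

text \<open>Testing with \<open>v = 0\<close> eliminates the vorticity; testing with \<open>q = div u\<close>, which has mean zero,
  shows that \<open>u\<close> is divergence free.\<close>

lemma is_solution_iff: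
  assumes w: "w \<in> V_space \<Omega>"
  shows "is_solution \<Omega> \<nu> F \<kappa> f w u \<omega> p \<longleftrightarrow> u \<in> V_space \<Omega> \<and> \<omega> \<in> Lp 2 \<Omega> \<and> p \<in> L20 \<Omega> \<and>
    (AE x in lebesgue_on \<Omega>. \<omega> x = sqrt \<nu> *\<^sub>R weak_curl \<Omega> u x) \<and>
    (AE x in lebesgue_on \<Omega>. weak_div \<Omega> u x = 0) \<and>
    (\<forall>v\<in>V_space \<Omega>. B w u v - l2ip \<Omega> p (weak_div \<Omega> v) = l2ip \<Omega> f v)"
proof
  assume s: "is_solution \<Omega> \<nu> F \<kappa> f w u \<omega> p"
  then have u: "u \<in> V_space \<Omega>" and om: "\<omega> \<in> Lp 2 \<Omega>" and p: "p \<in> L20 \<Omega>"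
    and eq: "\<And>v \<theta>. v \<in> V_space \<Omega> \<Longrightarrow> \<theta> \<in> Lp 2 \<Omega> \<Longrightarrow> form_a \<Omega> \<kappa> \<nu> u \<omega> v \<theta> + form_b \<Omega> v \<theta> p
      + form_c \<Omega> \<nu> F w u \<omega> v \<theta> = l2ip \<Omega> f v"
    and dv: "\<And>q. q \<in> L20 \<Omega> \<Longrightarrow> l2ip \<Omega> q (weak_div \<Omega> u) = 0"
    by (auto simp: is_solution_def l2ip_def form_b_def)
  note U = V_Lp2[OF u]
  have e: "AE x in lebesgue_on \<Omega>. \<omega> x = sqrt \<nu> *\<^sub>R weak_curl \<Omega> u x"
  proof -
    define \<theta> where "\<theta> x = sqrt \<nu> *\<^sub>R weak_curl \<Omega> u x - \<omega> x" for x
    have th: "\<theta> \<in> Lp 2 \<Omega>" unfolding \<theta>_def[abs_def] by (intro Lp2_diff vorticity_L2 u om)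
    \<comment> \<open>Even for the zero field \<open>weak_curl\<close> is a choice, known to vanish
      only almost everywhere.\<close>
    have z: "l2ip \<Omega> a (weak_curl \<Omega> (\<lambda>x. 0)) = 0" if "a \<in> Lp 2 \<Omega>" for a
    proof -
      have "l2ip \<Omega> a (weak_curl \<Omega> (\<lambda>x. 0)) = l2ip \<Omega> a (\<lambda>x. 0)"
        using has_div_curl_imp_V(3)[OF zero_has_div_curl] that V_Lp2[OF zero_in_V] Lp2_zero
        by (intro l2ip_cong) auto
      then show ?thesis by (simp add: l2ip_def)
    qed
    have z': "l2ip \<Omega> p (weak_div \<Omega> (\<lambda>x. 0)) = 0"
    proof -
      have "l2ip \<Omega> p (weak_div \<Omega> (\<lambda>x. 0)) = l2ip \<Omega> p (\<lambda>x. 0)"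
        using has_div_curl_imp_V(2)[OF zero_has_div_curl] L20_Lp2[OF p] V_Lp2[OF zero_in_V] Lp2_zero
        by (intro l2ip_cong) auto
      then show ?thesis by (simp add: l2ip_def)
    qed
    have "sqrt \<nu> * l2ip \<Omega> \<theta> (weak_curl \<Omega> u) - l2ip \<Omega> \<omega> \<theta> = 0"
      using eq[OF zero_in_V th] unfolding forms_eq z[OF om] z' by (simp add: l2ip_def cr_def nm_def)
    moreover have "l2ip \<Omega> \<theta> \<theta> = sqrt \<nu> * l2ip \<Omega> (weak_curl \<Omega> u) \<theta> - l2ip \<Omega> \<omega> \<theta>"
      using l2ip_axpy[OF om vorticity_L2[OF u] th, of "-1"]
      by (simp add: fun_axpy_def \<theta>_def[abs_def] l2ip_def)
    ultimately have "l2ip \<Omega> \<theta> \<theta> = 0" by (simp add: l2ip_commute)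
    then have "AE x in lebesgue_on \<Omega>. \<theta> x = 0" using l2ip_self_eq_0_iff[OF th] by simp
    then show ?thesis by eventually_elim (simp add: \<theta>_def)
  qed
  moreover have "AE x in lebesgue_on \<Omega>. weak_div \<Omega> u x = 0"
    using dv[OF weak_div_L20[OF u]] l2ip_self_eq_0_iff[OF U(2)] by simp
  \<comment> \<open>The terms in \<theta> cancel, so any admissible \<theta> would do; \<omega>
    itself is taken.\<close>
  moreover have "B w u v - l2ip \<Omega> p (weak_div \<Omega> v) = l2ip \<Omega> f v" if "v \<in> V_space \<Omega>" for v
    using eq[OF that om] forms_reduced[OF w u om that om e] by simp
  ultimately show "u \<in> V_space \<Omega> \<and> \<omega> \<in> Lp 2 \<Omega> \<and> p \<in> L20 \<Omega> \<and>
    (AE x in lebesgue_on \<Omega>. \<omega> x = sqrt \<nu> *\<^sub>R weak_curl \<Omega> u x) \<and>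
    (AE x in lebesgue_on \<Omega>. weak_div \<Omega> u x = 0) \<and>
    (\<forall>v\<in>V_space \<Omega>. B w u v - l2ip \<Omega> p (weak_div \<Omega> v) = l2ip \<Omega> f v)"
    using u om p by blast
next
  assume r: "u \<in> V_space \<Omega> \<and> \<omega> \<in> Lp 2 \<Omega> \<and> p \<in> L20 \<Omega> \<and>
    (AE x in lebesgue_on \<Omega>. \<omega> x = sqrt \<nu> *\<^sub>R weak_curl \<Omega> u x) \<and>
    (AE x in lebesgue_on \<Omega>. weak_div \<Omega> u x = 0) \<and>
    (\<forall>v\<in>V_space \<Omega>. B w u v - l2ip \<Omega> p (weak_div \<Omega> v) = l2ip \<Omega> f v)"
  have "form_b \<Omega> u \<omega> q = 0" if q: "q \<in> L20 \<Omega>" for q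
  proof -
    have "l2ip \<Omega> q (weak_div \<Omega> u) = l2ip \<Omega> q (\<lambda>x. 0)"
      using r L20_Lp2[OF q] V_Lp2 Lp2_zero by (intro l2ip_cong) auto
    then show ?thesis by (simp add: form_b_def l2ip_def)
  qed
  then show "is_solution \<Omega> \<nu> F \<kappa> f w u \<omega> p"
    using r forms_reduced[OF w] by (simp add: is_solution_def l2ip_def)
qed

text \<open>An instance of \<open>saddle_point\<close> for velocity and pressure. A field
  annihilated by all pressures is divergence free, since its own divergence is one of them; there
  the norm of V consists of the field and its curl alone, and the energy controls it.\<close>

lemma linear_exists:
  assumes w: "w \<in> V_space \<Omega>" and small: "4 * C\<^sup>2 * V_norm \<Omega> w \<le> \<alpha>" and f: "f \<in> Lp 2 \<Omega>"
  shows "\<exists>u \<omega> p. is_solution \<Omega> \<nu> F \<kappa> f w u \<omega> p"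
proof -
  have nV: "sqrt (V_ip v v) = V_norm \<Omega> v" for v by (simp add: V_norm_eq)
  have nQ: "sqrt (l2ip \<Omega> q q) = Lp_norm 2 \<Omega> q" for q :: "real^3 \<Rightarrow> real" by (simp add: Lp_norm_2)
  have div0: "AE x in lebesgue_on \<Omega>. weak_div \<Omega> u x = 0"
    if u: "u \<in> V_space \<Omega>" and z: "\<And>q. q \<in> L20 \<Omega> \<Longrightarrow> - l2ip \<Omega> q (weak_div \<Omega> u) = 0" for u
    using z[OF weak_div_L20[OF u]] l2ip_self_eq_0_iff[OF V_Lp2(2)[OF u]] by simp
  have "\<exists>u\<in>V_space \<Omega>. \<exists>p\<in>L20 \<Omega>. (\<forall>v\<in>V_space \<Omega>. B w u v + - l2ip \<Omega> p (weak_div \<Omega> v) = l2ip \<Omega> f v)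
      \<and> (\<forall>q\<in>L20 \<Omega>. - l2ip \<Omega> q (weak_div \<Omega> u) = 0)"
  proof (rule saddle_point[OF semi_hilbert_V semi_hilbert_L20, where Mb=1 and \<beta>=\<beta>
        and Ma="inverse \<kappa>min + \<nu> + C\<^sup>2 * V_norm \<Omega> w * (1 + F)" and \<alpha>="3 / 4 * \<alpha>" and C="Lp_norm 2 \<Omega> f"],
      unfold nV nQ)
    show "- l2ip \<Omega> q (weak_div \<Omega> (fun_axpy a x y)) = a * - l2ip \<Omega> q (weak_div \<Omega> x) + - l2ip \<Omega> q (weak_div \<Omega> y)"
      if "x \<in> V_space \<Omega>" "y \<in> V_space \<Omega>" "q \<in> L20 \<Omega>" for a x y q
      using l2ip_weak_axpy(1)[OF that(1,2) L20_Lp2[OF that(3)]] by (simp add: l2ip_commute[of _ q])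
    show "- l2ip \<Omega> (fun_axpy a p q) (weak_div \<Omega> x) = a * - l2ip \<Omega> p (weak_div \<Omega> x) + - l2ip \<Omega> q (weak_div \<Omega> x)"
      if "x \<in> V_space \<Omega>" "p \<in> L20 \<Omega>" "q \<in> L20 \<Omega>" for a p q x
      using that by (simp add: l2ip_axpy L20_Lp2 V_Lp2)
    show "\<bar>- l2ip \<Omega> q (weak_div \<Omega> x)\<bar> \<le> 1 * V_norm \<Omega> x * Lp_norm 2 \<Omega> q" if "x \<in> V_space \<Omega>" "q \<in> L20 \<Omega>" for x q
      using l2ip_le[OF L20_Lp2[OF that(2)] V_Lp2(2)[OF that(1)] order_refl V_norm_ge(2)] by (simp add: mult.commute)
    show "\<beta> * Lp_norm 2 \<Omega> q \<le> M"
      if "q \<in> L20 \<Omega>" "0 \<le> M" "\<And>v. v \<in> V_space \<Omega> \<Longrightarrow> - l2ip \<Omega> q (weak_div \<Omega> v) \<le> M * V_norm \<Omega> v" for q M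
      using that by (rule inf_sup)
    show "B w (fun_axpy a x y) z = a * B w x z + B w y z" "B w z (fun_axpy a x y) = a * B w z x + B w z y"
      if "x \<in> V_space \<Omega>" "y \<in> V_space \<Omega>" "z \<in> V_space \<Omega>" for a x y z
      using that w B_axpy_left B_axpy_right by auto
    show "\<bar>B w x y\<bar> \<le> (inverse \<kappa>min + \<nu> + C\<^sup>2 * V_norm \<Omega> w * (1 + F)) * V_norm \<Omega> x * V_norm \<Omega> y"
      if "x \<in> V_space \<Omega>" "y \<in> V_space \<Omega>" for x y using that w by (intro B_bounded)
    show "3 / 4 * \<alpha> * V_ip x x \<le> B w x x"
      if "x \<in> V_space \<Omega>" "\<And>q. q \<in> L20 \<Omega> \<Longrightarrow> - l2ip \<Omega> q (weak_div \<Omega> x) = 0" for x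
      using energy_ge[OF that(1) div0[OF that]] B_coercive[OF w small that(1) div0[OF that]]
      by (simp add: V_norm_sq)
    show "l2ip \<Omega> f (fun_axpy a x y) = a * l2ip \<Omega> f x + l2ip \<Omega> f y"
      if "x \<in> V_space \<Omega>" "y \<in> V_space \<Omega>" for a x y using that f by (simp add: l2ip_axpy_right V_Lp2)
    show "\<bar>l2ip \<Omega> f x\<bar> \<le> Lp_norm 2 \<Omega> f * V_norm \<Omega> x" if "x \<in> V_space \<Omega>" for x
      by (rule l2ip_le[OF f V_Lp2(1)[OF that] order_refl V_norm_ge(1)])
  qed (use beta_pos alpha_pos in auto)
  then obtain u p where u: "u \<in> V_space \<Omega>" "p \<in> L20 \<Omega>" "\<And>v. v \<in> V_space \<Omega> \<Longrightarrow> B w u v - l2ip \<Omega> p (weak_div \<Omega> v) = l2ip \<Omega> f v"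
    "\<And>q. q \<in> L20 \<Omega> \<Longrightarrow> - l2ip \<Omega> q (weak_div \<Omega> u) = 0" by auto
  have "is_solution \<Omega> \<nu> F \<kappa> f w u (\<lambda>x. sqrt \<nu> *\<^sub>R weak_curl \<Omega> u x) p"
    unfolding is_solution_iff[OF w] using u vorticity_L2[OF u(1)] div0[OF u(1,4)] by simp
  then show ?thesis by blast
qed

end

section \<open>A priori estimates and the fixed point\<close>

text \<open>Let D be the sum that is squared in the denominator. From \<beta> \<le> 1 follows D
  \<ge> 3 \<beta>, the source of 1/9; and D^2 \<ge> (sqrt \<nu> + 2)^2 \<ge> 8 sqrt \<nu> is the
  source of 1/8. The second conclusion serves the contraction, the third the coercivity.\<close>

lemma gamma_bounds:
  fixes a k \<nu> \<beta> \<gamma> :: real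
  assumes p: "0 < a" "0 < k" "0 < \<nu>" "0 < \<beta>" "\<beta> \<le> 1"
    and g: "\<gamma> = min (2 * a) (min \<nu> 1) * \<beta>\<^sup>2 / (\<beta> + k + sqrt \<nu> + 2)\<^sup>2"
  shows "0 < \<gamma>" "\<gamma> \<le> 2 / 9 * min a \<nu>" "2 * sqrt \<nu> * \<gamma> \<le> min a \<nu>"
proof -
  define t where "t = min (2 * a) (min \<nu> 1)"
  define s where "s = sqrt \<nu>"
  define D where "D = \<beta> + k + s + 2"
  have s: "0 < s" using p by (simp add: s_def)
  have t: "0 < t" "t \<le> 2 * min a \<nu>" using p by (auto simp: t_def)
  have D: "0 < D" using p s by (simp add: D_def)
  have g': "\<gamma> = t * (\<beta>\<^sup>2 / D\<^sup>2)" using g by (simp add: t_def D_def s_def)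
  show "0 < \<gamma>" using t D p by (simp add: g')
  have "(3 * \<beta>)\<^sup>2 \<le> D\<^sup>2" using p s by (intro power_mono) (auto simp: D_def)
  then have r1: "\<beta>\<^sup>2 / D\<^sup>2 \<le> 1 / 9" using D by (simp add: divide_le_eq power_mult_distrib)
  have "8 * s \<le> (s + 2)\<^sup>2" using zero_le_power2[of "s - 2"] by (simp add: power2_eq_square algebra_simps)
  also have "\<dots> \<le> D\<^sup>2" using p s by (intro power_mono) (auto simp: D_def)
  finally have "8 * s \<le> D\<^sup>2" .
  moreover have "s * \<beta>\<^sup>2 \<le> s * 1" using p s by (intro mult_left_mono) (auto simp: power_le_one)
  ultimately have r2: "s * (\<beta>\<^sup>2 / D\<^sup>2) \<le> 1 / 8" using D by (simp add: divide_le_eq)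
  have "\<gamma> \<le> t * (1 / 9)" unfolding g' using r1 t by (intro mult_left_mono) auto
  then show "\<gamma> \<le> 2 / 9 * min a \<nu>" using t by simp
  have "2 * sqrt \<nu> * \<gamma> = 2 * t * (s * (\<beta>\<^sup>2 / D\<^sup>2))" by (simp add: g' s_def)
  also have "\<dots> \<le> 2 * t * (1 / 8)" using r2 t by (intro mult_left_mono) auto
  also have "\<dots> \<le> min a \<nu>" using t p by (simp add: min_def split: if_splits)
  finally show "2 * sqrt \<nu> * \<gamma> \<le> min a \<nu>" .
qed

text \<open>Here \<open>U\<close>, \<open>S\<close>, \<open>P\<close> stand for the norms of velocity, vorticity and pressure, and \<open>a\<close>, \<open>k\<close> for the
  inverses of the bounds of \<open>\<kappa>\<close>.\<close>

lemma apriori_arith: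
  fixes a k \<nu> \<beta> \<gamma> U S P N :: real
  assumes p: "0 < a" "0 < k" "0 < \<nu>" "0 < \<beta>" "\<beta> \<le> 1"
    and g: "\<gamma> = min (2 * a) (min \<nu> 1) * \<beta>\<^sup>2 / (\<beta> + k + sqrt \<nu> + 2)\<^sup>2"
    and nn: "0 \<le> U" "0 \<le> S" "0 \<le> P" "0 \<le> N"
    and h1: "3 / 4 * (min a \<nu> * U\<^sup>2) \<le> N * U" and h2: "3 / 4 * S\<^sup>2 \<le> N * U"
    and h3: "\<beta> * P \<le> N + k * U + sqrt \<nu> * S + \<gamma> / 2 * (U + S)"
  shows "U + S + P \<le> 2 / \<gamma> * N"
proof -
  define t where "t = min (2 * a) (min \<nu> 1)"
  define s where "s = sqrt \<nu>"
  define D where "D = \<beta> + k + s + 2"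
  have s: "0 < s" using p by (simp add: s_def)
  have t: "0 < t" "t \<le> 2 * min a \<nu>" "t \<le> 1" using p by (auto simp: t_def)
  have D: "0 < D" using p s by (simp add: D_def)
  have g': "\<gamma> = t * \<beta>\<^sup>2 / D\<^sup>2" using g by (simp add: t_def D_def s_def)
  have gb: "0 < \<gamma>" "\<gamma> \<le> 2 / 9 * min a \<nu>" using gamma_bounds[OF p g] by auto
  \<comment> \<open>\<open>h1\<close> is divided by \<open>U\<close>, hence the case distinction;
    8/3 is 2 times 4/3, from t \<le> 2 min a \<nu> and the coercivity factor 3/4.\<close>
  have tU: "t * U \<le> 8 / 3 * N"
  proof (cases "U = 0")
    case False
    then have "3 / 4 * (min a \<nu> * U) \<le> N" using h1 nn by (simp add: power2_eq_square)
    moreover have "t * U \<le> 2 * min a \<nu> * U" using t nn by (intro mult_right_mono) auto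
    ultimately show ?thesis by simp
  qed (use nn in simp)
  \<comment> \<open>\<open>h2\<close> bounds S^2 by N U, so a second factor t is needed to use
    \<open>tU\<close>; t \<le> 1 supplies it. The resulting constant (4/3) (8/3) = 32/9 is rounded
    up to 4.\<close>
  have tS: "t * S \<le> 2 * N"
  proof (rule power2_le_imp_le)
    have "(t * S)\<^sup>2 = t * (t * S\<^sup>2)" by (simp add: power2_eq_square)
    also have "\<dots> \<le> t * (1 * S\<^sup>2)" using t by (intro mult_left_mono mult_right_mono) auto
    also have "\<dots> \<le> t * (4 / 3 * (N * U))" using h2 t by (intro mult_left_mono) auto
    also have "\<dots> = 4 / 3 * N * (t * U)" by simp
    also have "\<dots> \<le> 4 / 3 * N * (8 / 3 * N)" using tU nn by (intro mult_left_mono) auto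
    also have "\<dots> \<le> (2 * N)\<^sup>2" by (simp add: power2_eq_square)
    finally show "(t * S)\<^sup>2 \<le> (2 * N)\<^sup>2" .
  qed (use nn in simp)
  have g1: "\<gamma> \<le> 1 / 9"
  proof -
    have "(3 * \<beta>)\<^sup>2 \<le> D\<^sup>2" using p s by (intro power_mono) (auto simp: D_def)
    then have "t * \<beta>\<^sup>2 \<le> 1 / 9 * D\<^sup>2"
      using mult_right_mono[OF t(3), of "\<beta>\<^sup>2"] by (simp add: power_mult_distrib)
    then show ?thesis using D by (simp add: g' divide_le_eq)
  qed
  have "t * (\<beta> * P) \<le> t * (N + k * U + s * S + \<gamma> / 2 * (U + S))"
    using h3 t by (intro mult_left_mono) (auto simp: s_def)
  also have "\<dots> = t * N + k * (t * U) + s * (t * S) + \<gamma> / 2 * (t * U + t * S)" by (simp add: algebra_simps)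
  also have "\<dots> \<le> 1 * N + k * (8 / 3 * N) + s * (2 * N) + (1 / 18) * (8 / 3 * N + 2 * N)"
  proof -
    have "t * N \<le> 1 * N" using t nn by (intro mult_right_mono) auto
    moreover have "k * (t * U) \<le> k * (8 / 3 * N)" using tU p by (intro mult_left_mono) auto
    moreover have "s * (t * S) \<le> s * (2 * N)" using tS s by (intro mult_left_mono) auto
    moreover have "\<gamma> / 2 * (t * U + t * S) \<le> (1 / 18) * (8 / 3 * N + 2 * N)"
      using tU tS g1 t nn by (intro mult_mono) auto
    ultimately show ?thesis by linarith
  qed
  finally have tP: "t * (\<beta> * P) \<le> N + k * (8 / 3 * N) + s * (2 * N) + (1 / 18) * (8 / 3 * N + 2 * N)" by simp
  have b2: "\<beta>\<^sup>2 \<le> 1" using p by (simp add: power_le_one)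
  \<comment> \<open>Here t \<beta>^2 is \<gamma> D^2. One factor \<beta> goes to the pressure,
    because \<open>h3\<close> controls only \<beta> P; the remaining powers of \<beta> are at most
    1.\<close>
  have "t * \<beta>\<^sup>2 * (U + S + P) = \<beta>\<^sup>2 * (t * U) + \<beta>\<^sup>2 * (t * S) + \<beta> * (t * (\<beta> * P))"
    by (simp add: algebra_simps power2_eq_square)
  also have "\<dots> \<le> 1 * (8 / 3 * N) + 1 * (2 * N) + 1 * (N + k * (8 / 3 * N) + s * (2 * N) + (1 / 18) * (8 / 3 * N + 2 * N))"
  proof -
    have "\<beta>\<^sup>2 * (t * U) \<le> 1 * (8 / 3 * N)" "\<beta>\<^sup>2 * (t * S) \<le> 1 * (2 * N)"
      by (rule mult_mono; use tU tS b2 t nn in simp)+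
    moreover have "\<beta> * (t * (\<beta> * P))
        \<le> 1 * (N + k * (8 / 3 * N) + s * (2 * N) + (1 / 18) * (8 / 3 * N + 2 * N))"
      using tP p t nn by (intro mult_mono) auto
    ultimately show ?thesis by linarith
  qed
  \<comment> \<open>The constant term is 8/3 + 2 + 1 + 7/27, less than 6. All coefficients are
    rounded up to 8, which gives twice 4 + 4 k + 4 s, a part of the expansion of (k + s +
    2)^2.\<close>
  also have "\<dots> \<le> (8 + 8 * k + 8 * s) * N"
  proof -
    have "0 \<le> k * N" "0 \<le> s * N" using p s nn by auto
    then show ?thesis using nn by (simp add: algebra_simps)
  qed
  also have "\<dots> \<le> 2 * D\<^sup>2 * N"
  proof (rule mult_right_mono)
    have "(k + s + 2)\<^sup>2 \<le> D\<^sup>2" using p s by (intro power_mono) (auto simp: D_def)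
    moreover have "4 + 4 * k + 4 * s \<le> (k + s + 2)\<^sup>2"
      using p s by (simp add: power2_eq_square algebra_simps)
    ultimately show "8 + 8 * k + 8 * s \<le> 2 * D\<^sup>2" by linarith
  qed (use nn in simp)
  finally have "\<gamma> * (U + S + P) \<le> 2 * N" using D by (simp add: g' divide_le_eq mult.commute mult.left_commute)
  then show ?thesis using gb by (simp add: field_simps)
qed

locale small_data = cbf +
  fixes f :: "real^3 \<Rightarrow> real^3" and \<gamma> :: real
  assumes f: "f \<in> Lp 2 \<Omega>"
    and gamma: "\<gamma> = min (2 * inverse \<kappa>max) (min \<nu> 1) * \<beta>\<^sup>2 / (\<beta> + inverse \<kappa>min + sqrt \<nu> + 2)\<^sup>2"
    and small: "4 / \<gamma>\<^sup>2 * C\<^sup>2 * (1 / sqrt \<nu> + F) * Lp_norm 2 \<Omega> f < 1"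
begin

section \<open>Consequences of small data and the a priori estimates\<close>

lemma parameters: "0 < inverse \<kappa>max" "0 < inverse \<kappa>min" "0 < \<nu>" "0 < \<beta>" "\<beta> \<le> 1"
  using kappa_order kappa pos beta_pos beta_le_1 by auto

lemmas gammas = gamma_bounds[OF parameters gamma, folded \<alpha>_def]

abbreviation "K \<equiv> K_set \<Omega> \<gamma> f"

abbreviation "solves \<equiv> is_solution \<Omega> \<nu> F \<kappa> f"

lemma K_V: "w \<in> K \<Longrightarrow> w \<in> V_space \<Omega>"
  by (simp add: K_set_def)

lemma radius_small: "C\<^sup>2 * (1 / sqrt \<nu> + F) * (2 / \<gamma> * Lp_norm 2 \<Omega> f) \<le> \<gamma> / 2"
proof -
  have "C\<^sup>2 * (1 / sqrt \<nu> + F) * (2 / \<gamma> * Lp_norm 2 \<Omega> f)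
      = \<gamma> / 2 * (4 / \<gamma>\<^sup>2 * C\<^sup>2 * (1 / sqrt \<nu> + F) * Lp_norm 2 \<Omega> f)"
    using gammas(1) by (simp add: power2_eq_square)
  also have "\<dots> \<le> \<gamma> / 2 * 1" using small gammas(1) by (intro mult_left_mono) auto
  finally show ?thesis by simp
qed

text \<open>The first bound is the smallness condition multiplied by \<gamma> / 2. For the second, F
  is dropped and sqrt \<nu> is moved to the right, after which 2 sqrt \<nu> \<gamma> \<le> \<alpha>
  is precisely what remains to be used.\<close>

lemma K_small:
  assumes w: "w \<in> K"
  shows "C\<^sup>2 * (1 / sqrt \<nu> + F) * V_norm \<Omega> w \<le> \<gamma> / 2" "4 * C\<^sup>2 * V_norm \<Omega> w \<le> \<alpha>"
proof -
  have s: "0 < sqrt \<nu>" using pos by simp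
  have "C\<^sup>2 * (1 / sqrt \<nu> + F) * V_norm \<Omega> w \<le> C\<^sup>2 * (1 / sqrt \<nu> + F) * (2 / \<gamma> * Lp_norm 2 \<Omega> f)"
    using w s pos by (intro mult_left_mono) (auto simp: K_set_def)
  then show 1: "C\<^sup>2 * (1 / sqrt \<nu> + F) * V_norm \<Omega> w \<le> \<gamma> / 2" using radius_small by linarith
  have "C\<^sup>2 * (1 / sqrt \<nu>) * V_norm \<Omega> w \<le> C\<^sup>2 * (1 / sqrt \<nu> + F) * V_norm \<Omega> w"
    using pos V_norm_ge(4) by (intro mult_left_mono mult_right_mono) auto
  then have "C\<^sup>2 * (1 / sqrt \<nu>) * V_norm \<Omega> w \<le> \<gamma> / 2" using 1 by linarith
  then have "C\<^sup>2 * V_norm \<Omega> w \<le> sqrt \<nu> * \<gamma> / 2" using s by (simp add: field_simps)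
  then show "4 * C\<^sup>2 * V_norm \<Omega> w \<le> \<alpha>" using gammas(3) by simp
qed

lemma div_free_pairing:
  assumes "p \<in> L20 \<Omega>" "u \<in> V_space \<Omega>" "AE x in lebesgue_on \<Omega>. weak_div \<Omega> u x = 0"
  shows "l2ip \<Omega> p (weak_div \<Omega> u) = 0"
proof -
  have "l2ip \<Omega> p (weak_div \<Omega> u) = l2ip \<Omega> p (\<lambda>x. 0)"
    using assms L20_Lp2 V_Lp2 Lp2_zero by (intro l2ip_cong) auto
  then show ?thesis by (simp add: l2ip_def)
qed

text \<open>Testing with u removes the pressure and bounds velocity and vorticity by coercivity. The
  momentum equation, solved for the pressure term, then bounds the pressure through the inf-sup
  condition; each trilinear term contributes at most \<gamma> / 2.\<close>

lemma apriori:
  assumes w: "w \<in> K" and sol: "solves w u \<omega> p"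
  shows "prod_norm \<Omega> u \<omega> p \<le> 2 / \<gamma> * Lp_norm 2 \<Omega> f"
proof -
  note wV = K_V[OF w]
  have u: "u \<in> V_space \<Omega>" and om: "\<omega> \<in> Lp 2 \<Omega>" and p: "p \<in> L20 \<Omega>"
    and e: "AE x in lebesgue_on \<Omega>. \<omega> x = sqrt \<nu> *\<^sub>R weak_curl \<Omega> u x"
    and d: "AE x in lebesgue_on \<Omega>. weak_div \<Omega> u x = 0"
    and eq: "\<And>v. v \<in> V_space \<Omega> \<Longrightarrow> B w u v - l2ip \<Omega> p (weak_div \<Omega> v) = l2ip \<Omega> f v"
    using sol unfolding is_solution_iff[OF wV] by auto
  note U = V_Lp2[OF u]
  let ?U = "V_norm \<Omega> u" and ?S = "Lp_norm 2 \<Omega> \<omega>" and ?N = "Lp_norm 2 \<Omega> f" and ?W = "C\<^sup>2 * V_norm \<Omega> w"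
  have s: "0 < sqrt \<nu>" "sqrt \<nu> * sqrt \<nu> = \<nu>" using pos by auto
  have W: "?W * (1 / sqrt \<nu>) \<le> \<gamma> / 2" "?W * F \<le> \<gamma> / 2"
  proof -
    have "?W * (1 / sqrt \<nu>) + ?W * F \<le> \<gamma> / 2" using K_small(1)[OF w] by (simp add: algebra_simps)
    moreover have "0 \<le> ?W * (1 / sqrt \<nu>)" "0 \<le> ?W * F" using pos V_norm_ge(4) by auto
    ultimately show "?W * (1 / sqrt \<nu>) \<le> \<gamma> / 2" "?W * F \<le> \<gamma> / 2" by linarith+
  qed
  have "3 / 4 * energy u \<le> B w u u" by (rule B_coercive[OF wV K_small(2)[OF w] u d])
  also have "\<dots> = l2ip \<Omega> f u" using eq[OF u] div_free_pairing[OF p u d] by simp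
  also have "\<dots> \<le> ?N * ?U" using l2ip_le[OF f U(1) order_refl V_norm_ge(1)] by simp
  finally have en: "3 / 4 * energy u \<le> ?N * ?U" .
  have S2: "?S\<^sup>2 = \<nu> * l2ip \<Omega> (weak_curl \<Omega> u) (weak_curl \<Omega> u)"
    using l2ip_vorticity[OF u om om e] l2ip_vorticity[OF u om U(3) e] s
    by (simp add: Lp_norm_2_sq l2ip_commute[of _ "weak_curl \<Omega> u" \<omega>] flip: mult.assoc)
  have "0 \<le> inverse \<kappa>max * l2ip \<Omega> u u" using kappa_order by (simp add: l2ip_self)
  then have "?S\<^sup>2 \<le> energy u" by (simp add: energy_def S2)
  then have h2: "3 / 4 * ?S\<^sup>2 \<le> ?N * ?U" using en by simp
  have h1: "3 / 4 * (min (inverse \<kappa>max) \<nu> * ?U\<^sup>2) \<le> ?N * ?U"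
    using energy_ge[OF u d] en by (simp add: \<alpha>_def)
  \<comment> \<open>A bound for the functional v \<mapsto> (f, v) - B w u v, with one summand each
    for the data, the resistance, the viscosity expressed through \<omega>, and the two trilinear
    terms together.\<close>
  define M where "M = ?N + inverse \<kappa>min * ?U + sqrt \<nu> * ?S + \<gamma> / 2 * (?U + ?S)"
  have "\<beta> * Lp_norm 2 \<Omega> p \<le> M"
  proof (rule inf_sup[OF p])
    show "0 \<le> M" unfolding M_def using parameters s gammas(1) V_norm_ge(4)[of u] by simp
    fix v assume v: "v \<in> V_space \<Omega>"
    note V = V_Lp2[OF v]
    let ?V = "V_norm \<Omega> v"
    have V0: "0 \<le> ?V" and U0: "0 \<le> ?U" by (rule V_norm_ge)+
    have 1: "\<bar>l2ip \<Omega> f v\<bar> \<le> ?N * ?V" by (rule l2ip_le[OF f V(1) order_refl V_norm_ge(1)])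
    have 2: "\<bar>l2ip \<Omega> (ki u) v\<bar> \<le> (inverse \<kappa>min * ?U) * ?V"
    proof (rule l2ip_le[OF ki_L2(1)[OF U(1)] V(1) _ V_norm_ge(1)])
      have "inverse \<kappa>min * Lp_norm 2 \<Omega> u \<le> inverse \<kappa>min * ?U"
        using parameters V_norm_ge by (intro mult_left_mono) auto
      then show "Lp_norm 2 \<Omega> (ki u) \<le> inverse \<kappa>min * ?U" using ki_L2(2)[OF U(1)] by linarith
    qed
    have "\<nu> * l2ip \<Omega> (weak_curl \<Omega> u) (weak_curl \<Omega> v) = sqrt \<nu> * l2ip \<Omega> \<omega> (weak_curl \<Omega> v)"
      using l2ip_vorticity[OF u om V(3) e] s by (simp flip: mult.assoc)
    moreover have "\<bar>l2ip \<Omega> \<omega> (weak_curl \<Omega> v)\<bar> \<le> ?S * ?V"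
      by (rule l2ip_le[OF om V(3) order_refl V_norm_ge(3)])
    ultimately have 3: "\<bar>\<nu> * l2ip \<Omega> (weak_curl \<Omega> u) (weak_curl \<Omega> v)\<bar> \<le> sqrt \<nu> * (?S * ?V)"
      using s by (simp add: abs_mult)
    have "l2ip \<Omega> (weak_curl \<Omega> u) (cr w v) = (1 / sqrt \<nu>) * l2ip \<Omega> \<omega> (cr w v)"
      using l2ip_vorticity[OF u om cr_L2(1)[OF wV v] e] s by simp
    moreover have "\<bar>l2ip \<Omega> \<omega> (cr w v)\<bar> \<le> ?S * (?W * ?V)"
      by (rule l2ip_le[OF om cr_L2(1)[OF wV v] order_refl cr_L2(2)[OF wV v]])
    ultimately have "\<bar>l2ip \<Omega> (weak_curl \<Omega> u) (cr w v)\<bar> \<le> (1 / sqrt \<nu>) * (?S * (?W * ?V))"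
      using s by (simp add: abs_mult divide_right_mono)
    also have "\<dots> = (?W * (1 / sqrt \<nu>)) * (?S * ?V)" by simp
    also have "\<dots> \<le> \<gamma> / 2 * (?S * ?V)" using W V0 by (intro mult_right_mono) auto
    finally have 4: "\<bar>l2ip \<Omega> (weak_curl \<Omega> u) (cr w v)\<bar> \<le> \<gamma> / 2 * (?S * ?V)" .
    have "\<bar>F * l2ip \<Omega> u (nm w v)\<bar> \<le> F * (?U * (?W * ?V))"
      using l2ip_le[OF U(1) nm_L2(1)[OF wV v] V_norm_ge(1) nm_L2(2)[OF wV v]] pos by (simp add: abs_mult)
    also have "\<dots> = (?W * F) * (?U * ?V)" by simp
    also have "\<dots> \<le> \<gamma> / 2 * (?U * ?V)" using W V0 U0 by (intro mult_right_mono) auto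
    finally have 5: "\<bar>F * l2ip \<Omega> u (nm w v)\<bar> \<le> \<gamma> / 2 * (?U * ?V)" .
    have "- l2ip \<Omega> p (weak_div \<Omega> v) = l2ip \<Omega> f v - B w u v" using eq[OF v] by simp
    also have "\<dots> \<le> ?N * ?V + (inverse \<kappa>min * ?U) * ?V + sqrt \<nu> * (?S * ?V) + \<gamma> / 2 * (?S * ?V) + \<gamma> / 2 * (?U * ?V)"
      using 1 2 3 4 5 unfolding B_def by linarith
    also have "\<dots> = M * ?V" by (simp add: M_def algebra_simps)
    finally show "- l2ip \<Omega> p (weak_div \<Omega> v) \<le> M * ?V" .
  qed
  then show ?thesis
    unfolding prod_norm_def M_def
    by (intro apriori_arith[OF parameters gamma _ _ _ _ h1 h2]) (auto simp: V_norm_ge)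
qed

lemma solution_in_K:
  assumes w: "w \<in> K" and sol: "solves w u \<omega> p"
  shows "u \<in> K"
proof -
  have "V_norm \<Omega> u \<le> prod_norm \<Omega> u \<omega> p" by (simp add: prod_norm_def)
  then show ?thesis using apriori[OF assms] sol by (simp add: K_set_def is_solution_def)
qed

lemma solution_lipschitz:
  assumes w1: "w1 \<in> K" and s1: "solves w1 u1 \<omega>1 p1" and w2: "w2 \<in> K" and s2: "solves w2 u2 \<omega>2 p2"
  shows "V_norm \<Omega> (fun_axpy (-1) u2 u1) \<le> 4 / 27 * V_norm \<Omega> (fun_axpy (-1) w2 w1)"
proof -
  note V1 = K_V[OF w1] and V2 = K_V[OF w2]
  have u1: "u1 \<in> V_space \<Omega>" "p1 \<in> L20 \<Omega>" "AE x in lebesgue_on \<Omega>. weak_div \<Omega> u1 x = 0"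
    "\<And>v. v \<in> V_space \<Omega> \<Longrightarrow> B w1 u1 v - l2ip \<Omega> p1 (weak_div \<Omega> v) = l2ip \<Omega> f v"
    using s1 unfolding is_solution_iff[OF V1] by auto
  have u2: "u2 \<in> V_space \<Omega>" "p2 \<in> L20 \<Omega>" "AE x in lebesgue_on \<Omega>. weak_div \<Omega> u2 x = 0"
    "\<omega>2 \<in> Lp 2 \<Omega>" "AE x in lebesgue_on \<Omega>. \<omega>2 x = sqrt \<nu> *\<^sub>R weak_curl \<Omega> u2 x"
    "\<And>v. v \<in> V_space \<Omega> \<Longrightarrow> B w2 u2 v - l2ip \<Omega> p2 (weak_div \<Omega> v) = l2ip \<Omega> f v"
    using s2 unfolding is_solution_iff[OF V2] by auto
  let ?d = "fun_axpy (-1) u2 u1" and ?w = "fun_axpy (-1) w2 w1"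
  have dV: "?d \<in> V_space \<Omega>" by (rule V_axpy(1)[OF u2(1) u1(1)])
  have wV: "?w \<in> V_space \<Omega>" by (rule V_axpy(1)[OF V2 V1])
  have d0: "AE x in lebesgue_on \<Omega>. weak_div \<Omega> ?d x = 0"
    using V_axpy(2)[OF u2(1) u1(1), of "-1"] u1(3) u2(3) by eventually_elim (simp add: fun_axpy_def)
  have eq: "B w1 u1 ?d = B w2 u2 ?d"
    using u1(4)[OF dV] u2(6)[OF dV] div_free_pairing[OF u1(2) dV d0] div_free_pairing[OF u2(2) dV d0] by simp
  let ?N = "2 / \<gamma> * Lp_norm 2 \<Omega> f" and ?D = "V_norm \<Omega> ?d" and ?W = "V_norm \<Omega> ?w" and ?S = "Lp_norm 2 \<Omega> \<omega>2"
  have D0: "0 \<le> ?D" and W0: "0 \<le> ?W" by (rule V_norm_ge)+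
  have crd: "cr w1 ?d = fun_axpy 1 (cr ?w ?d) (cr w2 ?d)"
    by (simp add: fun_eq_iff cr_def fun_axpy_def cross3_simps)
  have "\<alpha> * ?D\<^sup>2 \<le> 4 / 3 * B w1 ?d ?d"
    using energy_ge[OF dV d0] B_coercive[OF V1 K_small(2)[OF w1] dV d0] by linarith
  also have "B w1 ?d ?d = B w2 u2 ?d - B w1 u2 ?d"
    using B_axpy_left[OF V1 u2(1) u1(1) dV, of "-1"] eq by simp
  also have "\<dots> = l2ip \<Omega> (weak_curl \<Omega> u2) (cr ?w ?d) - F * (l2ip \<Omega> u2 (nm w1 ?d) - l2ip \<Omega> u2 (nm w2 ?d))"
    unfolding B_def crd using V_Lp2[OF u2(1)] cr_L2(1)[OF wV dV] cr_L2(1)[OF V2 dV]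
    by (simp add: l2ip_axpy_right algebra_simps)
  also have "\<dots> \<le> C\<^sup>2 * (1 / sqrt \<nu> + F) * ?N * ?W * ?D"
  proof -
    have s: "0 < sqrt \<nu>" using pos by simp
    have ap: "V_norm \<Omega> u2 \<le> ?N" "?S \<le> ?N"
      using apriori[OF w2 s2] V_norm_ge(4)[of u2] Lp_norm_nonneg[of \<Omega> \<omega>2] Lp_norm_nonneg[of \<Omega> p2]
      unfolding prod_norm_def by linarith+
    have "l2ip \<Omega> (weak_curl \<Omega> u2) (cr ?w ?d) = (1 / sqrt \<nu>) * l2ip \<Omega> \<omega>2 (cr ?w ?d)"
      using l2ip_vorticity[OF u2(1) u2(4) cr_L2(1)[OF wV dV] u2(5)] s by simp
    also have "\<dots> \<le> (1 / sqrt \<nu>) * (?N * (C\<^sup>2 * ?W * ?D))"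
      using l2ip_le[OF u2(4) cr_L2(1)[OF wV dV] ap(2) cr_L2(2)[OF wV dV]] s by (intro mult_left_mono) auto
    finally have 1: "l2ip \<Omega> (weak_curl \<Omega> u2) (cr ?w ?d) \<le> (1 / sqrt \<nu>) * (?N * (C\<^sup>2 * ?W * ?D))" .
    let ?n = "\<lambda>x. nm w1 ?d x - nm w2 ?d x"
    note n1 = nm_L2(1)[OF V1 dV] and n2 = nm_L2(1)[OF V2 dV]
    have nL: "?n \<in> Lp 2 \<Omega>" by (rule Lp2_diff[OF n1 n2])
    have le: "norm (?n x) \<le> norm (nm ?w ?d x)" for x
    proof -
      have "?n x = (norm (w1 x) - norm (w2 x)) *\<^sub>R ?d x" by (simp add: nm_def scaleR_left_diff_distrib)
      moreover have "\<bar>norm (w1 x) - norm (w2 x)\<bar> \<le> norm (?w x)"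
        using norm_triangle_ineq3[of "w1 x" "w2 x"] by (simp add: fun_axpy_def)
      ultimately show ?thesis by (simp add: nm_def mult_right_mono)
    qed
    have nn: "Lp_norm 2 \<Omega> ?n \<le> C\<^sup>2 * ?W * ?D"
      using Lp_norm_mono(2)[OF nm_L2(1)[OF wV dV] Lp_measurable[OF nL] le] nm_L2(2)[OF wV dV] by linarith
    have "l2ip \<Omega> u2 ?n = l2ip \<Omega> u2 (nm w1 ?d) - l2ip \<Omega> u2 (nm w2 ?d)"
      using l2ip_axpy_right[OF n2 n1 V_Lp2(1)[OF u2(1)], of "-1"] by (simp add: fun_axpy_def)
    moreover have "\<bar>l2ip \<Omega> u2 ?n\<bar> \<le> ?N * (C\<^sup>2 * ?W * ?D)"
      using V_norm_ge(1)[of u2] ap by (intro l2ip_le V_Lp2 u2 nL nn) auto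
    ultimately have "F * (l2ip \<Omega> u2 (nm w2 ?d) - l2ip \<Omega> u2 (nm w1 ?d)) \<le> F * (?N * (C\<^sup>2 * ?W * ?D))"
      using pos by (intro mult_left_mono) auto
    then show ?thesis using 1 by (simp add: algebra_simps)
  qed
  also have "\<dots> \<le> \<gamma> / 2 * ?W * ?D"
    using radius_small D0 W0 by (intro mult_right_mono) auto
  also have "\<dots> \<le> \<alpha> / 9 * ?W * ?D"
    using gammas(2) D0 W0 by (intro mult_right_mono) auto
  finally have "\<alpha> * ?D\<^sup>2 \<le> 4 / 3 * (\<alpha> / 9 * ?W * ?D)" by simp
  then have "\<alpha> * (?D * ?D) \<le> \<alpha> * (4 / 27 * ?W * ?D)" by (simp add: power2_eq_square)
  then have "?D * ?D \<le> (4 / 27 * ?W) * ?D" using alpha_pos by simp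
  then show ?thesis using D0 W0
    by (metis less_eq_real_def mult_nonneg_nonneg mult_right_le_imp_le zero_le_divide_iff zero_le_numeral)
qed

section \<open>Invariance under changes on null sets, and uniqueness for the linearised
  problem\<close>

lemma V_dist_self: "w \<in> V_space \<Omega> \<Longrightarrow> V_norm \<Omega> (fun_axpy (-1) w w) = 0"
  by (simp add: V_diff_norm_eq_0)

lemma B_cong:
  assumes "w \<in> V_space \<Omega>" "w' \<in> V_space \<Omega>" "u \<in> V_space \<Omega>" "u' \<in> V_space \<Omega>" "v \<in> V_space \<Omega>"
    and e: "AE x in lebesgue_on \<Omega>. w x = w' x" "AE x in lebesgue_on \<Omega>. u x = u' x"
  shows "B w u v = B w' u' v"
proof -
  note U = V_Lp2[OF assms(3)] V_Lp2[OF assms(4)] V_Lp2[OF assms(5)]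
  note c = V_ae_eq(2)[OF assms(3,4) e(2)]
  have 1: "l2ip \<Omega> (ki u) v = l2ip \<Omega> (ki u') v"
    using e(2) U ki_L2(1) by (intro l2ip_cong) (auto simp: ki_def[abs_def] elim: eventually_mono)
  have 2: "l2ip \<Omega> (weak_curl \<Omega> u) (weak_curl \<Omega> v) = l2ip \<Omega> (weak_curl \<Omega> u') (weak_curl \<Omega> v)"
    using c U by (intro l2ip_cong) auto
  have 3: "l2ip \<Omega> (weak_curl \<Omega> u) (cr w v) = l2ip \<Omega> (weak_curl \<Omega> u') (cr w' v)"
    using c U e(1) cr_L2(1)[OF assms(1,5)] cr_L2(1)[OF assms(2,5)]
    by (intro l2ip_cong) (auto simp: cr_def[abs_def] elim: eventually_mono)
  have 4: "l2ip \<Omega> u (nm w v) = l2ip \<Omega> u' (nm w' v)"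
    using e U nm_L2(1)[OF assms(1,5)] nm_L2(1)[OF assms(2,5)]
    by (intro l2ip_cong) (auto simp: nm_def[abs_def] elim: eventually_mono)
  show ?thesis by (simp add: B_def 1 2 3 4)
qed

text \<open>A fixed point agrees with its image only almost everywhere; this lets one be substituted
  for the other, both as frozen velocity and as solution.\<close>

lemma solves_cong:
  assumes "w \<in> V_space \<Omega>" "w' \<in> V_space \<Omega>" "u' \<in> V_space \<Omega>" and s: "solves w u \<omega> p"
    and e: "AE x in lebesgue_on \<Omega>. w x = w' x" "AE x in lebesgue_on \<Omega>. u x = u' x"
  shows "solves w' u' \<omega> p"
proof -
  have u: "u \<in> V_space \<Omega>" using s by (simp add: is_solution_def)
  have "AE x in lebesgue_on \<Omega>. \<omega> x = sqrt \<nu> *\<^sub>R weak_curl \<Omega> u' x"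
    if "AE x in lebesgue_on \<Omega>. \<omega> x = sqrt \<nu> *\<^sub>R weak_curl \<Omega> u x"
    using that V_ae_eq(2)[OF u assms(3) e(2)] by eventually_elim simp
  moreover have "AE x in lebesgue_on \<Omega>. weak_div \<Omega> u' x = 0" if "AE x in lebesgue_on \<Omega>. weak_div \<Omega> u x = 0"
    using that V_ae_eq(1)[OF u assms(3) e(2)] by eventually_elim simp
  moreover have "B w' u' v = B w u v" if "v \<in> V_space \<Omega>" for v
    using B_cong[OF assms(1,2) u assms(3) that e] by simp
  ultimately show ?thesis using s assms(3) unfolding is_solution_iff[OF assms(1)] is_solution_iff[OF assms(2)]
    by simp
qed

text \<open>For the velocity, the Lipschitz estimate with equal frozen velocities. The vorticity
  follows from the velocity, and the difference of the pressures is annihilated by every div v, so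
  the inf-sup condition applies with M = 0.\<close>

lemma linear_unique:
  assumes w: "w \<in> K" and s1: "solves w u1 \<omega>1 p1" and s2: "solves w u2 \<omega>2 p2"
  shows "eq_ae \<Omega> u1 u2" "eq_ae \<Omega> \<omega>1 \<omega>2" "eq_ae \<Omega> p1 p2"
proof -
  note wV = K_V[OF w]
  have u1: "u1 \<in> V_space \<Omega>" "p1 \<in> L20 \<Omega>" "AE x in lebesgue_on \<Omega>. \<omega>1 x = sqrt \<nu> *\<^sub>R weak_curl \<Omega> u1 x"
    "\<And>v. v \<in> V_space \<Omega> \<Longrightarrow> B w u1 v - l2ip \<Omega> p1 (weak_div \<Omega> v) = l2ip \<Omega> f v"
    using s1 unfolding is_solution_iff[OF wV] by auto
  have u2: "u2 \<in> V_space \<Omega>" "p2 \<in> L20 \<Omega>" "AE x in lebesgue_on \<Omega>. \<omega>2 x = sqrt \<nu> *\<^sub>R weak_curl \<Omega> u2 x"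
    "\<And>v. v \<in> V_space \<Omega> \<Longrightarrow> B w u2 v - l2ip \<Omega> p2 (weak_div \<Omega> v) = l2ip \<Omega> f v"
    using s2 unfolding is_solution_iff[OF wV] by auto
  have "V_norm \<Omega> (fun_axpy (-1) u2 u1) = 0"
    using solution_lipschitz[OF w s1 w s2] V_dist_self[OF wV] V_norm_ge(4)[of "fun_axpy (-1) u2 u1"] by simp
  then have e: "AE x in lebesgue_on \<Omega>. u1 x = u2 x" using V_diff_norm_eq_0[OF u1(1) u2(1)] by simp
  then show "eq_ae \<Omega> u1 u2" by (simp add: eq_ae_def)
  show "eq_ae \<Omega> \<omega>1 \<omega>2"
    unfolding eq_ae_def using u1(3) u2(3) V_ae_eq(2)[OF u1(1) u2(1) e] by eventually_elim simp
  have P: "p1 \<in> Lp 2 \<Omega>" "p2 \<in> Lp 2 \<Omega>" using u1 u2 L20_Lp2 by auto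
  let ?p = "fun_axpy (-1) p2 p1"
  have pQ: "?p \<in> L20 \<Omega>" using semi_hilbert.axpy_in[OF semi_hilbert_L20] u1(2) u2(2) by blast
  have "\<beta> * Lp_norm 2 \<Omega> ?p \<le> 0"
  proof (rule inf_sup[OF pQ])
    fix v assume v: "v \<in> V_space \<Omega>"
    have "B w u1 v = B w u2 v" by (rule B_cong[OF wV wV u1(1) u2(1) v _ e]) simp
    then have "l2ip \<Omega> ?p (weak_div \<Omega> v) = 0"
      using u1(4)[OF v] u2(4)[OF v] l2ip_axpy[OF P(2,1) V_Lp2(2)[OF v], of "-1"] by simp
    then show "- l2ip \<Omega> ?p (weak_div \<Omega> v) \<le> 0 * V_norm \<Omega> v" by simp
  qed simp
  then have "Lp_norm 2 \<Omega> ?p = 0"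
    using beta_pos Lp_norm_nonneg[of \<Omega> ?p] by (simp add: mult_le_0_iff)
  then have "AE x in lebesgue_on \<Omega>. ?p x = 0"
    using l2ip_self_eq_0_iff[OF L20_Lp2[OF pQ]] by (simp add: Lp_norm_2)
  then show "eq_ae \<Omega> p1 p2" unfolding eq_ae_def by eventually_elim (simp add: fun_axpy_def)
qed

section \<open>The solution map, its fixed point, and uniqueness for the nonlinear problem\<close>

abbreviation "T \<equiv> fixpoint_map \<Omega> \<nu> F \<kappa> f"

lemma T_solves:
  assumes "w \<in> K"
  obtains \<omega> p where "solves w (T w) \<omega> p"
proof -
  have "\<exists>u \<omega> p. solves w u \<omega> p" by (rule linear_exists[OF K_V[OF assms] K_small(2)[OF assms] f])
  then have "\<exists>\<omega> p. solves w (T w) \<omega> p" unfolding fixpoint_map_def by (rule someI_ex)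
  then show ?thesis using that by blast
qed

lemma T_K: "w \<in> K \<Longrightarrow> T w \<in> K"
  using T_solves solution_in_K by metis

text \<open>The value of \<open>T\<close> is some velocity solving the linearised problem. If u
  solves the problem with itself frozen, uniqueness is needed to conclude that the chosen velocity
  agrees with u.\<close>

lemma fixed_point_iff:
  assumes u: "u \<in> K"
  shows "eq_ae \<Omega> (T u) u \<longleftrightarrow> (\<exists>\<omega> p. solves u u \<omega> p)"
proof
  obtain \<omega> p where s: "solves u (T u) \<omega> p" using T_solves[OF u] .
  show "\<exists>\<omega> p. solves u u \<omega> p" if "eq_ae \<Omega> (T u) u"
    using solves_cong[OF K_V[OF u] K_V[OF u] K_V[OF u] s] that by (auto simp: eq_ae_def)
  show "eq_ae \<Omega> (T u) u" if "\<exists>\<omega> p. solves u u \<omega> p"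
    using linear_unique(1)[OF u s] that by blast
qed

lemma fixed_point_exists: "\<exists>u\<in>K. eq_ae \<Omega> (T u) u"
proof -
  interpret V: semi_hilbert "V_space \<Omega>" fun_axpy V_ip by (rule semi_hilbert_V)
  have "\<exists>u\<in>K. V.dst (T u) u = 0"
  proof (rule V.contraction_fixed_point[where c="4 / 27"])
    show "K \<subseteq> V_space \<Omega>" using K_V by blast
    have "V_norm \<Omega> (\<lambda>x. 0) = 0"
      using V_dist_self[OF zero_in_V] by (simp add: fun_axpy_def)
    then have "(\<lambda>x. 0) \<in> K" using zero_in_V gammas(1) by (simp add: K_set_def)
    then show "K \<noteq> {}" by blast
    show "x \<in> K" if X: "\<And>n. X n \<in> K" and x: "x \<in> V_space \<Omega>" and lim: "(\<lambda>n. V.dst (X n) x) \<longlonglongrightarrow> 0" for X x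
    proof -
      let ?R = "2 / \<gamma> * Lp_norm 2 \<Omega> f"
      \<comment> \<open>The norm is the distance to the zero field, so the triangle inequality shows
        that K is closed.\<close>
      have "V_norm \<Omega> x \<le> ?R + V.dst (X n) x" for n
      proof -
        let ?z = "\<lambda>x. 0 :: real^3"
        have z: "fun_axpy (-1) ?z u = u" for u by (simp add: fun_axpy_def)
        have "V.dst x ?z \<le> V.dst x (X n) + V.dst (X n) ?z" by (rule V.dst_triangle[OF x K_V[OF X] zero_in_V])
        then have "V_norm \<Omega> x \<le> V.dst x (X n) + V_norm \<Omega> (X n)" by (simp add: V_dst z)
        then show ?thesis using X[of n] V.dst_commute[OF x K_V[OF X], of n] by (simp add: K_set_def)
      qed
      moreover have "(\<lambda>n. ?R + V.dst (X n) x) \<longlonglongrightarrow> ?R + 0" by (intro tendsto_intros lim)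
      ultimately have "V_norm \<Omega> x \<le> ?R + 0" by (meson LIMSEQ_le_const)
      then show ?thesis using x by (simp add: K_set_def)
    qed
    show "T w \<in> K" if "w \<in> K" for w using that by (rule T_K)
    show "V.dst (T w1) (T w2) \<le> 4 / 27 * V.dst w1 w2" if w: "w1 \<in> K" "w2 \<in> K" for w1 w2
    proof -
      obtain \<omega>1 p1 where s1: "solves w1 (T w1) \<omega>1 p1" using T_solves[OF w(1)] .
      obtain \<omega>2 p2 where s2: "solves w2 (T w2) \<omega>2 p2" using T_solves[OF w(2)] .
      show ?thesis unfolding V_dst by (rule solution_lipschitz[OF w(1) s1 w(2) s2])
    qed
  qed auto
  then show ?thesis using V_diff_norm_eq_0 T_K K_V unfolding V_dst eq_ae_def by blast
qed

text \<open>With each solution as its own frozen velocity, the distance is at most 4/27 of itself,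
  hence 0. Then u2 may replace u1 in the first problem, and linear uniqueness compares vorticities
  and pressures.\<close>

lemma nonlinear_unique:
  assumes u1: "u1 \<in> K" "solves u1 u1 \<omega>1 p1" and u2: "u2 \<in> K" "solves u2 u2 \<omega>2 p2"
  shows "eq_ae \<Omega> u1 u2" "eq_ae \<Omega> \<omega>1 \<omega>2" "eq_ae \<Omega> p1 p2"
proof -
  note V = K_V[OF u1(1)] K_V[OF u2(1)]
  have "V_norm \<Omega> (fun_axpy (-1) u2 u1) = 0"
    using solution_lipschitz[OF u1 u2] V_norm_ge(4)[of "fun_axpy (-1) u2 u1"] by simp
  then have e: "AE x in lebesgue_on \<Omega>. u1 x = u2 x" using V_diff_norm_eq_0[OF V] by simp
  have "solves u2 u2 \<omega>1 p1" by (rule solves_cong[OF V V(2) u1(2) e e])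
  from linear_unique(2,3)[OF u2(1) this u2(2)] show "eq_ae \<Omega> \<omega>1 \<omega>2" "eq_ae \<Omega> p1 p2" .
  show "eq_ae \<Omega> u1 u2" using e by (simp add: eq_ae_def)
qed

end

text \<open>M bounds every quotient, as the norm of \<theta> only enlarges the denominator. A real
  supremum inherits an upper bound only over a nonempty set, so an admissible pair has to be
  exhibited.\<close>

lemma (in bounded_open) inf_sup_elim:
  assumes sup: "(SUP (v, \<theta>) \<in> {(v, \<theta>). v \<in> V_space \<Omega> \<and> \<theta> \<in> Lp 2 \<Omega> \<and>
                                  \<not> (eq_ae \<Omega> v (\<lambda>_. 0) \<and> eq_ae \<Omega> \<theta> (\<lambda>_. 0))}.
                form_b \<Omega> v \<theta> q / (V_norm \<Omega> v + Lp_norm 2 \<Omega> \<theta>)) \<ge> \<beta> * Lp_norm 2 \<Omega> q"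
    and ne: "\<Omega> \<noteq> {}" and M: "0 \<le> M"
    and le: "\<And>v. v \<in> V_space \<Omega> \<Longrightarrow> - l2ip \<Omega> q (weak_div \<Omega> v) \<le> M * V_norm \<Omega> v"
  shows "\<beta> * Lp_norm 2 \<Omega> q \<le> M"
proof -
  let ?A = "{(v, \<theta>). v \<in> V_space \<Omega> \<and> \<theta> \<in> Lp 2 \<Omega> \<and> \<not> (eq_ae \<Omega> v (\<lambda>_. 0 :: real^3) \<and> eq_ae \<Omega> \<theta> (\<lambda>_. 0 :: real^3))}"
  have "\<not> (AE x in lebesgue_on \<Omega>. (axis 1 1 :: real^3) = 0)"
  proof
    assume "AE x in lebesgue_on \<Omega>. (axis 1 1 :: real^3) = 0"
    then have "AE x in lebesgue_on \<Omega>. False" by (simp add: axis_eq_0_iff)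
    then have "AE x in lebesgue. x \<notin> \<Omega>" unfolding AE_restrict_space_iff[OF sets_dom] by simp
    then have "\<Omega> \<in> null_sets lebesgue" using open_dom by (subst (asm) AE_iff_null_sets[symmetric]) auto
    then show False using open_not_negligible[OF open_dom ne] by (simp add: negligible_iff_null_sets)
  qed
  \<comment> \<open>A constant vorticity makes the pair nonzero, so no nonzero element of V has to
    be constructed.\<close>
  then have "(\<lambda>_. 0, \<lambda>_. axis 1 1) \<in> ?A" using zero_in_V Lp2_const by (simp add: eq_ae_def)
  then have "?A \<noteq> {}" by blast
  moreover have "(case z of (v, \<theta>) \<Rightarrow> form_b \<Omega> v \<theta> q / (V_norm \<Omega> v + Lp_norm 2 \<Omega> \<theta>)) \<le> M" if zA: "z \<in> ?A" for z
  proof -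
    obtain v \<theta> where z: "z = (v, \<theta>)" "v \<in> V_space \<Omega>" using zA by (cases z) auto
    let ?n = "V_norm \<Omega> v + Lp_norm 2 \<Omega> \<theta>"
    have n: "0 \<le> ?n" using V_norm_ge(4)[of v] by simp
    have "form_b \<Omega> v \<theta> q \<le> M * V_norm \<Omega> v" using le[OF z(2)] by (simp add: form_b_def l2ip_def)
    also have "\<dots> \<le> M * ?n" using M by (intro mult_left_mono) auto
    \<comment> \<open>A quotient with denominator 0 has the default value 0, which is at most
      M.\<close>
    finally have "form_b \<Omega> v \<theta> q / ?n \<le> M" using n M by (cases "?n = 0") (auto simp: divide_le_eq)
    then show ?thesis using z by simp
  qed
  ultimately have "(SUP (v, \<theta>) \<in> ?A. form_b \<Omega> v \<theta> q / (V_norm \<Omega> v + Lp_norm 2 \<Omega> \<theta>)) \<le> M"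
    by (rule cSUP_least)
  then show ?thesis using sup by linarith
qed

theorem theorem3p5:
  fixes \<Omega> :: "(real^3) set"
    and \<nu> F \<kappa>min \<kappa>max C\<^sub>S \<beta> \<gamma> :: real
    and \<kappa> :: "real^3 \<Rightarrow> real"
    and f :: "real^3 \<Rightarrow> real^3"
  assumes domain: "polyhedral_lipschitz_domain \<Omega>"
    and pos: "0 < \<nu>" "0 < F"
    and kappa: "\<kappa> \<in> borel_measurable (lebesgue_on \<Omega>)" "0 < \<kappa>min"
          "AE x in lebesgue_on \<Omega>. \<kappa>min \<le> \<kappa> x \<and> \<kappa> x \<le> \<kappa>max"
    and sobolev: "0 < C\<^sub>S"
          "\<forall>w\<in>H1 \<Omega>. w \<in> Lp 4 \<Omega> \<and> Lp_norm 4 \<Omega> w \<le> C\<^sub>S * H1_norm \<Omega> w"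
    and inf_sup: "0 < \<beta>"
          "\<forall>q\<in>L20 \<Omega>.
             (SUP (v, \<theta>) \<in> {(v, \<theta>). v \<in> V_space \<Omega> \<and> \<theta> \<in> Lp 2 \<Omega> \<and>
                                  \<not> (eq_ae \<Omega> v (\<lambda>_. 0) \<and> eq_ae \<Omega> \<theta> (\<lambda>_. 0))}.
                form_b \<Omega> v \<theta> q / (V_norm \<Omega> v + Lp_norm 2 \<Omega> \<theta>))
             \<ge> \<beta> * Lp_norm 2 \<Omega> q"
    and gamma: "\<gamma> = min (2 * inverse \<kappa>max) (min \<nu> 1) * \<beta>\<^sup>2
                      / (\<beta> + inverse \<kappa>min + sqrt \<nu> + 2)\<^sup>2"
    and f: "f \<in> Lp 2 \<Omega>"
    and small: "4 / \<gamma>\<^sup>2 * C\<^sub>S\<^sup>2 * (1 / sqrt \<nu> + F) * Lp_norm 2 \<Omega> f < 1"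
  shows
    "(\<forall>u'\<in>K_set \<Omega> \<gamma> f.
        (\<exists>u \<omega> p. is_solution \<Omega> \<nu> F \<kappa> f u' u \<omega> p) \<and>
        (\<forall>u1 \<omega>1 p1 u2 \<omega>2 p2.
           is_solution \<Omega> \<nu> F \<kappa> f u' u1 \<omega>1 p1 \<and> is_solution \<Omega> \<nu> F \<kappa> f u' u2 \<omega>2 p2 \<longrightarrow>
           eq_ae \<Omega> u1 u2 \<and> eq_ae \<Omega> \<omega>1 \<omega>2 \<and> eq_ae \<Omega> p1 p2) \<and>
        fixpoint_map \<Omega> \<nu> F \<kappa> f u' \<in> K_set \<Omega> \<gamma> f) \<and>
     (\<exists>u\<in>K_set \<Omega> \<gamma> f. eq_ae \<Omega> (fixpoint_map \<Omega> \<nu> F \<kappa> f u) u \<and>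
        (\<forall>w\<in>K_set \<Omega> \<gamma> f. eq_ae \<Omega> (fixpoint_map \<Omega> \<nu> F \<kappa> f w) w \<longrightarrow> eq_ae \<Omega> w u)) \<and>
     (\<forall>u\<in>K_set \<Omega> \<gamma> f. eq_ae \<Omega> (fixpoint_map \<Omega> \<nu> F \<kappa> f u) u \<longleftrightarrow>
        (\<exists>\<omega> p. is_solution \<Omega> \<nu> F \<kappa> f u u \<omega> p)) \<and>
     (\<exists>u\<in>K_set \<Omega> \<gamma> f. \<exists>\<omega> p. is_solution \<Omega> \<nu> F \<kappa> f u u \<omega> p \<and>
        (\<forall>u1\<in>K_set \<Omega> \<gamma> f. \<forall>\<omega>1 p1. is_solution \<Omega> \<nu> F \<kappa> f u1 u1 \<omega>1 p1 \<longrightarrow>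
           eq_ae \<Omega> u1 u \<and> eq_ae \<Omega> \<omega>1 \<omega> \<and> eq_ae \<Omega> p1 p) \<and>
        prod_norm \<Omega> u \<omega> p \<le> 2 / \<gamma> * Lp_norm 2 \<Omega> f)"
proof -
  interpret bounded_open \<Omega>
    using domain by unfold_locales (auto simp: polyhedral_lipschitz_domain_def)
  have ne: "\<Omega> \<noteq> {}" using domain by (simp add: polyhedral_lipschitz_domain_def)
  interpret small_data \<Omega> \<nu> F \<kappa>min \<kappa>max C\<^sub>S \<beta> \<kappa> f \<gamma>
  proof (unfold_locales)
    show "\<beta> * Lp_norm 2 \<Omega> q \<le> M" if "q \<in> L20 \<Omega>" "0 \<le> M"
      "\<And>v. v \<in> V_space \<Omega> \<Longrightarrow> - l2ip \<Omega> q (weak_div \<Omega> v) \<le> M * V_norm \<Omega> v" for q M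
      by (rule inf_sup_elim[OF bspec[OF inf_sup(2) that(1)] ne that(2,3)])
  qed (rule ne pos kappa sobolev inf_sup(1) f gamma small)+
  obtain u where u: "u \<in> K" "eq_ae \<Omega> (T u) u" using fixed_point_exists by blast
  then obtain \<omega> p where s: "solves u u \<omega> p" using fixed_point_iff by blast
  have unique: "eq_ae \<Omega> u1 u \<and> eq_ae \<Omega> \<omega>1 \<omega> \<and> eq_ae \<Omega> p1 p" if "u1 \<in> K" "solves u1 u1 \<omega>1 p1" for u1 \<omega>1 p1
    using nonlinear_unique[OF that u(1) s] by blast
  show ?thesis
  proof (intro conjI ballI)
    show "\<exists>u \<omega> p. solves w u \<omega> p" if "w \<in> K" for w using T_solves[OF that] by blast
    show "\<forall>u1 \<omega>1 p1 u2 \<omega>2 p2. solves w u1 \<omega>1 p1 \<and> solves w u2 \<omega>2 p2 \<longrightarrow>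
        eq_ae \<Omega> u1 u2 \<and> eq_ae \<Omega> \<omega>1 \<omega>2 \<and> eq_ae \<Omega> p1 p2" if "w \<in> K" for w
      using linear_unique[OF that] by blast
    show "T w \<in> K" if "w \<in> K" for w using that by (rule T_K)
    show "\<exists>u\<in>K. eq_ae \<Omega> (T u) u \<and> (\<forall>w\<in>K. eq_ae \<Omega> (T w) w \<longrightarrow> eq_ae \<Omega> w u)"
      using u unique fixed_point_iff by blast
    show "eq_ae \<Omega> (T w) w = (\<exists>\<omega> p. solves w w \<omega> p)" if "w \<in> K" for w using that by (rule fixed_point_iff)
    show "\<exists>u\<in>K. \<exists>\<omega> p. solves u u \<omega> p \<and>
        (\<forall>u1\<in>K. \<forall>\<omega>1 p1. solves u1 u1 \<omega>1 p1 \<longrightarrow> eq_ae \<Omega> u1 u \<and> eq_ae \<Omega> \<omega>1 \<omega> \<and> eq_ae \<Omega> p1 p) \<and>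
        prod_norm \<Omega> u \<omega> p \<le> 2 / \<gamma> * Lp_norm 2 \<Omega> f"
      using u(1) s unique apriori[OF u(1) s] by blast
  qed
qed

end
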